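(* Let $p$ be a prime, let $\Phi=(\phi_1,\dots,\phi_k)$ be a system of linear forms $\phi_i\colon\mathbb{F}_p^d\to\mathbb{F}_p$, and let $i_0\in[k]$ be such that $s(\Phi)\le s(\Phi,i_0)+1$. Then there exists $M\ge0$ such that for every $n\ge1$ and all $1$-bounded functions $f_1,\dots,f_k\colon\mathbb{F}_p^n\to\mathbb{C}$, \[ \left|\Lambda_\Phi(f_1,\dots,f_k)\right|\le \|f_{i_0}\|_{U^{s(\Phi,i_0)+1}}^{2^{-M}}. \] Moreover, if $\phi_i(x_1,\dots,x_d)=\sum_j a_{ij}x_j$ with integers $|a_{ij}|\le L$, one may take $M\ll k^3(\log k+\log\log(10L))$ with an absolute implied constant.
   Context: A function is $1$-bounded if its absolute value is at most $1$. $\Lambda_\Phi(f_1,\dots,f_k)=\mathbb{E}_{x_1,\dots,x_d\in\mathbb{F}_p^n}\prod_i f_i(\phi_i(x_1,\dots,x_d))$ with $\phi_i$ applied coordinatewise. $\|f\|_{U^t}=\bigl(\mathbb{E}_{x,h_1,\dots,h_t\in\mathbb{F}_p^n}\prod_{\omega\in\{0,1\}^t}\mathcal{C}^{|\omega|}f(x+\sum_r\omega_rh_r)\bigr)^{1/2^t}$ ($\mathcal{C}$ = complex conjugation). For an index $i$, $s(\Phi,i)$ is the largest integer $t\ge0$ such that $\phi_i^{\otimes t}\in\operatorname{span}(\phi_j^{\otimes t}: j\ne i)$ in $((\mathbb{F}_p^d)^* )^{\otimes t}$ (assumed to exist, i.e. finite); $s(\Phi)=\max_i s(\Phi,i)$,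 equivalently the largest $t$ with $\phi_1^{\otimes t},\dots,\phi_k^{\otimes t}$ linearly dependent. *)

theory Defs
  imports Complex_Main "HOL-Library.FuncSet" "HOL-Number_Theory.Residues"
begin

abbreviation Fp :: "nat \<Rightarrow> int ring" where
  "Fp p \<equiv> residue_ring (int p)"

definition Fp_vec :: "nat \<Rightarrow> nat \<Rightarrow> (nat \<Rightarrow> int) set" where
  "Fp_vec p n = {..<n} \<rightarrow>\<^sub>E carrier (Fp p)"

definition expect :: "'a set \<Rightarrow> ('a \<Rightarrow> complex) \<Rightarrow> complex" where
  "expect A g = (\<Sum>x\<in>A. g x) / of_nat (card A)"

definition linear_form :: "nat \<Rightarrow> nat \<Rightarrow> ((nat \<Rightarrow> int) \<Rightarrow> int) \<Rightarrow> bool" where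
  "linear_form p d \<phi> \<longleftrightarrow>
     \<phi> \<in> Fp_vec p d \<rightarrow> carrier (Fp p) \<and>
     (\<forall>x\<in>Fp_vec p d. \<forall>y\<in>Fp_vec p d.
        \<phi> (\<lambda>j\<in>{..<d}. x j \<oplus>\<^bsub>Fp p\<^esub> y j) = \<phi> x \<oplus>\<^bsub>Fp p\<^esub> \<phi> y) \<and>
     (\<forall>c\<in>carrier (Fp p). \<forall>x\<in>Fp_vec p d.
        \<phi> (\<lambda>j\<in>{..<d}. c \<otimes>\<^bsub>Fp p\<^esub> x j) = c \<otimes>\<^bsub>Fp p\<^esub> \<phi> x)"

(* The t-th tensor power of the dual of F_p^d is identified with the space of t-linear
   forms on F_p^d: the t-th tensor power of \<phi> sends (v_0, ..., v_(t-1)) to the product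
   of the \<phi>(v_r).  For t = 0 it is the scalar 1. *)
definition tensor_power ::
    "nat \<Rightarrow> nat \<Rightarrow> ((nat \<Rightarrow> int) \<Rightarrow> int) \<Rightarrow> (nat \<Rightarrow> nat \<Rightarrow> int) \<Rightarrow> int" where
  "tensor_power p t \<phi> v = (\<Otimes>\<^bsub>Fp p\<^esub>r\<in>{..<t}. \<phi> (v r))"

definition tensor_power_in_span ::
    "nat \<Rightarrow> nat \<Rightarrow> nat \<Rightarrow> (nat \<Rightarrow> (nat \<Rightarrow> int) \<Rightarrow> int) \<Rightarrow> nat \<Rightarrow> nat \<Rightarrow> bool" where
  "tensor_power_in_span p d k \<Phi> i t \<longleftrightarrow>
     (\<exists>c \<in> {..<k} - {i} \<rightarrow> carrier (Fp p). \<forall>v \<in> {..<t} \<rightarrow>\<^sub>E Fp_vec p d.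
        tensor_power p t (\<Phi> i) v =
          (\<Oplus>\<^bsub>Fp p\<^esub>j\<in>{..<k} - {i}. c j \<otimes>\<^bsub>Fp p\<^esub> tensor_power p t (\<Phi> j) v))"

definition finite_s :: "nat \<Rightarrow> nat \<Rightarrow> nat \<Rightarrow> (nat \<Rightarrow> (nat \<Rightarrow> int) \<Rightarrow> int) \<Rightarrow> nat \<Rightarrow> bool" where
  "finite_s p d k \<Phi> i \<longleftrightarrow> finite {t. tensor_power_in_span p d k \<Phi> i t}"

(* Only meaningful under finite_s, where it is the maximum of the set.  For k \<ge> 2 the set
   contains 0; for k = 1 and a nonzero form it is empty, and the value is Sup {} = 0. *)
definition s_form :: "nat \<Rightarrow> nat \<Rightarrow> nat \<Rightarrow> (nat \<Rightarrow> (nat \<Rightarrow> int) \<Rightarrow> int) \<Rightarrow> nat \<Rightarrow> nat" where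
  "s_form p d k \<Phi> i = Sup {t. tensor_power_in_span p d k \<Phi> i t}"

definition s_system :: "nat \<Rightarrow> nat \<Rightarrow> nat \<Rightarrow> (nat \<Rightarrow> (nat \<Rightarrow> int) \<Rightarrow> int) \<Rightarrow> nat" where
  "s_system p d k \<Phi> = Max (s_form p d k \<Phi> ` {..<k})"

(* x j m is the m-th coordinate of the vector x_j in F_p^n *)
definition Lambda ::
    "nat \<Rightarrow> nat \<Rightarrow> nat \<Rightarrow> nat \<Rightarrow> (nat \<Rightarrow> (nat \<Rightarrow> int) \<Rightarrow> int) \<Rightarrow>
     (nat \<Rightarrow> (nat \<Rightarrow> int) \<Rightarrow> complex) \<Rightarrow> complex" where
  "Lambda p n d k \<Phi> f =
     expect ({..<d} \<rightarrow>\<^sub>E Fp_vec p n)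
       (\<lambda>x. \<Prod>i<k. f i (\<lambda>m\<in>{..<n}. \<Phi> i (\<lambda>j\<in>{..<d}. x j m)))"

(* W = {r. \<omega>_r = 1} replaces \<omega> in {0,1}^t.  For t \<ge> 1 the average is a nonnegative
   real number, so taking Re discards nothing. *)
definition gowers_norm :: "nat \<Rightarrow> nat \<Rightarrow> nat \<Rightarrow> ((nat \<Rightarrow> int) \<Rightarrow> complex) \<Rightarrow> real" where
  "gowers_norm p n t f =
     root (2 ^ t) (Re (expect (Fp_vec p n \<times> ({..<t} \<rightarrow>\<^sub>E Fp_vec p n))
       (\<lambda>(x, h). \<Prod>W\<in>Pow {..<t}. (cnj ^^ card W)
          (f (\<lambda>m\<in>{..<n}. x m \<oplus>\<^bsub>Fp p\<^esub> (\<Oplus>\<^bsub>Fp p\<^esub>r\<in>W. h r m))))))"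

definition one_bounded :: "nat \<Rightarrow> nat \<Rightarrow> ((nat \<Rightarrow> int) \<Rightarrow> complex) \<Rightarrow> bool" where
  "one_bounded p n f \<longleftrightarrow> (\<forall>x\<in>Fp_vec p n. cmod (f x) \<le> 1)"

definition gowers_control ::
    "nat \<Rightarrow> nat \<Rightarrow> nat \<Rightarrow> (nat \<Rightarrow> (nat \<Rightarrow> int) \<Rightarrow> int) \<Rightarrow> nat \<Rightarrow> real \<Rightarrow> bool" where
  "gowers_control p d k \<Phi> i\<^sub>0 M \<longleftrightarrow>
     (\<forall>n\<ge>1. \<forall>f. (\<forall>i<k. one_bounded p n (f i)) \<longrightarrow>
        cmod (Lambda p n d k \<Phi> f)
          \<le> gowers_norm p n (s_form p d k \<Phi> i\<^sub>0 + 1) (f i\<^sub>0) powr (2 powr (- M)))"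

end

theory Submission imports Defs begin

text \<open>Write \<open>\<phi>\<^sub>i\<close> for the forms and \<open>U\<^sup>t\<close> for the Gowers norms. The functions \<open>f\<^sub>i\<close> with \<open>i \<noteq> i\<^sub>0\<close> are
  replaced, one at a time and with polynomial loss, by structured functions. By Cauchy--Schwarz \<open>f\<^sub>j\<close> may
  be replaced by the conjugate of the dual function \<open>F\<^sub>j\<close> obtained by fixing the value of \<open>\<phi>\<^sub>j\<close>; if the
  new average is controlled by the norm \<open>U\<^sup>t\<close> of \<open>F\<^sub>j\<close>, then \<open>F\<^sub>j\<close> correlates with a structured function of
  degree \<open>t\<close>, made from the Gowers inner product itself. At degree \<open>k - 1\<close> the control is the usual
  Cauchy--Schwarz argument for pairwise independent forms; each further round lowers the degree by one,
  down to \<open>s(\<Phi>) + 1\<close>.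

  To pass from degree \<open>m + 2\<close> to \<open>m + 1\<close>, the structured functions are also chosen stepped:
  \<open>D v\<close> is the average of \<open>R v z z' * (G z * G' z')\<close> over labels \<open>z\<close>, \<open>z'\<close>, and shifts of \<open>v\<close> are compensated by
  shifts of the labels subject to linear relations, the moves. If all \<open>f\<^sub>i\<close> with \<open>i \<noteq> j\<close> are stepped,
  the average is a matrix coefficient of an operator \<open>A\<close>, and its \<open>2 \<cdot> 2\<^sup>N\<close>-th power is at most a matrix
  coefficient of the \<open>2\<^sup>N\<close>-th power of \<open>A\<close> times its adjoint. This is an average over long paths whose
  steps have independent variables. A shift of one step by a tuple of directions \<open>u\<^sub>0, \<dots>, u\<^sub>m\<close> is
  absorbed if the labels are moved along the path, and moves can carry out binary multiplication,
  so that a register collects the product of the \<open>\<phi>\<^sub>i(u\<^sub>r)\<close> over \<open>r\<close>. Since the \<open>(m + 1)\<close>-st tensor power of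
  \<open>\<phi>\<^sub>j\<close> is not in the span of those of the other forms, there are tuples for which the sum of these
  products vanishes modulo \<open>p\<close> for every \<open>i \<noteq> j\<close>, while only for a single tuple all the \<open>\<phi>\<^sub>j(u\<^sub>r)\<close> are nonzero.
  So a single factor \<open>f\<^sub>j\<close> is left, and the power of the average is at most its norm \<open>U\<^sup>m\<^sup>+\<^sup>1\<close>. A
  multiplication takes \<open>O(log L)\<close> steps, whence the term \<open>log log L\<close> in the exponent.\<close>

section \<open>Averages over finite sets\<close>

text \<open>The exponent \<open>M\<close> is a binary logarithm. So the costs of successive
  Cauchy--Schwarz steps add up, and a path of length \<open>2 ^ N\<close> costs only
  \<open>N + 1\<close>. A path consists of at most \<open>k\<close> multiplication blocks of
  \<open>O(k * log L)\<close> steps each, hence N = O(log k + log log L). A replacement costs in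
  addition O(k), for the cubes of dimension at most \<open>k\<close> that build a stepped function.
  Fewer than \<open>k\<close> rounds of \<open>k - 1\<close> replacements give the factor k^3, the
  constants being absorbed by log k. The obstacle within a round is that two functions lack
  structure at once: the one at the distinguished form and the one whose control is sought. The
  former is replaced first, at the old degree, which is possible because some direction kills the
  latter form but not the former. Rounds need independent tensor powers for every form, so they stop
  at degree s(Phi) + 1. A last application of the path argument concerns the distinguished form
  alone and gains one more degree; this is where s(Phi) is compared with the number attached to that
  form.\<close>

definition mean :: "'a set \<Rightarrow> ('a \<Rightarrow> real) \<Rightarrow> real" where
  "mean A f = (\<Sum>a\<in>A. f a) / real (card A)"

abbreviation bdd :: "('a \<Rightarrow> complex) \<Rightarrow> bool" where
  "bdd f \<equiv> \<forall>x. cmod (f x) \<le> 1"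

lemma expect_cong [cong]:
  "A = B \<Longrightarrow> (\<And>a. a \<in> B \<Longrightarrow> f a = g a) \<Longrightarrow> expect A f = expect B g"
  by (simp add: expect_def cong: sum.cong)

lemma mean_cong [cong]:
  "A = B \<Longrightarrow> (\<And>a. a \<in> B \<Longrightarrow> f a = g a) \<Longrightarrow> mean A f = mean B g"
  by (simp add: mean_def cong: sum.cong)

lemma expect_const [simp]: "finite A \<Longrightarrow> A \<noteq> {} \<Longrightarrow> expect A (\<lambda>a. c) = c"
  by (simp add: expect_def)

lemma expect_mult_left: "expect A (\<lambda>a. c * f a) = c * expect A f"
  by (simp add: expect_def sum_distrib_left)

lemma expect_mult_right: "expect A (\<lambda>a. f a * c) = expect A f * c"
  by (simp add: expect_def sum_distrib_right)

lemma expect_singleton [simp]: "expect {a} f = f a"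
  by (simp add: expect_def)

lemma cnj_expect: "cnj (expect A f) = expect A (\<lambda>a. cnj (f a))"
  by (simp add: expect_def)

lemma expect_swap: "expect A (\<lambda>a. expect B (\<lambda>b. f a b)) = expect B (\<lambda>b. expect A (\<lambda>a. f a b))"
  unfolding expect_def sum_divide_distrib [symmetric] by (subst sum.swap) simp

lemma expect_Times: "expect (A \<times> B) f = expect A (\<lambda>a. expect B (\<lambda>b. f (a, b)))"
  by (simp add: expect_def sum_divide_distrib [symmetric] card_cartesian_product
      sum.cartesian_product mult.commute)

lemma expect_bij: "bij_betw h A B \<Longrightarrow> expect A (\<lambda>a. f (h a)) = expect B f"
  unfolding expect_def using sum.reindex_bij_betw [of h A B f] bij_betw_same_card [of h A B] by simp

lemma cmod_expect_le_mean: "cmod (expect A f) \<le> mean A (\<lambda>a. cmod (f a))"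
  unfolding expect_def mean_def by (simp add: norm_divide divide_right_mono norm_sum)

lemma mean_le:
  assumes "finite A" "\<And>a. a \<in> A \<Longrightarrow> f a \<le> c" "0 \<le> c"
  shows "mean A f \<le> c"
proof (cases "card A = 0")
  case True
  then show ?thesis using assms by (simp add: mean_def)
next
  case False
  have "(\<Sum>a\<in>A. f a) \<le> real (card A) * c"
    using assms by (intro sum_bounded_above) auto
  then show ?thesis using False by (simp add: mean_def divide_le_eq mult.commute)
qed

lemma mean_mono: "(\<And>a. a \<in> A \<Longrightarrow> f a \<le> g a) \<Longrightarrow> mean A f \<le> mean A g"
  by (simp add: mean_def divide_right_mono sum_mono)

lemma mean_nonneg: "(\<And>a. a \<in> A \<Longrightarrow> 0 \<le> f a) \<Longrightarrow> 0 \<le> mean A f"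
  by (simp add: mean_def sum_nonneg)

lemma Re_expect: "Re (expect A f) = mean A (\<lambda>a. Re (f a))"
  by (simp add: expect_def mean_def)

lemma cmod_expect_le_1: "(\<And>a. a \<in> A \<Longrightarrow> cmod (f a) \<le> 1) \<Longrightarrow> cmod (expect A f) \<le> 1"
  using mean_le [of A "\<lambda>a. cmod (f a)" 1] cmod_expect_le_mean [of A f]
  by (cases "finite A") (auto simp: expect_def)

lemma mean_power2_le: "(mean A f)\<^sup>2 \<le> mean A (\<lambda>a. (f a)\<^sup>2)"
proof (cases "card A = 0")
  case True
  then show ?thesis by (auto simp: mean_def)
next
  case False
  define m where "m = mean A f"
  have s: "(\<Sum>a\<in>A. f a) = m * real (card A)" using False by (simp add: m_def mean_def)
  have "0 \<le> (\<Sum>a\<in>A. (f a - m)\<^sup>2)" by (simp add: sum_nonneg)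
  also have "\<dots> = (\<Sum>a\<in>A. (f a)\<^sup>2 + m\<^sup>2 - 2 * m * f a)"
    by (intro sum.cong) (auto simp: power2_diff)
  also have "\<dots> = (\<Sum>a\<in>A. (f a)\<^sup>2) + real (card A) * m\<^sup>2 - 2 * m * (\<Sum>a\<in>A. f a)"
    by (simp only: sum.distrib sum_subtractf sum_distrib_left sum_constant)
  also have "\<dots> = (\<Sum>a\<in>A. (f a)\<^sup>2) - real (card A) * m\<^sup>2"
    by (simp add: s power2_eq_square)
  finally show ?thesis using False
    by (simp add: mean_def [of A "\<lambda>a. (f a)\<^sup>2"] m_def [symmetric] le_divide_eq mult.commute)
qed

lemma mean_power_two_power_le:
  assumes "\<And>a. a \<in> A \<Longrightarrow> 0 \<le> f a"
  shows "(mean A f) ^ (2 ^ n) \<le> mean A (\<lambda>a. f a ^ (2 ^ n))"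
proof (induction n)
  case (Suc n)
  have "(mean A f) ^ (2 ^ Suc n) = ((mean A f) ^ (2 ^ n))\<^sup>2" by (simp only: power_Suc2 power_mult)
  also have "\<dots> \<le> (mean A (\<lambda>a. f a ^ (2 ^ n)))\<^sup>2"
    using Suc mean_nonneg [of A f] assms by (intro power_mono) auto
  also have "\<dots> \<le> mean A (\<lambda>a. (f a ^ (2 ^ n))\<^sup>2)" by (rule mean_power2_le)
  also have "\<dots> = mean A (\<lambda>a. f a ^ (2 ^ Suc n))" by (simp only: power_Suc2 power_mult)
  finally show ?case .
qed simp

text \<open>The mean square is left as a product with a conjugate, so that it can be expanded into a
  double average or read as a new correlation.\<close>

lemma expect_cs:
  assumes "\<And>a. a \<in> A \<Longrightarrow> cmod (g a) \<le> 1"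
  shows "(cmod (expect A (\<lambda>a. f a * g a)))\<^sup>2 \<le> Re (expect A (\<lambda>a. f a * cnj (f a)))"
proof -
  have "cmod (expect A (\<lambda>a. f a * g a)) \<le> mean A (\<lambda>a. cmod (f a * g a))"
    by (rule cmod_expect_le_mean)
  also have "\<dots> \<le> mean A (\<lambda>a. cmod (f a))"
    using assms by (intro mean_mono) (auto simp: norm_mult mult_left_le)
  finally have "(cmod (expect A (\<lambda>a. f a * g a)))\<^sup>2 \<le> (mean A (\<lambda>a. cmod (f a)))\<^sup>2"
    by (simp add: power_mono)
  also have "\<dots> \<le> mean A (\<lambda>a. (cmod (f a))\<^sup>2)" by (rule mean_power2_le)
  also have "\<dots> = Re (expect A (\<lambda>a. f a * cnj (f a)))"
    by (simp only: Re_expect complex_mult_cnj cmod_power2 Re_complex_of_real)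
  finally show ?thesis .
qed

section \<open>Gowers norms on a finite elementary abelian group\<close>

lemma inverse_mod:
  assumes "prime p" "\<not> int p dvd a"
  obtains b where "int p dvd a * b - 1"
proof -
  have "coprime a (int p)"
    using assms prime_imp_coprime [of "int p" a] by (simp add: coprime_commute)
  then obtain b where "[a * b = 1] (mod int p)" using cong_solve_coprime_int by blast
  then show thesis using that by (simp add: cong_iff_dvd_diff)
qed

text \<open>Scalars are integers rather than residues because the size of coefficients matters
  later, when they are processed digit by digit. The space is a subset \<open>S\<close>, so that one
  type can serve all dimensions.\<close>

locale fp_space = Modules.module scale
  for scale :: "int \<Rightarrow> 'v::ab_group_add \<Rightarrow> 'v" (infixr \<open>*s\<close> 75) +
  fixes S :: "'v set" and p :: nat
  assumes finite_S: "finite S"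
    and zero_S: "0 \<in> S"
    and add_S: "x \<in> S \<Longrightarrow> y \<in> S \<Longrightarrow> x + y \<in> S"
    and scale_S: "x \<in> S \<Longrightarrow> c *s x \<in> S"
    and torsion: "x \<in> S \<Longrightarrow> int p *s x = 0"
    and prime_p: "prime p"
begin

lemma S_nonempty: "S \<noteq> {}"
  using zero_S by blast

lemma diff_S: "x \<in> S \<Longrightarrow> y \<in> S \<Longrightarrow> x - y \<in> S"
  using add_S [of x "(-1) *s y"] scale_S [of y "-1"] by simp

lemma sum_S: "(\<And>i. i \<in> I \<Longrightarrow> f i \<in> S) \<Longrightarrow> sum f I \<in> S"
  by (induction I rule: infinite_finite_induct) (auto simp: zero_S add_S)

lemma scale_dvd: "int p dvd c \<Longrightarrow> x \<in> S \<Longrightarrow> c *s x = 0"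
  by (metis dvd_def scale_scale torsion scale_S)

lemma expect_S_shift: "h \<in> S \<Longrightarrow> expect S (\<lambda>x. f (x + h)) = expect S f"
  by (rule expect_bij, rule bij_betw_byWitness [where f' = "\<lambda>x. x - h"]) (auto simp: add_S diff_S)

lemma expect_S_shift': "h \<in> S \<Longrightarrow> expect S (\<lambda>x. f (h + x)) = expect S f"
  using expect_S_shift [of h f] by (simp add: add.commute)

lemma expect_S_scale:
  assumes "\<not> int p dvd c"
  shows "expect S (\<lambda>x. f (c *s x)) = expect S f"
proof -
  obtain d where d: "int p dvd c * d - 1" by (rule inverse_mod [OF prime_p assms])
  have inv: "(c * d) *s x = x" if "x \<in> S" for x
    using scale_dvd [OF d that] by (simp add: scale_left_diff_distrib)
  show ?thesis
    by (rule expect_bij, rule bij_betw_byWitness [where f' = "\<lambda>x. d *s x"])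
      (use inv in \<open>auto simp: scale_S mult.commute\<close>)
qed

section \<open>Tuples, linear combinations and invisible functions\<close>

definition Y :: "nat \<Rightarrow> (nat \<Rightarrow> 'v) set" where
  "Y t = {..<t} \<rightarrow>\<^sub>E S"

definition lc :: "nat \<Rightarrow> (nat \<Rightarrow> int) \<Rightarrow> (nat \<Rightarrow> 'v) \<Rightarrow> 'v" where
  "lc t l y = (\<Sum>r<t. l r *s y r)"

lemma finite_Y: "finite (Y t)"
  by (simp add: Y_def finite_PiE finite_S)

lemma Y_nonempty: "Y t \<noteq> {}"
  using zero_S by (auto simp: Y_def PiE_eq_empty_iff)

lemma Y_mem: "y \<in> Y t \<Longrightarrow> r < t \<Longrightarrow> y r \<in> S"
  by (auto simp: Y_def)

lemma lc_S: "y \<in> Y t \<Longrightarrow> lc t l y \<in> S"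
  unfolding lc_def by (intro sum_S scale_S) (auto simp: Y_mem)

lemma lc_add: "lc t (\<lambda>r. l r + l' r) y = lc t l y + lc t l' y"
  by (simp add: lc_def scale_left_distrib sum.distrib)

lemma lc_diff: "lc t (\<lambda>r. l r - l' r) y = lc t l y - lc t l' y"
  by (simp add: lc_def scale_left_diff_distrib sum_subtractf)

lemma lc_sum: "lc t (\<lambda>r. \<Sum>i\<in>I. l i r) y = (\<Sum>i\<in>I. lc t (l i) y)"
  unfolding lc_def scale_sum_left by (rule sum.swap)

lemma lc_cong: "(\<And>r. r < t \<Longrightarrow> l r = l' r) \<Longrightarrow> lc t l y = lc t l' y"
  by (simp add: lc_def)

lemma lc_Suc: "lc (Suc t) l (y(t := c)) = lc t l y + l t *s c"
  by (simp add: lc_def)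

lemma lc_upd:
  assumes "r < t" "int p dvd l r" "y \<in> Y t" "c \<in> S"
  shows "lc t l (y(r := c)) = lc t l y"
  unfolding lc_def by (rule sum.cong) (use assms scale_dvd Y_mem in auto)

lemma Y_0: "Y 0 = {\<lambda>_. undefined}"
  by (simp add: Y_def)

lemma Y_upd_undefined: "y \<in> Y t \<Longrightarrow> y(t := undefined) = y"
  unfolding Y_def by (rule fun_upd_idem) (auto elim: PiE_arb)

lemma Y_Suc_iff: "y \<in> Y (Suc t) \<longleftrightarrow> y(t := undefined) \<in> Y t \<and> y t \<in> S"
  by (auto simp: Y_def PiE_iff extensional_def less_Suc_eq)

lemma expect_Y_Suc:
  "expect (Y (Suc t)) f = expect (Y t) (\<lambda>y. expect S (\<lambda>c. f (y(t := c))))"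
proof -
  have "bij_betw (\<lambda>(y, c). y(t := c)) (Y t \<times> S) (Y (Suc t))"
  proof (rule bij_betw_byWitness [where f' = "\<lambda>y. (y(t := undefined), y t)"])
  qed (auto simp: Y_upd_undefined Y_Suc_iff)
  then show ?thesis
    by (simp only: expect_bij [symmetric] expect_Times case_prod_conv)
qed

lemma expect_Y_shift:
  assumes "\<And>r. r < t \<Longrightarrow> d r \<in> S"
  shows "expect (Y t) (\<lambda>y. f (\<lambda>r\<in>{..<t}. y r + d r)) = expect (Y t) f"
  by (rule expect_bij, rule bij_betw_byWitness [where f' = "\<lambda>y. \<lambda>r\<in>{..<t}. y r - d r"])
    (use assms in \<open>auto simp: Y_def PiE_iff extensional_def add_S diff_S fun_eq_iff\<close>)

text \<open>\<open>L t\<close> is the convex hull of the products of \<open>t\<close> bounded functions, the \<open>r\<close>-th of which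
  does not depend on the \<open>r\<close>-th variable. Its members are invisible to a Gowers norm of
  degree \<open>t\<close>, see \<open>L_bound\<close>.\<close>

inductive_set L :: "nat \<Rightarrow> ((nat \<Rightarrow> 'v) \<Rightarrow> complex) set" for t :: nat where
  L_prod: "\<lbrakk>\<forall>r<t. bdd (b r); \<forall>r<t. \<forall>y\<in>Y t. \<forall>c\<in>S. b r (y(r := c)) = b r y;
    \<forall>y\<in>Y t. g y = (\<Prod>r<t. b r y)\<rbrakk> \<Longrightarrow> g \<in> L t"
| L_avg: "\<lbrakk>finite A; A \<noteq> {}; \<forall>a\<in>A. h a \<in> L t; \<forall>y\<in>Y t. g y = expect A (\<lambda>a::nat. h a y)\<rbrakk> \<Longrightarrow> g \<in> L t"

lemma L_cong:
  assumes "f \<in> L t" "\<And>y. y \<in> Y t \<Longrightarrow> f y = g y"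
  shows "g \<in> L t"
  using assms(1)
proof cases
  case (L_prod b)
  then show ?thesis using assms(2) by (intro L.L_prod [of t b]) auto
next
  case (L_avg A h)
  then show ?thesis using assms(2) by (intro L.L_avg [of A h]) auto
qed

text \<open>An inductive set cannot quantify over a type, so \<open>L_avg\<close> averages over sets
  of naturals; an enumeration frees the index type.\<close>

lemma L_expect:
  assumes "finite A" "A \<noteq> {}" "\<And>a. a \<in> A \<Longrightarrow> (\<lambda>y. h a y) \<in> L t"
  shows "(\<lambda>y. expect A (\<lambda>a. h a y)) \<in> L t"
proof -
  obtain e where e: "bij_betw e {0..<card A} A"
    using ex_bij_betw_nat_finite [OF assms(1)] by blast
  show ?thesis
  proof (rule L_avg [of "{0..<card A}" "\<lambda>i. h (e i)"])
    show "{0..<card A} \<noteq> {}" using assms by auto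
    show "\<forall>a\<in>{0..<card A}. h (e a) \<in> L t"
      using e assms(3) by (auto simp: bij_betw_def)
    show "\<forall>y\<in>Y t. expect A (\<lambda>a. h a y) = expect {0..<card A} (\<lambda>a. h (e a) y)"
      by (simp add: expect_bij [OF e, of "\<lambda>a. h a _"])
  qed simp
qed

lemma L_cnj: "f \<in> L t \<Longrightarrow> (\<lambda>y. cnj (f y)) \<in> L t"
proof (induction rule: L.induct)
  case (L_prod b g)
  show ?case by (rule L.L_prod [of t "\<lambda>r y. cnj (b r y)"]) (use L_prod in auto)
next
  case (L_avg A h g)
  show ?case by (rule L.L_avg [of A "\<lambda>a y. cnj (h a y)"]) (use L_avg in \<open>auto simp: cnj_expect\<close>)
qed

lemma L_mult: "f \<in> L t \<Longrightarrow> g \<in> L t \<Longrightarrow> (\<lambda>y. f y * g y) \<in> L t"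
proof (induction rule: L.induct)
  case (L_prod b f)
  from L_prod(4) show ?case
  proof (induction rule: L.induct)
    case prod: (L_prod b' g)
    show ?case
      by (rule L.L_prod [of t "\<lambda>r y. b r y * b' r y"])
        (use L_prod prod in \<open>auto simp: norm_mult prod.distrib intro!: mult_le_one\<close>)
  next
    case avg: (L_avg A h g)
    show ?case by (rule L.L_avg [of A "\<lambda>a y. f y * h a y"])
        (use avg in \<open>auto simp: expect_mult_left\<close>)
  qed
next
  case (L_avg A h f)
  show ?case by (rule L.L_avg [of A "\<lambda>a y. h a y * g y"])
      (use L_avg in \<open>auto simp: expect_mult_right\<close>)
qed

lemma L_slice:
  assumes "r < t" "bdd g" "\<And>y c. y \<in> Y t \<Longrightarrow> c \<in> S \<Longrightarrow> g (y(r := c)) = g y"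
  shows "g \<in> L t"
  by (rule L_prod [of t "\<lambda>r'. if r' = r then g else (\<lambda>_. 1)"]) (use assms in \<open>auto simp: if_distrib [of "\<lambda>f. f _"] prod.delta\<close>)

text \<open>For \<open>t = 0\<close> the only product is the empty one, so no constant but 1 would
  qualify.\<close>

lemma L_const: "0 < t \<Longrightarrow> cmod c \<le> 1 \<Longrightarrow> (\<lambda>y. c) \<in> L t"
  by (rule L_slice [of 0]) auto

lemma L_prod_set:
  assumes "0 < t" "\<And>i. i \<in> I \<Longrightarrow> f i \<in> L t"
  shows "(\<lambda>y. \<Prod>i\<in>I. f i y) \<in> L t"
  using assms(2)
proof (induction I rule: infinite_finite_induct)
  case (insert i I)
  then show ?case using L_mult [of "f i" t "\<lambda>y. \<Prod>i\<in>I. f i y"] by simp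
qed (use assms(1) in \<open>auto intro: L_const\<close>)

text \<open>Since \<open>p\<close> annihilates \<open>S\<close>, a combination with such
  coefficients does not see the variable \<open>y r\<close>.\<close>

definition dead :: "nat \<Rightarrow> (nat \<Rightarrow> int) \<Rightarrow> bool" where
  "dead t l \<longleftrightarrow> (\<exists>r<t. int p dvd l r)"

lemma L_dead:
  assumes "dead t l" "bdd g"
  shows "(\<lambda>y. g (v + lc t l y)) \<in> L t"
proof -
  obtain r where "r < t" "int p dvd l r" using assms(1) by (auto simp: dead_def)
  then show ?thesis using assms(2) by (intro L_slice [of r]) (auto simp: lc_upd)
qed

section \<open>Gowers norms and the Cauchy--Schwarz--Gowers inequality\<close>

definition gow :: "nat \<Rightarrow> ('v \<Rightarrow> complex) \<Rightarrow> complex" where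
  "gow t F = expect (S \<times> Y t) (\<lambda>(x, h). \<Prod>W\<in>Pow {..<t}. (cnj ^^ card W) (F (x + (\<Sum>r\<in>W. h r))))"

definition unorm :: "nat \<Rightarrow> ('v \<Rightarrow> complex) \<Rightarrow> real" where
  "unorm t F = root (2 ^ t) (Re (gow t F))"

lemma cnj_pow_mult: "(cnj ^^ n) (a * b) = (cnj ^^ n) a * (cnj ^^ n) b"
  by (induction n) auto

lemma norm_cnj_pow [simp]: "cmod ((cnj ^^ n) a) = cmod a"
  by (induction n) auto

lemma cnj_cnj_pow: "cnj ((cnj ^^ n) a) = (cnj ^^ n) (cnj a)"
  by (induction n) auto

lemma prod_Pow_Suc:
  "(\<Prod>W\<in>Pow {..<Suc t}. f W) = (\<Prod>W\<in>Pow {..<t}. f W * f (insert t W))"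
proof -
  have "Pow {..<Suc t} = Pow {..<t} \<union> insert t ` Pow {..<t}"
    by (simp add: lessThan_Suc Pow_insert)
  moreover have "inj_on (insert t) (Pow {..<t})"
    by (auto simp: inj_on_def insert_eq_iff)
  moreover have "Pow {..<t} \<inter> insert t ` Pow {..<t} = {}" by auto
  ultimately show ?thesis by (simp add: prod.union_disjoint prod.reindex prod.distrib)
qed

lemma gow_Suc: "gow (Suc t) F = expect S (\<lambda>k. gow t (\<lambda>x. F x * cnj (F (x + k))))"
proof -
  let ?Q = "\<lambda>x y c. \<Prod>W\<in>Pow {..<t}. (cnj ^^ card W) (F (x + (\<Sum>r\<in>W. y r)) * cnj (F (x + (\<Sum>r\<in>W. y r) + c)))"
  have eq: "(\<Prod>W\<in>Pow {..<Suc t}. (cnj ^^ card W) (F (x + (\<Sum>r\<in>W. (y(t := c)) r)))) = ?Q x y c"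
    for x y c
    unfolding prod_Pow_Suc
  proof (rule prod.cong [OF refl])
    fix W assume "W \<in> Pow {..<t}"
    then have W: "t \<notin> W" "finite W" by (auto intro: finite_subset)
    have "(\<Sum>r\<in>W. (y(t := c)) r) = (\<Sum>r\<in>W. y r)" using W by (intro sum.cong) auto
    then show "(cnj ^^ card W) (F (x + (\<Sum>r\<in>W. (y(t := c)) r))) *
          (cnj ^^ card (insert t W)) (F (x + (\<Sum>r\<in>insert t W. (y(t := c)) r))) =
          (cnj ^^ card W) (F (x + (\<Sum>r\<in>W. y r)) * cnj (F (x + (\<Sum>r\<in>W. y r) + c)))"
      using W by (simp add: cnj_pow_mult cnj_cnj_pow algebra_simps)
  qed
  have "gow (Suc t) F = expect S (\<lambda>x. expect (Y t) (\<lambda>y. expect S (\<lambda>c. ?Q x y c)))"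
    by (simp only: gow_def expect_Times expect_Y_Suc case_prod_conv eq)
  also have "\<dots> = expect S (\<lambda>x. expect S (\<lambda>c. expect (Y t) (\<lambda>y. ?Q x y c)))"
    by (intro expect_cong refl expect_swap)
  also have "\<dots> = expect S (\<lambda>c. expect S (\<lambda>x. expect (Y t) (\<lambda>y. ?Q x y c)))"
    by (rule expect_swap)
  also have "\<dots> = expect S (\<lambda>c. gow t (\<lambda>x. F x * cnj (F (x + c))))"
    by (simp only: gow_def expect_Times case_prod_conv)
  finally show ?thesis .
qed

lemma gow_0: "gow 0 F = expect S F"
  by (simp add: gow_def expect_Times Y_0)

lemma gow_1: "gow (Suc 0) F = expect S F * cnj (expect S F)"
proof -
  have "gow (Suc 0) F = expect S (\<lambda>x. expect S (\<lambda>k. F x * cnj (F (x + k))))"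
    by (simp only: gow_Suc gow_0) (rule expect_swap)
  also have "\<dots> = expect S (\<lambda>x. F x * cnj (expect S F))"
    by (intro expect_cong refl) (simp only: expect_mult_left cnj_expect [symmetric] expect_S_shift')
  finally show ?thesis by (simp only: expect_mult_right)
qed

lemma expect_S_diff_scale:
  assumes "\<not> int p dvd c" "a \<in> S"
  shows "expect S (\<lambda>b. f (c *s (b - a))) = expect S f"
proof -
  have "expect S (\<lambda>b. f (c *s (b - a))) = expect S (\<lambda>b. f (c *s b + (- c) *s a))"
    by (simp add: scale_right_diff_distrib)
  also have "\<dots> = expect S (\<lambda>x. f (x + (- c) *s a))"
    by (rule expect_S_scale [OF assms(1), of "\<lambda>x. f (x + (- c) *s a)"])
  also have "\<dots> = expect S f"
    by (rule expect_S_shift) (rule scale_S [OF assms(2)])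
  finally show ?thesis .
qed

lemma box_base:
  assumes l: "\<not> int p dvd l 0" and b: "bdd b" "\<And>y c. y \<in> Y (Suc 0) \<Longrightarrow> c \<in> S \<Longrightarrow> b (y(0 := c)) = b y"
    and v: "v \<in> S"
  shows "cmod (expect (Y (Suc 0)) (\<lambda>y. F (v + lc (Suc 0) l y) * b y)) ^ 2 \<le> Re (gow (Suc 0) F)"
proof -
  define y0 :: "nat \<Rightarrow> 'v" where "y0 = (\<lambda>_. undefined)(0 := 0)"
  have y0: "y0 \<in> Y (Suc 0)" using zero_S by (auto simp: y0_def Y_Suc_iff Y_0)
  have bc: "b ((\<lambda>_. undefined)(0 := c)) = b y0" if "c \<in> S" for c
    using b(2) [OF y0 that] by (simp add: y0_def)
  have "expect (Y (Suc 0)) (\<lambda>y. F (v + lc (Suc 0) l y) * b y) = expect S (\<lambda>c. F (v + l 0 *s c) * b y0)"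
    unfolding expect_Y_Suc Y_0 expect_singleton by (intro expect_cong refl) (simp add: bc lc_def)
  also have "\<dots> = expect S (\<lambda>c. F (v + l 0 *s c)) * b y0" by (rule expect_mult_right)
  also have "expect S (\<lambda>c. F (v + l 0 *s c)) = expect S F"
    using expect_S_scale [OF l, of "\<lambda>x. F (v + x)"] expect_S_shift' [OF v] by simp
  finally have "cmod (expect (Y (Suc 0)) (\<lambda>y. F (v + lc (Suc 0) l y) * b y)) \<le> cmod (expect S F)"
    using b(1) by (simp add: norm_mult mult_left_le)
  then have "cmod (expect (Y (Suc 0)) (\<lambda>y. F (v + lc (Suc 0) l y) * b y)) ^ 2 \<le> cmod (expect S F) ^ 2"
    by (simp add: power_mono)
  also have "\<dots> = Re (gow (Suc 0) F)"
    by (simp only: gow_1 complex_mult_cnj cmod_power2 Re_complex_of_real)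
  finally show ?thesis .
qed

text \<open>The last factor is constant in the last variable, so Cauchy--Schwarz discards it and
  doubles this variable into \<open>c\<close>, \<open>c'\<close>. What remains is the case of one
  variable fewer for the multiplicative derivative of \<open>F\<close> with step
  \<open>l ?t *s (c' - c)\<close>, and by \<open>gow_Suc\<close> the Gowers averages of these
  derivatives average to that of \<open>F\<close>.\<close>

lemma box_prod:
  assumes "\<And>r. r < Suc t \<Longrightarrow> \<not> int p dvd l r" "\<And>r. r < Suc t \<Longrightarrow> bdd (b r)"
    "\<And>r y c. r < Suc t \<Longrightarrow> y \<in> Y (Suc t) \<Longrightarrow> c \<in> S \<Longrightarrow> b r (y(r := c)) = b r y" "v \<in> S"
  shows "cmod (expect (Y (Suc t)) (\<lambda>y. F (v + lc (Suc t) l y) * (\<Prod>r<Suc t. b r y))) ^ (2 ^ Suc t)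
    \<le> Re (gow (Suc t) F)"
  using assms
proof (induction t arbitrary: F b v)
  case 0
  have "cmod (expect (Y (Suc 0)) (\<lambda>y. F (v + lc (Suc 0) l y) * b 0 y)) ^ 2 \<le> Re (gow (Suc 0) F)"
    by (rule box_base) (use 0 in blast)+
  then show ?case by simp
next
  case (Suc t)
  let ?t = "Suc t"
  define g where "g c y = F (v + l ?t *s c + lc ?t l y) * (\<Prod>r<?t. b r (y(?t := c)))" for c y
  define \<beta> where "\<beta> y = b ?t (y(?t := 0))" for y
  have up: "y(?t := c) \<in> Y (Suc ?t)" if "y \<in> Y ?t" "c \<in> S" for y c
    using that by (simp add: Y_Suc_iff [of _ ?t] Y_upd_undefined)
  have \<beta>: "b ?t (y(?t := c)) = \<beta> y" if "y \<in> Y ?t" "c \<in> S" for y c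
  proof -
    have "b ?t ((y(?t := 0))(?t := c)) = b ?t (y(?t := 0))"
      by (rule Suc.prems(3) [OF lessI up [OF that(1) zero_S] that(2)])
    then show ?thesis by (simp only: fun_upd_upd \<beta>_def)
  qed
  have "expect (Y (Suc ?t)) (\<lambda>y. F (v + lc (Suc ?t) l y) * (\<Prod>r<Suc ?t. b r y)) =
    expect (Y ?t) (\<lambda>y. expect S (\<lambda>c. g c y * \<beta> y))"
    unfolding expect_Y_Suc [of ?t]
    by (intro expect_cong refl) (simp only: lc_Suc prod.lessThan_Suc [of _ ?t] \<beta> g_def, simp add: algebra_simps)
  also have "\<dots> = expect (Y ?t) (\<lambda>y. expect S (\<lambda>c. g c y) * \<beta> y)"
    by (simp only: expect_mult_right)
  finally have e1: "expect (Y (Suc ?t)) (\<lambda>y. F (v + lc (Suc ?t) l y) * (\<Prod>r<Suc ?t. b r y)) =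
    expect (Y ?t) (\<lambda>y. expect S (\<lambda>c. g c y) * \<beta> y)" (is "?E = _") .
  define q where "q c c' = expect (Y ?t) (\<lambda>y. g c y * cnj (g c' y))" for c c'
  have "(cmod ?E)\<^sup>2 \<le> Re (expect (Y ?t) (\<lambda>y. expect S (\<lambda>c. g c y) * cnj (expect S (\<lambda>c. g c y))))"
    unfolding e1 by (rule expect_cs) (use Suc.prems(2) [of ?t] in \<open>simp add: \<beta>_def\<close>)
  also have "expect (Y ?t) (\<lambda>y. expect S (\<lambda>c. g c y) * cnj (expect S (\<lambda>c. g c y))) =
     expect (Y ?t) (\<lambda>y. expect S (\<lambda>c. expect S (\<lambda>c'. g c y * cnj (g c' y))))"
    by (simp only: expect_mult_left expect_mult_right cnj_expect)
  also have "\<dots> = expect S (\<lambda>c. expect S (\<lambda>c'. q c c'))"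
    unfolding q_def by (subst expect_swap, intro expect_cong refl, rule expect_swap)
  also have "Re \<dots> \<le> cmod \<dots>" by (rule complex_Re_le_cmod)
  also have "\<dots> \<le> mean S (\<lambda>c. mean S (\<lambda>c'. cmod (q c c')))"
    by (rule order_trans [OF cmod_expect_le_mean mean_mono]) (rule cmod_expect_le_mean)
  finally have "((cmod ?E)\<^sup>2) ^ (2 ^ ?t) \<le> (mean S (\<lambda>c. mean S (\<lambda>c'. cmod (q c c')))) ^ (2 ^ ?t)"
    by (rule power_mono) simp
  also have "\<dots> \<le> mean S (\<lambda>c. (mean S (\<lambda>c'. cmod (q c c'))) ^ (2 ^ ?t))"
    by (rule mean_power_two_power_le) (simp add: mean_nonneg)
  also have "\<dots> \<le> mean S (\<lambda>c. mean S (\<lambda>c'. cmod (q c c') ^ (2 ^ ?t)))"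
    by (intro mean_mono mean_power_two_power_le) simp
  also have "\<dots> \<le> mean S (\<lambda>c. mean S (\<lambda>c'. Re (gow ?t (\<lambda>x. F x * cnj (F (x + l ?t *s (c' - c)))))))"
  proof (intro mean_mono)
    fix c c' assume c: "c \<in> S" "c' \<in> S"
    define b' where "b' r y = b r (y(?t := c)) * cnj (b r (y(?t := c')))" for r y
    have vc: "v + l ?t *s c \<in> S" using c Suc.prems(4) by (simp add: add_S scale_S)
    have IH: "cmod (expect (Y ?t) (\<lambda>y. (\<lambda>x. F x * cnj (F (x + l ?t *s (c' - c)))) (v + l ?t *s c + lc ?t l y)
         * (\<Prod>r<?t. b' r y))) ^ (2 ^ ?t) \<le> Re (gow ?t (\<lambda>x. F x * cnj (F (x + l ?t *s (c' - c)))))"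
    proof (rule Suc.IH)
      fix r y d assume r: "r < ?t" and y: "y \<in> Y ?t" and d: "d \<in> S"
      have "b r ((y(r := d))(?t := e)) = b r (y(?t := e))" if "e \<in> S" for e
      proof -
        have "b r ((y(?t := e))(r := d)) = b r (y(?t := e))"
          by (rule Suc.prems(3) [OF less_SucI [OF r] up [OF y that] d])
        then show ?thesis using r by (metis fun_upd_twist less_irrefl)
      qed
      then show "b' r (y(r := d)) = b' r y" using c by (simp add: b'_def)
    qed (use Suc.prems vc in \<open>auto simp: b'_def norm_mult intro!: mult_le_one\<close>)
    have "q c c' = expect (Y ?t) (\<lambda>y. (\<lambda>x. F x * cnj (F (x + l ?t *s (c' - c)))) (v + l ?t *s c + lc ?t l y)
         * (\<Prod>r<?t. b' r y))"
      unfolding q_def g_def b'_def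
      by (intro expect_cong refl) (simp add: prod.distrib scale_right_diff_distrib algebra_simps)
    then show "cmod (q c c') ^ (2 ^ ?t) \<le> Re (gow ?t (\<lambda>x. F x * cnj (F (x + l ?t *s (c' - c)))))"
      using IH by simp
  qed
  also have "\<dots> = mean S (\<lambda>c. Re (gow (Suc ?t) F))"
  proof (intro mean_cong refl)
    fix c assume c: "c \<in> S"
    have "expect S (\<lambda>c'. gow ?t (\<lambda>x. F x * cnj (F (x + l ?t *s (c' - c))))) = gow (Suc ?t) F"
      unfolding gow_Suc [of ?t]
      by (rule expect_S_diff_scale [OF Suc.prems(1) c]) simp
    then show "mean S (\<lambda>c'. Re (gow ?t (\<lambda>x. F x * cnj (F (x + l ?t *s (c' - c)))))) = Re (gow (Suc ?t) F)"
      by (simp only: Re_expect [symmetric])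
  qed
  also have "\<dots> = Re (gow (Suc ?t) F)"
    using finite_S S_nonempty by (simp add: mean_def)
  finally show ?case by (simp only: power_mult [symmetric] power_Suc [symmetric])
qed

text \<open>\<open>box_prod\<close> with trivial factors exhibits a nonnegative lower bound.\<close>

lemma gow_nonneg: "0 < t \<Longrightarrow> 0 \<le> Re (gow t F)"
proof -
  assume "0 < t"
  then obtain t' where t: "t = Suc t'" by (cases t) auto
  have "\<not> int p dvd 1" using prime_p by (simp add: prime_nat_iff)
  then have le: "cmod (expect (Y (Suc t')) (\<lambda>y. F (0 + lc (Suc t') (\<lambda>_. 1) y) * (\<Prod>r<Suc t'. 1))) ^ (2 ^ Suc t')
      \<le> Re (gow (Suc t') F)"
    by (intro box_prod [where b = "\<lambda>_ _. 1"]) (auto simp: zero_S)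
  show ?thesis unfolding t by (rule order_trans [OF _ le]) (rule zero_le_power, rule norm_ge_zero)
qed

lemma unorm_nonneg: "0 < t \<Longrightarrow> 0 \<le> unorm t F"
  by (simp add: unorm_def gow_nonneg)

lemma unorm_pow: "0 < t \<Longrightarrow> unorm t F ^ (2 ^ t) = Re (gow t F)"
  by (simp add: unorm_def gow_nonneg)

lemma L_bound:
  assumes "g \<in> L t" "0 < t" "\<And>r. r < t \<Longrightarrow> \<not> int p dvd l r" "v \<in> S"
  shows "cmod (expect (Y t) (\<lambda>y. F (v + lc t l y) * g y)) \<le> unorm t F"
  using assms(1)
proof (induction rule: L.induct)
  case (L_prod b g)
  obtain t' where t: "t = Suc t'" using assms(2) by (cases t) auto
  have "expect (Y t) (\<lambda>y. F (v + lc t l y) * g y) = expect (Y t) (\<lambda>y. F (v + lc t l y) * (\<Prod>r<t. b r y))"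
    using L_prod by (intro expect_cong) auto
  then have "cmod (expect (Y t) (\<lambda>y. F (v + lc t l y) * g y)) ^ (2 ^ t) \<le> Re (gow t F)"
    using box_prod [of t' l b v F] L_prod assms by (simp add: t)
  then have "cmod (expect (Y t) (\<lambda>y. F (v + lc t l y) * g y)) ^ (2 ^ t) \<le> unorm t F ^ (2 ^ t)"
    using assms(2) by (simp add: unorm_pow)
  then show ?case by (rule power_le_imp_le_base [of _ "2 ^ t - 1", simplified]) (use assms(2) in \<open>auto simp: unorm_nonneg\<close>)
next
  case (L_avg A h g)
  have "expect (Y t) (\<lambda>y. F (v + lc t l y) * g y) = expect (Y t) (\<lambda>y. expect A (\<lambda>a. F (v + lc t l y) * h a y))"
    using L_avg by (intro expect_cong refl) (simp add: expect_mult_left)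
  also have "\<dots> = expect A (\<lambda>a. expect (Y t) (\<lambda>y. F (v + lc t l y) * h a y))" by (rule expect_swap)
  finally have "cmod (expect (Y t) (\<lambda>y. F (v + lc t l y) * g y)) \<le> mean A (\<lambda>a. cmod (expect (Y t) (\<lambda>y. F (v + lc t l y) * h a y)))"
    by (simp only: cmod_expect_le_mean)
  also have "\<dots> \<le> unorm t F" using L_avg assms(2) by (intro mean_le) (auto simp: unorm_nonneg)
  finally show ?case .
qed

section \<open>Dual functions\<close>

text \<open>All degrees from \<open>t\<^sub>0\<close> on are demanded, which builds monotonicity
  into the definition.\<close>

definition structured :: "nat \<Rightarrow> ('v \<Rightarrow> complex) \<Rightarrow> bool" where
  "structured t\<^sub>0 D \<longleftrightarrow> (\<forall>t\<ge>t\<^sub>0. \<forall>l. \<forall>v\<in>S. (\<lambda>y. D (v + lc t l y)) \<in> L t)"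

lemma structured_mono: "structured t D \<Longrightarrow> t \<le> t' \<Longrightarrow> structured t' D"
  by (simp add: structured_def)

lemma structured_cnj: "structured t D \<Longrightarrow> structured t (\<lambda>x. cnj (D x))"
  by (simp add: structured_def L_cnj)

lemma not_p_dvd_1: "\<not> int p dvd 1"
  using prime_p by (simp add: prime_nat_iff)

lemma expect_lc:
  assumes "0 < t" "v \<in> S"
  shows "expect (Y t) (\<lambda>y. f (v + lc t (\<lambda>_. 1) y)) = expect S f"
proof -
  obtain t' where t: "t = Suc t'" using assms(1) by (cases t) auto
  have "expect S (\<lambda>c. f (v + lc t (\<lambda>_. 1) (y(t' := c)))) = expect S f" if "y \<in> Y t'" for y
  proof -
    have "expect S (\<lambda>c. f (v + lc t (\<lambda>_. 1) (y(t' := c)))) = expect S (\<lambda>c. f (v + lc t' (\<lambda>_. 1) y + c))"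
      by (simp only: t lc_Suc) (simp add: add.assoc)
    also have "\<dots> = expect S f"
      by (rule expect_S_shift') (simp add: add_S assms lc_S that)
    finally show ?thesis .
  qed
  then have "expect (Y t') (\<lambda>y. expect S (\<lambda>c. f (v + lc t (\<lambda>_. 1) (y(t' := c))))) = expect (Y t') (\<lambda>y. expect S f)"
    by (rule expect_cong [OF refl])
  then show ?thesis
    by (simp add: t expect_Y_Suc finite_Y Y_nonempty)
qed

lemma structured_bound:
  assumes "structured t D" "0 < t"
  shows "cmod (expect S (\<lambda>x. F x * D x)) \<le> unorm t F"
proof -
  have "expect S (\<lambda>x. F x * D x) = expect (Y t) (\<lambda>y. F (0 + lc t (\<lambda>_. 1) y) * D (0 + lc t (\<lambda>_. 1) y))"
    by (rule expect_lc [OF assms(2) zero_S, symmetric])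
  also have "cmod \<dots> \<le> unorm t F"
  proof (rule L_bound)
    show "(\<lambda>y. D (0 + lc t (\<lambda>_. 1) y)) \<in> L t"
      using assms zero_S unfolding structured_def by blast
  qed (use assms not_p_dvd_1 zero_S in auto)
  finally show ?thesis .
qed

section \<open>Cubes and their dual functions\<close>

text \<open>In the average defining the Gowers norm of degree \<open>m + 2\<close>, two of the directions
  span a parallelogram \<open>a\<close>, \<open>b\<close>, \<open>c\<close>, \<open>e = b + c - a\<close>; the kernel collects the factors shifted by the
  other \<open>m\<close> directions.\<close>

definition kern :: "nat \<Rightarrow> ('v \<Rightarrow> complex) \<Rightarrow> 'v \<Rightarrow> 'v \<Rightarrow> 'v \<Rightarrow> 'v \<Rightarrow> complex" where
  "kern m F a b c e = expect (Y m) (\<lambda>h. \<Prod>W\<in>Pow {..<m} - {{}}. (cnj ^^ card W)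
     (F (a + (\<Sum>r\<in>W. h r)) * cnj (F (b + (\<Sum>r\<in>W. h r))) *
      cnj (F (c + (\<Sum>r\<in>W. h r))) * F (e + (\<Sum>r\<in>W. h r))))"

lemma kern_bdd: "bdd F \<Longrightarrow> cmod (kern m F a b c e) \<le> 1"
  unfolding kern_def
  by (intro cmod_expect_le_1, unfold prod_norm [symmetric], intro prod_le_1)
    (auto simp: norm_mult intro!: mult_le_one)

lemma kern_conj: "kern m F b a e c = cnj (kern m F a b c e)"
  unfolding kern_def cnj_expect cnj_prod cnj_cnj_pow
  by (simp add: mult.commute mult.left_commute)

lemma kern_commute: "kern m F a c b e = kern m F a b c e"
  unfolding kern_def by (simp add: mult.commute mult.left_commute)

text \<open>The kernel is averaged over its directions, so \<open>h s\<close> may be shifted along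
  \<open>lam s\<close> for free. The condition says that afterwards every factor, one for each
  nonempty \<open>W\<close>, misses a variable.\<close>

definition dead_shifts :: "nat \<Rightarrow> nat \<Rightarrow> (nat \<Rightarrow> int) \<Rightarrow> (nat \<Rightarrow> nat \<Rightarrow> int) \<Rightarrow> bool" where
  "dead_shifts t m l lam \<longleftrightarrow> (\<forall>W\<subseteq>{..<m}. W \<noteq> {} \<longrightarrow> dead t (\<lambda>r. l r + (\<Sum>s\<in>W. lam s r)))"

lemma L_dead_cnj: "dead t l \<Longrightarrow> bdd g \<Longrightarrow> (\<lambda>y. (cnj ^^ n) (g (v + lc t l y))) \<in> L t"
  using L_dead [of t l "\<lambda>x. (cnj ^^ n) (g x)" v] by simp

lemma kern_L:
  assumes "0 < t" "bdd F" "dead_shifts t m la lam" "dead_shifts t m lb lam"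
    "dead_shifts t m lg lam" "dead_shifts t m ld lam"
  shows "(\<lambda>y. kern m F (a + lc t la y) (b + lc t lb y) (c + lc t lg y) (e + lc t ld y)) \<in> L t"
proof -
  define sh where "sh l W = (\<lambda>r. l r + (\<Sum>s\<in>W. lam s r))" for l :: "nat \<Rightarrow> int" and W
  let ?P = "\<lambda>h y W. (cnj ^^ card W) (F (a + (\<Sum>r\<in>W. h r) + lc t (sh la W) y)) *
      (cnj ^^ card W) (cnj (F (b + (\<Sum>r\<in>W. h r) + lc t (sh lb W) y))) *
      (cnj ^^ card W) (cnj (F (c + (\<Sum>r\<in>W. h r) + lc t (sh lg W) y))) *
      (cnj ^^ card W) (F (e + (\<Sum>r\<in>W. h r) + lc t (sh ld W) y))"
  define f where "f h y = (\<Prod>W\<in>Pow {..<m} - {{}}. ?P h y W)" for h y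
  have "(\<lambda>y. expect (Y m) (\<lambda>h. f h y)) \<in> L t"
  proof (rule L_expect [OF finite_Y Y_nonempty])
    fix h assume "h \<in> Y m"
    show "(\<lambda>y. f h y) \<in> L t" unfolding f_def
    proof (rule L_prod_set [OF assms(1)])
      fix W assume "W \<in> Pow {..<m} - {{}}"
      then have "dead t (sh la W)" "dead t (sh lb W)" "dead t (sh lg W)" "dead t (sh ld W)"
        using assms(3-6) by (auto simp: dead_shifts_def sh_def)
      then show "(\<lambda>y. ?P h y W) \<in> L t"
        using assms(2) by (intro L_mult L_dead_cnj [of t _ F] L_dead_cnj [of t _ "\<lambda>x. cnj (F x)"]) auto
    qed
  qed
  then show ?thesis
  proof (rule L_cong)
    fix y assume y: "y \<in> Y t"
    let ?s = "\<lambda>h W. \<Sum>r\<in>W. (\<lambda>r\<in>{..<m}. h r + lc t (lam r) y) r"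
    let ?K = "\<lambda>h W. (cnj ^^ card W)
     (F (a + lc t la y + ?s h W) *
      cnj (F (b + lc t lb y + ?s h W)) *
      cnj (F (c + lc t lg y + ?s h W)) *
      F (e + lc t ld y + ?s h W))"
    have s: "?s h W = (\<Sum>r\<in>W. h r) + lc t (\<lambda>r. \<Sum>s\<in>W. lam s r) y"
      if "W \<subseteq> {..<m}" for W h
    proof -
      have "?s h W = (\<Sum>r\<in>W. h r + lc t (lam r) y)"
        using that by (intro sum.cong) auto
      then show ?thesis by (simp add: sum.distrib lc_sum)
    qed
    have "kern m F (a + lc t la y) (b + lc t lb y) (c + lc t lg y) (e + lc t ld y) =
      expect (Y m) (\<lambda>h. \<Prod>W\<in>Pow {..<m} - {{}}. ?K h W)"
      unfolding kern_def
      by (rule expect_Y_shift [of m "\<lambda>r. lc t (lam r) y", symmetric]) (simp add: lc_S y)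
    also have "\<dots> = expect (Y m) (\<lambda>h. f h y)"
    proof (intro expect_cong refl, unfold f_def, rule prod.cong [OF refl])
      fix h W assume "W \<in> Pow {..<m} - {{}}"
      then have W: "W \<subseteq> {..<m}" by auto
      have "x + lc t l y + ?s h W =
         x + (\<Sum>r\<in>W. h r) + lc t (sh l W) y" for x l
        unfolding s [OF W] sh_def lc_add by (simp add: algebra_simps)
      then show "?K h W =
      ?P h y W"
        by (simp only: cnj_pow_mult)
    qed
    finally show "expect (Y m) (\<lambda>h. f h y) =
      kern m F (a + lc t la y) (b + lc t lb y) (c + lc t lg y) (e + lc t ld y)" by simp
  qed
qed

text \<open>For \<open>M1\<close>, \<open>M2\<close> equal to the conjugate of \<open>F\<close> and
  \<open>M3 = F\<close> this is the dual function of the norm of degree \<open>m + 2\<close>, with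
  the vertex \<open>a\<close> fixed. The other three vertices of the parallelogram are kept as
  parameters because they will be replaced.\<close>

definition cubefun where
  "cubefun m F M1 M2 M3 a = expect S (\<lambda>b. expect S (\<lambda>c.
     kern m F a b c (b + c - a) * (M1 b * M2 c * M3 (b + c - a))))"

lemma cubefun_bdd:
  assumes "bdd F" "bdd M1" "bdd M2" "bdd M3"
  shows "cmod (cubefun m F M1 M2 M3 a) \<le> 1"
  unfolding cubefun_def
  by (intro cmod_expect_le_1) (use assms kern_bdd in \<open>auto simp: norm_mult intro!: mult_le_one\<close>)

lemma expect_S2_shift:
  assumes "h \<in> S" "k \<in> S"
  shows "expect S (\<lambda>b. expect S (\<lambda>c. f (b + h) (c + k))) = expect S (\<lambda>b. expect S (\<lambda>c. f b c))"
proof -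
  have "expect S (\<lambda>b. expect S (\<lambda>c. f (b + h) (c + k))) = expect S (\<lambda>b. expect S (\<lambda>c. f (b + h) c))"
    by (intro expect_cong refl expect_S_shift assms)
  also have "\<dots> = expect S (\<lambda>b. expect S (\<lambda>c. f b c))"
    by (rule expect_S_shift [OF assms(1)])
  finally show ?thesis .
qed

text \<open>Each of the \<open>m + 2\<close> directions of the cube gets a variable of its own:
  direction \<open>s\<close> of the kernel cancels variable \<open>s\<close>, the side towards
  \<open>b\<close> cancels \<open>m\<close>, the side towards \<open>c\<close> cancels
  \<open>Suc m\<close>. Every vertex but the fixed one then misses a variable, whatever bounded
  functions sit there.\<close>

lemma structured_cubefun:
  assumes bd: "bdd F" "bdd M1" "bdd M2" "bdd M3"
  shows "structured (m + 2) (cubefun m F M1 M2 M3)"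
  unfolding structured_def
proof (intro allI impI ballI)
  fix t and l :: "nat \<Rightarrow> int" and v assume t: "m + 2 \<le> t" and v: "v \<in> S"
  define lb where "lb = l(m := 0)"
  define lg where "lg = l(Suc m := 0)"
  define ld where "ld = l(m := 0, Suc m := 0)"
  define lam :: "nat \<Rightarrow> nat \<Rightarrow> int" where "lam s r = (if r = s then - l s else 0)" for s r
  have ds: "dead_shifts t m l' lam" if "\<And>s. s < m \<Longrightarrow> l' s = l s" for l'
    unfolding dead_shifts_def dead_def
  proof (intro allI impI)
    fix W assume W: "W \<subseteq> {..<m}" "W \<noteq> {}"
    then obtain s where s: "s \<in> W" "s < m" by auto
    have "(\<Sum>s'\<in>W. lam s' s) = - l s"
      using W s by (subst sum.remove [of W s]) (auto simp: lam_def finite_subset intro!: sum.neutral)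
    then show "\<exists>r<t. int p dvd l' r + (\<Sum>s\<in>W. lam s r)"
      using s that t by (intro exI [of _ s]) auto
  qed
  have deads: "dead t lb" "dead t lg" "dead t ld"
    using t by (auto simp: dead_def lb_def lg_def ld_def intro: exI [of _ m] exI [of _ "Suc m"])
  let ?P = "\<lambda>y b c. kern m F (v + lc t l y) (b + lc t lb y) (c + lc t lg y) (b + c - v + lc t ld y) *
     (M1 (b + lc t lb y) * M2 (c + lc t lg y) * M3 (b + c - v + lc t ld y))"
  have "(\<lambda>y. expect S (\<lambda>b. expect S (\<lambda>c. ?P y b c))) \<in> L t"
    by (intro L_expect L_mult kern_L [where lam = lam] L_dead deads finite_S S_nonempty ds)
      (use t bd in \<open>auto simp: lb_def lg_def ld_def\<close>)
  then show "(\<lambda>y. cubefun m F M1 M2 M3 (v + lc t l y)) \<in> L t"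
  proof (rule L_cong)
    fix y assume y: "y \<in> Y t"
    have ld: "lc t ld y = lc t lb y + lc t lg y - lc t l y"
      unfolding lc_add [symmetric] lc_diff [symmetric] by (rule lc_cong) (auto simp: ld_def lb_def lg_def)
    show "expect S (\<lambda>b. expect S (\<lambda>c. ?P y b c)) = cubefun m F M1 M2 M3 (v + lc t l y)"
      unfolding cubefun_def
      using expect_S2_shift [OF lc_S [OF y, of lb] lc_S [OF y, of lg], of "\<lambda>b c. 
        kern m F (v + lc t l y) b c (b + c - (v + lc t l y)) * (M1 b * M2 c * M3 (b + c - (v + lc t l y)))"]
      by (simp add: ld algebra_simps)
  qed
qed

definition cubeform where
  "cubeform m F M0 M1 M2 M3 = expect S (\<lambda>a. M0 a * cubefun m F M1 M2 M3 a)"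

lemma cubeform_commute: "cubeform m F M0 M1 M2 M3 = cubeform m F M0 M2 M1 M3"
  unfolding cubeform_def cubefun_def
  by (subst expect_swap) (simp add: kern_commute [of m F _ _ _] mult.commute mult.left_commute add.commute)

text \<open>The parallelogram is read from \<open>b\<close> instead of \<open>a\<close>, so that the
  cofactor of \<open>M1\<close> is the conjugate of a dual function and hence structured.\<close>

lemma cubeform_swap:
  "cubeform m F M0 M1 M2 M3 =
   expect S (\<lambda>b. M1 b * cnj (cubefun m F (\<lambda>x. cnj (M0 x)) (\<lambda>x. cnj (M3 x)) (\<lambda>x. cnj (M2 x)) b))"
proof -
  have "cubeform m F M0 M1 M2 M3 = expect S (\<lambda>a. expect S (\<lambda>b. expect S (\<lambda>c.
     M0 a * (kern m F a b c (b + c - a) * (M1 b * M2 c * M3 (b + c - a))))))"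
    unfolding cubeform_def cubefun_def by (simp only: expect_mult_left)
  also have "\<dots> = expect S (\<lambda>a. expect S (\<lambda>b. expect S (\<lambda>e.
     M0 a * (kern m F a b (a + e - b) e * (M1 b * M2 (a + e - b) * M3 e)))))"
  proof (rule expect_cong [OF refl], rule expect_cong [OF refl])
    fix a b assume "a \<in> S" "b \<in> S"
    from expect_S_shift [OF diff_S [OF this], of "\<lambda>c. M0 a * (kern m F a b c (b + c - a) * (M1 b * M2 c * M3 (b + c - a)))"]
    show "expect S (\<lambda>c. M0 a * (kern m F a b c (b + c - a) * (M1 b * M2 c * M3 (b + c - a)))) =
      expect S (\<lambda>e. M0 a * (kern m F a b (a + e - b) e * (M1 b * M2 (a + e - b) * M3 e)))"
      by (simp add: algebra_simps)
  qed
  also have "\<dots> = expect S (\<lambda>b. expect S (\<lambda>a. expect S (\<lambda>e.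
     M0 a * (kern m F a b (a + e - b) e * (M1 b * M2 (a + e - b) * M3 e)))))"
    by (rule expect_swap)
  also have "\<dots> = expect S (\<lambda>b. M1 b * expect S (\<lambda>a. expect S (\<lambda>e.
     kern m F a b (a + e - b) e * (M0 a * M3 e * M2 (a + e - b)))))"
    unfolding expect_mult_left [symmetric] by (intro expect_cong refl) (simp add: mult.commute mult.left_commute)
  finally show ?thesis
    unfolding cubefun_def cnj_expect complex_cnj_mult kern_conj [symmetric] complex_cnj_cnj .
qed

lemma gow_cubeform: "gow (m + 2) F = cubeform m F F (\<lambda>x. cnj (F x)) (\<lambda>x. cnj (F x)) F"
proof -
  let ?G = "\<lambda>x k k'. (F x * cnj (F (x + k')) * cnj (F (x + k)) * F (x + k' + k)) *
      kern m F x (x + k') (x + k) (x + k' + k)"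
  let ?H = "\<lambda>x b c. (F x * cnj (F b) * cnj (F c) * F (b + c - x)) *
      kern m F x b c (b + c - x)"
  have P: "(\<Prod>W\<in>Pow {..<m}. f W) = f {} * (\<Prod>W\<in>Pow {..<m} - {{}}. f W)" for f :: "nat set \<Rightarrow> complex"
    by (rule prod.remove) auto
  have 1: "gow m (\<lambda>x. F x * cnj (F (x + k)) * cnj (F (x + k') * cnj (F (x + k' + k)))) =
    expect S (\<lambda>x. ?G x k k')" for k k'
    unfolding gow_def expect_Times case_prod_conv P kern_def expect_mult_left [symmetric]
    by (intro expect_cong refl arg_cong2 [where f = times] prod.cong) (simp_all add: algebra_simps)
  have "gow (m + 2) F = expect S (\<lambda>k. expect S (\<lambda>k'. expect S (\<lambda>x. ?G x k k')))"
    by (simp only: add_2_eq_Suc' gow_Suc 1)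
  also have "\<dots> = expect S (\<lambda>k. expect S (\<lambda>x. expect S (\<lambda>k'. ?G x k k')))"
    by (intro expect_cong refl expect_swap)
  also have "\<dots> = expect S (\<lambda>x. expect S (\<lambda>k. expect S (\<lambda>k'. ?G x k k')))"
    by (rule expect_swap)
  also have "\<dots> = expect S (\<lambda>x. expect S (\<lambda>k'. expect S (\<lambda>k. ?G x k k')))"
    by (intro expect_cong refl expect_swap)
  also have "\<dots> = expect S (\<lambda>x. expect S (\<lambda>b. expect S (\<lambda>c. ?H x b c)))"
  proof (rule expect_cong [OF refl])
    fix x assume x: "x \<in> S"
    show "expect S (\<lambda>k'. expect S (\<lambda>k. ?G x k k')) = expect S (\<lambda>b. expect S (\<lambda>c. ?H x b c))"
      using expect_S2_shift [OF x x, of "?H x"] by (simp add: algebra_simps)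
  qed
  also have "\<dots> = cubeform m F F (\<lambda>x. cnj (F x)) (\<lambda>x. cnj (F x)) F"
    unfolding cubeform_def cubefun_def expect_mult_left [symmetric]
    by (intro expect_cong refl) (simp add: mult.commute mult.left_commute)
  finally show ?thesis .
qed

text \<open>The vectors shift the vertices \<open>a\<close>, \<open>b\<close>, \<open>c\<close>,
  \<open>b + c - a\<close> of a parallelogram. One \<open>lam\<close> must serve all four, because
  they share the directions of the kernel.\<close>

definition cube_rel :: "nat \<Rightarrow> nat \<Rightarrow> (nat \<Rightarrow> int) \<Rightarrow> (nat \<Rightarrow> int) \<Rightarrow> (nat \<Rightarrow> int) \<Rightarrow> (nat \<Rightarrow> int) \<Rightarrow> bool" where
  "cube_rel t m la lb lg ld \<longleftrightarrow> (\<forall>r. la r + ld r = lb r + lg r) \<and>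
     (\<exists>lam. dead_shifts t m la lam \<and> dead_shifts t m lb lam \<and> dead_shifts t m lg lam \<and> dead_shifts t m ld lam)"

section \<open>Functions presented by labels\<close>

text \<open>The labels \<open>z\<close> absorb shifts: if \<open>v\<close> moves along \<open>l\<close> and the label along \<open>e\<close>, with \<open>(l, e) \<in> X\<close>,
  then \<open>R\<close> becomes invisible to the norm of degree \<open>t\<close>.\<close>

definition presented ::
  "nat \<Rightarrow> ((nat \<Rightarrow> int) \<times> 'e) set \<Rightarrow> ('e \<Rightarrow> (nat \<Rightarrow> 'v) \<Rightarrow> 'z \<Rightarrow> 'z) \<Rightarrow> ('z \<Rightarrow> complex) set \<Rightarrow> 'z set \<Rightarrow>
    ('v \<Rightarrow> complex) \<Rightarrow> bool" where
  "presented t X act Gs Z D \<longleftrightarrow> (\<exists>R G. (\<forall>v z. cmod (R v z) \<le> 1) \<and> G \<in> Gs \<and>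
     (\<forall>l e v z. (l, e) \<in> X \<longrightarrow> v \<in> S \<longrightarrow> z \<in> Z \<longrightarrow> (\<lambda>y. R (v + lc t l y) (act e y z)) \<in> L t) \<and>
     (\<forall>v\<in>S. D v = expect Z (\<lambda>z. R v z * G z)))"

text \<open>The cost \<open>c\<close> is the binary logarithm of the exponent, so costs add when
  constructions are nested. The flag \<open>s\<close> exempts raw vertices, where \<open>D\<close>
  is the conjugate of \<open>F\<close> and carries no structure.\<close>

definition rich ::
  "nat \<Rightarrow> bool \<Rightarrow> ((nat \<Rightarrow> int) \<times> 'e) set \<Rightarrow> ('e \<Rightarrow> (nat \<Rightarrow> 'v) \<Rightarrow> 'z \<Rightarrow> 'z) \<Rightarrow> ('z \<Rightarrow> complex) set \<Rightarrow> 'z set \<Rightarrow>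
    nat \<Rightarrow> bool" where
  "rich m s X act Gs Z c \<longleftrightarrow> (\<forall>F. bdd F \<longrightarrow> (\<exists>D. bdd D \<and> (s \<longrightarrow> structured (m + 2) D) \<and> presented (Suc m) X act Gs Z D \<and>
     unorm (m + 2) F ^ (2 ^ c) \<le> cmod (expect S (\<lambda>v. F v * D v))))"

text \<open>Cauchy--Schwarz bounds the square of the correlation by that of \<open>F\<close> with
  its own conjugate. As \<open>F\<close> is structured, this is at most its Gowers norm, and
  richness supplies \<open>D\<close>.\<close>

lemma rich_replace:
  assumes "rich m s X act Gs Z c" "bdd M" "bdd F" "structured (m + 2) F"
  shows "\<exists>D. bdd D \<and> presented (Suc m) X act Gs Z D \<and>
    cmod (expect S (\<lambda>v. M v * F v)) ^ (2 ^ Suc c) \<le> cmod (expect S (\<lambda>v. D v * F v))"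
proof -
  obtain D where D: "bdd D" "presented (Suc m) X act Gs Z D"
      "unorm (m + 2) F ^ (2 ^ c) \<le> cmod (expect S (\<lambda>v. F v * D v))"
    using assms(1,3) unfolding rich_def by blast
  have "(cmod (expect S (\<lambda>v. F v * M v)))\<^sup>2 \<le> Re (expect S (\<lambda>v. F v * cnj (F v)))"
    by (rule expect_cs) (use assms(2) in auto)
  also have "\<dots> \<le> cmod (expect S (\<lambda>v. F v * cnj (F v)))" by (rule complex_Re_le_cmod)
  also have "\<dots> \<le> unorm (m + 2) F"
    by (rule structured_bound [OF structured_cnj [OF assms(4)]]) simp
  finally have "((cmod (expect S (\<lambda>v. F v * M v)))\<^sup>2) ^ (2 ^ c) \<le> unorm (m + 2) F ^ (2 ^ c)"
    by (rule power_mono) simp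
  also have "((cmod (expect S (\<lambda>v. F v * M v)))\<^sup>2) ^ (2 ^ c) = cmod (expect S (\<lambda>v. M v * F v)) ^ (2 ^ Suc c)"
    by (simp add: power_mult [symmetric] mult.commute)
  finally have "cmod (expect S (\<lambda>v. M v * F v)) ^ (2 ^ Suc c) \<le> cmod (expect S (\<lambda>v. D v * F v))"
    using D(3) by (simp add: mult.commute)
  with D show ?thesis by blast
qed

text \<open>\<open>cubeform_swap\<close> exchanges two pairs of neighbouring vertices,
  \<open>cubeform_commute\<close> the two neighbours of the base; swap, commute, swap exchanges
  opposite vertices.\<close>

lemma cubeform_flip: "cubeform m F M0 M1 M2 M3 = cubeform m F M3 M1 M2 M0"
proof -
  have "cubeform m F M0 M1 M2 M3 = cnj (cubeform m F (\<lambda>x. cnj (M1 x)) (\<lambda>x. cnj (M0 x)) (\<lambda>x. cnj (M3 x)) (\<lambda>x. cnj (M2 x)))"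
    for M0 M1 M2 M3
    by (subst cubeform_swap) (simp add: cubeform_def cnj_expect)
  then show ?thesis by (metis cubeform_commute)
qed

lemma cubeform_bound: "unorm (m + 2) F ^ (2 ^ (m + 2)) \<le> cmod (cubeform m F F (\<lambda>x. cnj (F x)) (\<lambda>x. cnj (F x)) F)"
proof -
  have "unorm (m + 2) F ^ (2 ^ (m + 2)) = Re (gow (m + 2) F)" by (rule unorm_pow) simp
  also have "\<dots> \<le> cmod (gow (m + 2) F)" by (rule complex_Re_le_cmod)
  finally show ?thesis by (simp only: gow_cubeform)
qed

text \<open>The vertices other than the base are replaced one at a time, which is possible since
  each cofactor is a dual function. Expressing the norm by the form costs \<open>m + 2\<close>, each
  replacement \<open>Suc\<close> of its own cost.\<close>

lemma rich_cube:
  assumes "rich m s1 X1 act1 G1 Z1 c1" "rich m s2 X2 act2 G2 Z2 c2" "rich m s3 X3 act3 G3 Z3 c3" "bdd F"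
  shows "\<exists>M1 M2 M3. bdd M1 \<and> bdd M2 \<and> bdd M3 \<and> presented (Suc m) X1 act1 G1 Z1 M1 \<and>
    presented (Suc m) X2 act2 G2 Z2 M2 \<and> presented (Suc m) X3 act3 G3 Z3 M3 \<and>
    unorm (m + 2) F ^ (2 ^ (m + 5 + c1 + c2 + c3)) \<le> cmod (expect S (\<lambda>v. F v * cubefun m F M1 M2 M3 v))"
proof -
  let ?F = "\<lambda>x. cnj (F x)"
  note bF = assms(4)
  define dual where "dual M0 M2 M3 b = cnj (cubefun m F (\<lambda>x. cnj (M0 x)) (\<lambda>x. cnj (M3 x)) (\<lambda>x. cnj (M2 x)) b)" for M0 M2 M3 b
  have cf: "cubeform m F M0 M1 M2 M3 = expect S (\<lambda>b. M1 b * dual M0 M2 M3 b)" for M0 M1 M2 M3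
    unfolding dual_def by (rule cubeform_swap)
  have dual: "bdd (dual M0 M2 M3)" "structured (m + 2) (dual M0 M2 M3)" if "bdd M0" "bdd M2" "bdd M3" for M0 M2 M3
    unfolding dual_def using that bF
    by (auto intro!: cubefun_bdd) (intro structured_cnj structured_cubefun [simplified], auto)
  obtain M1 where M1: "bdd M1" "presented (Suc m) X1 act1 G1 Z1 M1"
    "cmod (cubeform m F F ?F ?F F) ^ (2 ^ Suc c1) \<le> cmod (cubeform m F F M1 ?F F)"
    using rich_replace [OF assms(1), of ?F "dual F ?F F"] dual [of F ?F F] bF by (auto simp: cf)
  obtain M2 where M2: "bdd M2" "presented (Suc m) X2 act2 G2 Z2 M2"
    "cmod (cubeform m F F M1 ?F F) ^ (2 ^ Suc c2) \<le> cmod (cubeform m F F M1 M2 F)"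
    using rich_replace [OF assms(2), of ?F "dual F M1 F"] dual [of F M1 F] bF M1(1)
    unfolding cubeform_commute [of m F F M1] by (auto simp: cf)
  have fl: "cubeform m F F M1 M2 M3 = expect S (\<lambda>v. M3 v * cubefun m F M1 M2 F v)" for M3
    unfolding cubeform_flip [of m F F M1] by (rule cubeform_def)
  obtain M3 where M3: "bdd M3" "presented (Suc m) X3 act3 G3 Z3 M3"
    "cmod (cubeform m F F M1 M2 F) ^ (2 ^ Suc c3) \<le> cmod (cubeform m F F M1 M2 M3)"
    using rich_replace [OF assms(3), of F "cubefun m F M1 M2 F"] cubefun_bdd [of F M1 M2 F]
      structured_cubefun [of F M1 M2 F] bF M1(1) M2(1)
    by (auto simp: fl)
  have step: "a ^ (2 ^ i) \<le> b \<Longrightarrow> b ^ (2 ^ j) \<le> c \<Longrightarrow> 0 \<le> a \<Longrightarrow> a ^ (2 ^ (i + j)) \<le> c" for a b c :: real and i j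
    using power_mono [of "a ^ (2 ^ i)" b "2 ^ j"] by (simp add: power_add power_mult)
  have "0 \<le> unorm (m + 2) F" by (rule unorm_nonneg) simp
  from step [OF step [OF step [OF cubeform_bound M1(3)] M2(3)] M3(3)] this
  have "unorm (m + 2) F ^ (2 ^ (m + 2 + Suc c1 + Suc c2 + Suc c3)) \<le> cmod (cubeform m F F M1 M2 M3)"
    by simp
  moreover have e: "m + 2 + Suc c1 + Suc c2 + Suc c3 = m + 5 + c1 + c2 + c3" by simp
  ultimately have "unorm (m + 2) F ^ (2 ^ (m + 5 + c1 + c2 + c3)) \<le> cmod (expect S (\<lambda>v. F v * cubefun m F M1 M2 M3 v))"
    by (simp only: e cubeform_def)
  with M1(1,2) M2(1,2) M3(1,2) show ?thesis by blast
qed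

definition node_rel where
  "node_rel m X1 X2 X3 = {(la, (e1, e2, e3)). \<exists>lb lg ld. cube_rel (Suc m) m la lb lg ld \<and>
     (lb, e1) \<in> X1 \<and> (lg, e2) \<in> X2 \<and> (ld, e3) \<in> X3}"

definition node_act where
  "node_act act1 act2 act3 = (\<lambda>(e1, e2, e3) y (z1, z2, z3). (act1 e1 y z1, act2 e2 y z2, act3 e3 y z3))"

definition node_funs :: "('a \<Rightarrow> complex) set \<Rightarrow> ('b \<Rightarrow> complex) set \<Rightarrow> ('c \<Rightarrow> complex) set \<Rightarrow> ('a \<times> 'b \<times> 'c \<Rightarrow> complex) set" where
  "node_funs G1 G2 G3 = {(\<lambda>(z1, z2, z3). g1 z1 * g2 z2 * g3 z3) | g1 g2 g3. g1 \<in> G1 \<and> g2 \<in> G2 \<and> g3 \<in> G3}"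

lemma expect_mult3:
  "expect A f * expect B g * expect C h = expect (A \<times> B \<times> C) (\<lambda>(a, b, c). f a * g b * h c)"
  by (simp add: expect_Times expect_mult_left expect_mult_right)

text \<open>The labels of the three vertices together become the label of the dual function. The
  vertices \<open>b\<close>, \<open>c\<close> are averaged inside \<open>R\<close>, so their shifts
  along \<open>lb\<close>, \<open>lg\<close> are absorbed there.\<close>

lemma presented_cubefun:
  assumes "presented (Suc m) X1 act1 G1 Z1 M1" "presented (Suc m) X2 act2 G2 Z2 M2"
    "presented (Suc m) X3 act3 G3 Z3 M3" "bdd F"
  shows "presented (Suc m) (node_rel m X1 X2 X3) (node_act act1 act2 act3) (node_funs G1 G2 G3) (Z1 \<times> Z2 \<times> Z3)
    (cubefun m F M1 M2 M3)"
proof -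
  let ?t = "Suc m"
  obtain R1 g1 where 1: "\<And>v z. cmod (R1 v z) \<le> 1" "g1 \<in> G1"
    "\<And>l e v z. (l, e) \<in> X1 \<Longrightarrow> v \<in> S \<Longrightarrow> z \<in> Z1 \<Longrightarrow> (\<lambda>y. R1 (v + lc ?t l y) (act1 e y z)) \<in> L ?t"
    "\<And>v. v \<in> S \<Longrightarrow> M1 v = expect Z1 (\<lambda>z. R1 v z * g1 z)"
    using assms(1) unfolding presented_def by blast
  obtain R2 g2 where 2: "\<And>v z. cmod (R2 v z) \<le> 1" "g2 \<in> G2"
    "\<And>l e v z. (l, e) \<in> X2 \<Longrightarrow> v \<in> S \<Longrightarrow> z \<in> Z2 \<Longrightarrow> (\<lambda>y. R2 (v + lc ?t l y) (act2 e y z)) \<in> L ?t"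
    "\<And>v. v \<in> S \<Longrightarrow> M2 v = expect Z2 (\<lambda>z. R2 v z * g2 z)"
    using assms(2) unfolding presented_def by blast
  obtain R3 g3 where 3: "\<And>v z. cmod (R3 v z) \<le> 1" "g3 \<in> G3"
    "\<And>l e v z. (l, e) \<in> X3 \<Longrightarrow> v \<in> S \<Longrightarrow> z \<in> Z3 \<Longrightarrow> (\<lambda>y. R3 (v + lc ?t l y) (act3 e y z)) \<in> L ?t"
    "\<And>v. v \<in> S \<Longrightarrow> M3 v = expect Z3 (\<lambda>z. R3 v z * g3 z)"
    using assms(3) unfolding presented_def by blast
  define R where "R v = (\<lambda>(z1, z2, z3). expect S (\<lambda>b. expect S (\<lambda>c.
     kern m F v b c (b + c - v) * (R1 b z1 * R2 c z2 * R3 (b + c - v) z3))))" for v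
  define G where "G = (\<lambda>(z1, z2, z3). g1 z1 * g2 z2 * g3 z3)"
  have "cmod (R v z) \<le> 1" for v z
    unfolding R_def by (cases z) (auto intro!: cmod_expect_le_1 mult_le_one simp: norm_mult 1(1) 2(1) 3(1) kern_bdd assms(4))
  moreover have "G \<in> node_funs G1 G2 G3"
    using 1(2) 2(2) 3(2) by (auto simp: node_funs_def G_def)
  moreover have "(\<lambda>y. R (v + lc ?t l y) (node_act act1 act2 act3 e y z)) \<in> L ?t"
    if le: "(l, e) \<in> node_rel m X1 X2 X3" and vS: "v \<in> S" and zZ: "z \<in> Z1 \<times> Z2 \<times> Z3" for l e v z
  proof -
    obtain e1 e2 e3 where e: "e = (e1, e2, e3)" by (cases e)
    obtain z1 z2 z3 where z: "z = (z1, z2, z3)" "z1 \<in> Z1" "z2 \<in> Z2" "z3 \<in> Z3" using zZ by (cases z) auto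
    obtain lb lg ld lam where r: "(lb, e1) \<in> X1" "(lg, e2) \<in> X2" "(ld, e3) \<in> X3"
      "\<And>r. l r + ld r = lb r + lg r" "dead_shifts ?t m l lam" "dead_shifts ?t m lb lam"
      "dead_shifts ?t m lg lam" "dead_shifts ?t m ld lam"
      using le unfolding node_rel_def cube_rel_def e by auto
    let ?P = "\<lambda>y b c. kern m F (v + lc ?t l y) (b + lc ?t lb y) (c + lc ?t lg y) (b + c - v + lc ?t ld y) *
     (R1 (b + lc ?t lb y) (act1 e1 y z1) * R2 (c + lc ?t lg y) (act2 e2 y z2) * R3 (b + c - v + lc ?t ld y) (act3 e3 y z3))"
    have "(\<lambda>y. expect S (\<lambda>b. expect S (\<lambda>c. ?P y b c))) \<in> L ?t"
      by (intro L_expect L_mult kern_L [where lam = lam] finite_S S_nonempty r(5-8) 1(3) [OF r(1)] 2(3) [OF r(2)] 3(3) [OF r(3)])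
         (use vS z assms(4) in \<open>auto intro: diff_S add_S\<close>)
    then show ?thesis
    proof (rule L_cong)
      fix y assume y: "y \<in> Y ?t"
      have ld: "lc ?t ld y = lc ?t lb y + lc ?t lg y - lc ?t l y"
        unfolding lc_add [symmetric] lc_diff [symmetric] by (rule lc_cong) (use r(4) in \<open>simp add: algebra_simps\<close>)
      show "expect S (\<lambda>b. expect S (\<lambda>c. ?P y b c)) =
         R (v + lc ?t l y) (node_act act1 act2 act3 e y z)"
        unfolding R_def e z node_act_def case_prod_conv
        using expect_S2_shift [OF lc_S [OF y, of lb] lc_S [OF y, of lg], of "\<lambda>b c.
          kern m F (v + lc ?t l y) b c (b + c - (v + lc ?t l y)) *
          (R1 b (act1 e1 y z1) * R2 c (act2 e2 y z2) * R3 (b + c - (v + lc ?t l y)) (act3 e3 y z3))"]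
        by (simp add: ld algebra_simps)
    qed
  qed
  moreover have "cubefun m F M1 M2 M3 v = expect (Z1 \<times> Z2 \<times> Z3) (\<lambda>z. R v z * G z)" if v: "v \<in> S" for v
  proof -
    let ?Q = "\<lambda>b c z. kern m F v b c (b + c - v) * (case z of (z1, z2, z3) \<Rightarrow> R1 b z1 * g1 z1 * (R2 c z2 * g2 z2) * (R3 (b + c - v) z3 * g3 z3))"
    have "cubefun m F M1 M2 M3 v = expect S (\<lambda>b. expect S (\<lambda>c. expect (Z1 \<times> Z2 \<times> Z3) (\<lambda>z. ?Q b c z)))"
      unfolding cubefun_def
    proof (rule expect_cong [OF refl], rule expect_cong [OF refl])
      fix b c assume b: "b \<in> S" "c \<in> S"
      show "kern m F v b c (b + c - v) * (M1 b * M2 c * M3 (b + c - v)) = expect (Z1 \<times> Z2 \<times> Z3) (\<lambda>z. ?Q b c z)"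
        unfolding expect_mult_left 1(4) [OF b(1)] 2(4) [OF b(2)] 3(4) [OF diff_S [OF add_S [OF b] v]] expect_mult3 ..
    qed
    also have "\<dots> = expect S (\<lambda>b. expect (Z1 \<times> Z2 \<times> Z3) (\<lambda>z. expect S (\<lambda>c. ?Q b c z)))"
      by (rule expect_cong [OF refl], rule expect_swap)
    also have "\<dots> = expect (Z1 \<times> Z2 \<times> Z3) (\<lambda>z. expect S (\<lambda>b. expect S (\<lambda>c. ?Q b c z)))"
      by (rule expect_swap)
    also have "\<dots> = expect (Z1 \<times> Z2 \<times> Z3) (\<lambda>z. R v z * G z)"
      unfolding R_def G_def expect_mult_right [symmetric] case_prod_unfold
      by (intro expect_cong refl) (simp add: mult.commute mult.left_commute)
    finally show ?thesis .
  qed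
  ultimately show ?thesis unfolding presented_def by blast
qed

lemma rich_node:
  assumes "rich m s1 X1 act1 G1 Z1 c1" "rich m s2 X2 act2 G2 Z2 c2" "rich m s3 X3 act3 G3 Z3 c3"
  shows "rich m True (node_rel m X1 X2 X3) (node_act act1 act2 act3) (node_funs G1 G2 G3) (Z1 \<times> Z2 \<times> Z3)
    (m + 5 + c1 + c2 + c3)"
  unfolding rich_def
proof (intro allI impI)
  fix F :: "'v \<Rightarrow> complex" assume F: "bdd F"
  from rich_cube [OF assms F] obtain M1 M2 M3 where M: "bdd M1" "bdd M2" "bdd M3"
    "presented (Suc m) X1 act1 G1 Z1 M1" "presented (Suc m) X2 act2 G2 Z2 M2" "presented (Suc m) X3 act3 G3 Z3 M3"
    "unorm (m + 2) F ^ (2 ^ (m + 5 + c1 + c2 + c3)) \<le> cmod (expect S (\<lambda>v. F v * cubefun m F M1 M2 M3 v))"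
    by blast
  show "\<exists>D. bdd D \<and> (True \<longrightarrow> structured (m + 2) D) \<and> presented (Suc m) (node_rel m X1 X2 X3) (node_act act1 act2 act3) (node_funs G1 G2 G3) (Z1 \<times> Z2 \<times> Z3) D \<and>
    unorm (m + 2) F ^ (2 ^ (m + 5 + c1 + c2 + c3)) \<le> cmod (expect S (\<lambda>v. F v * D v))"
    using presented_cubefun [OF M(4-6) F] M(7) cubefun_bdd [OF F M(1-3)] structured_cubefun [OF F M(1-3)] by blast
qed

text \<open>At a leaf the vertex \<open>c\<close> itself is the label and moves along
  \<open>lg\<close>. The two vertices beside it keep the function \<open>F\<close> or its conjugate,
  so their shifts have to be dead.\<close>

definition leaf_rel where
  "leaf_rel m = {(la, lg). \<exists>lb ld. dead (Suc m) lb \<and> dead (Suc m) ld \<and> cube_rel (Suc m) m la lb lg ld}"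

lemma rich_leaf: "rich m True (leaf_rel m) (\<lambda>l y z. z + lc (Suc m) l y) {G. bdd G} S (m + 2)"
  unfolding rich_def
proof (intro allI impI)
  fix F :: "'v \<Rightarrow> complex" assume F: "bdd F"
  let ?t = "Suc m" and ?F = "\<lambda>x. cnj (F x)"
  define R where "R v z = expect S (\<lambda>b. kern m F v b z (b + z - v) * (?F b * F (b + z - v)))" for v z
  have "cmod (R v z) \<le> 1" for v z
    unfolding R_def by (auto intro!: cmod_expect_le_1 mult_le_one simp: norm_mult kern_bdd F)
  moreover have "(\<lambda>y. R (v + lc ?t la y) (z + lc ?t lg y)) \<in> L ?t"
    if le: "(la, lg) \<in> leaf_rel m" and vS: "v \<in> S" and zS: "z \<in> S" for la lg v z
  proof -
    obtain lb ld lam where r: "dead ?t lb" "dead ?t ld"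
      "\<And>r. la r + ld r = lb r + lg r" "dead_shifts ?t m la lam" "dead_shifts ?t m lb lam"
      "dead_shifts ?t m lg lam" "dead_shifts ?t m ld lam"
      using le unfolding leaf_rel_def cube_rel_def by auto
    let ?P = "\<lambda>y b. kern m F (v + lc ?t la y) (b + lc ?t lb y) (z + lc ?t lg y) (b + z - v + lc ?t ld y) *
       (?F (b + lc ?t lb y) * F (b + z - v + lc ?t ld y))"
    have "(\<lambda>y. expect S (\<lambda>b. ?P y b)) \<in> L ?t"
      by (intro L_expect L_mult kern_L [where lam = lam] finite_S S_nonempty r(4-7) L_dead [OF r(1), of ?F] L_dead [OF r(2)])
         (use F in auto)
    then show ?thesis
    proof (rule L_cong)
      fix y assume y: "y \<in> Y ?t"
      have ld: "lc ?t ld y = lc ?t lb y + lc ?t lg y - lc ?t la y"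
        unfolding lc_add [symmetric] lc_diff [symmetric] by (rule lc_cong) (use r(3) in \<open>simp add: algebra_simps\<close>)
      show "expect S (\<lambda>b. ?P y b) = R (v + lc ?t la y) (z + lc ?t lg y)"
        unfolding R_def
        using expect_S_shift [OF lc_S [OF y, of lb], of "\<lambda>b. kern m F (v + lc ?t la y) b (z + lc ?t lg y)
          (b + (z + lc ?t lg y) - (v + lc ?t la y)) * (?F b * F (b + (z + lc ?t lg y) - (v + lc ?t la y)))"]
        by (simp add: ld algebra_simps)
    qed
  qed
  moreover have "cubefun m F ?F ?F F v = expect S (\<lambda>z. R v z * ?F z)" for v
    unfolding cubefun_def R_def expect_mult_right [symmetric]
    by (subst expect_swap) (simp add: mult.commute mult.left_commute)
  ultimately have "presented ?t (leaf_rel m) (\<lambda>l y z. z + lc ?t l y) {G. bdd G} S (cubefun m F ?F ?F F)"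
    unfolding presented_def using F by (intro exI [of _ R] exI [of _ ?F]) auto
  moreover have "bdd (cubefun m F ?F ?F F)" using cubefun_bdd [of F ?F ?F F] F by auto
  ultimately show "\<exists>D. bdd D \<and> (True \<longrightarrow> structured (m + 2) D) \<and> presented ?t (leaf_rel m) (\<lambda>l y z. z + lc ?t l y) {G. bdd G} S D \<and>
     unorm (m + 2) F ^ (2 ^ (m + 2)) \<le> cmod (expect S (\<lambda>v. F v * D v))"
    using cubeform_bound [of m F] structured_cubefun [of F ?F ?F F m] F unfolding cubeform_def by auto
qed

definition raw_rel :: "nat \<Rightarrow> ((nat \<Rightarrow> int) \<times> unit) set" where
  "raw_rel m = {(l, u). dead (Suc m) l}"

text \<open>\<open>F\<close> correlates with its conjugate at least as strongly as the square of its
  correlation with a bounded dual function; the squaring raises \<open>m + 2\<close> to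
  \<open>m + 3\<close>.\<close>

lemma rich_raw: "rich m False (raw_rel m) (\<lambda>_ _ z. z) {\<lambda>_. 1} {()} (m + 3)"
  unfolding rich_def
proof (intro allI impI)
  fix F :: "'v \<Rightarrow> complex" assume F: "bdd F"
  let ?F = "\<lambda>x. cnj (F x)"
  have "presented (Suc m) (raw_rel m) (\<lambda>_ _ z. z) {\<lambda>_. 1} {()} ?F"
    unfolding presented_def
    using F L_dead [of "Suc m" _ ?F] by (intro exI [of _ "\<lambda>v z. ?F v"] exI [of _ "\<lambda>_. 1"]) (auto simp: raw_rel_def)
  moreover have "unorm (m + 2) F ^ (2 ^ (m + 3)) \<le> cmod (expect S (\<lambda>v. F v * ?F v))"
  proof -
    have "(unorm (m + 2) F ^ (2 ^ (m + 2)))\<^sup>2 \<le> (cmod (cubeform m F F ?F ?F F))\<^sup>2"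
      by (rule power_mono [OF cubeform_bound]) (simp add: unorm_nonneg)
    also have "\<dots> \<le> Re (expect S (\<lambda>v. F v * ?F v))"
      unfolding cubeform_def by (rule expect_cs) (use F in \<open>auto intro!: cubefun_bdd\<close>)
    also have "\<dots> \<le> cmod (expect S (\<lambda>v. F v * ?F v))" by (rule complex_Re_le_cmod)
    finally show ?thesis by (simp add: power_mult [symmetric] power_add mult.commute)
  qed
  ultimately show "\<exists>D. bdd D \<and> (False \<longrightarrow> structured (m + 2) D) \<and> presented (Suc m) (raw_rel m) (\<lambda>_ _ z. z) {\<lambda>_. 1} {()} D \<and>
     unorm (m + 2) F ^ (2 ^ (m + 3)) \<le> cmod (expect S (\<lambda>v. F v * D v))"
    using F by (intro exI [of _ ?F]) auto
qed

section \<open>Links, splits and joins\<close>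

definition pair_act where
  "pair_act act1 act2 = (\<lambda>(e1, e2) y (z1, z2). (act1 e1 y z1, act2 e2 y z2))"

definition pair_funs :: "('a \<Rightarrow> complex) set \<Rightarrow> ('b \<Rightarrow> complex) set \<Rightarrow> ('a \<times> 'b \<Rightarrow> complex) set" where
  "pair_funs G1 G2 = {(\<lambda>(z1, z2). g1 z1 * g2 z2) | g1 g2. g1 \<in> G1 \<and> g2 \<in> G2}"

lemma pair_funsE:
  assumes "g \<in> pair_funs G1 G2"
  obtains g1 g2 where "g1 \<in> G1" "g2 \<in> G2" "\<And>z1 z2. g (z1, z2) = g1 z1 * g2 z2"
  using assms unfolding pair_funs_def by auto

lemma presentedE:
  assumes "presented t X act Gs Z D"
  obtains R G where "\<And>v z. cmod (R v z) \<le> 1" "G \<in> Gs"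
    "\<And>l e v z. (l, e) \<in> X \<Longrightarrow> v \<in> S \<Longrightarrow> z \<in> Z \<Longrightarrow> (\<lambda>y. R (v + lc t l y) (act e y z)) \<in> L t"
    "\<And>v. v \<in> S \<Longrightarrow> D v = expect Z (\<lambda>z. R v z * G z)"
  using assms unfolding presented_def by blast

lemma rich_map:
  assumes "rich m s X act Gs Z c" "bij_betw h Z' Z" "\<And>g. g \<in> Gs \<Longrightarrow> (\<lambda>z. g (h z)) \<in> Gs'"
    "\<And>l e'. (l, e') \<in> X' \<Longrightarrow> \<exists>e. (l, e) \<in> X \<and> (\<forall>y. \<forall>z\<in>Z'. act e y (h z) = h (act' e' y z))"
  shows "rich m s X' act' Gs' Z' c"
proof -
  have "presented t X' act' Gs' Z' D" if P: "presented t X act Gs Z D" for t D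
  proof -
    obtain R G where R: "\<And>v z. cmod (R v z) \<le> 1" "G \<in> Gs"
      "\<And>l e v z. (l, e) \<in> X \<Longrightarrow> v \<in> S \<Longrightarrow> z \<in> Z \<Longrightarrow> (\<lambda>y. R (v + lc t l y) (act e y z)) \<in> L t"
      "\<And>v. v \<in> S \<Longrightarrow> D v = expect Z (\<lambda>z. R v z * G z)"
      using P unfolding presented_def by blast
    show ?thesis unfolding presented_def
    proof (intro exI conjI)
      show "\<forall>v z. cmod (R v (h z)) \<le> 1" using R(1) by blast
      show "(\<lambda>z. G (h z)) \<in> Gs'" using assms(3) R(2) by blast
      show "\<forall>v\<in>S. D v = expect Z' (\<lambda>z. R v (h z) * G (h z))"
        by (simp add: R(4) expect_bij [OF assms(2), symmetric])
      show "\<forall>l e v z. (l, e) \<in> X' \<longrightarrow> v \<in> S \<longrightarrow> z \<in> Z' \<longrightarrow> (\<lambda>y. R (v + lc t l y) (h (act' e y z))) \<in> L t"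
      proof (intro allI impI)
        fix l e' v z assume l: "(l, e') \<in> X'" and v: "v \<in> S" and z: "z \<in> Z'"
        from assms(4) [OF l] obtain e where e: "(l, e) \<in> X" "\<And>y. act e y (h z) = h (act' e' y z)"
          using z by blast
        have "h z \<in> Z" using assms(2) z by (auto simp: bij_betw_def)
        from R(3) [OF e(1) v this] show "(\<lambda>y. R (v + lc t l y) (h (act' e' y z))) \<in> L t"
          by (simp add: e(2))
      qed
    qed
  qed
  then show ?thesis using assms(1) unfolding rich_def by blast
qed

text \<open>One vertex is raw, and its shift only has to be dead. In the typical case all shifts
  agree off one entry; there a split reads \<open>a = b + c\<close>, and a join reads
  \<open>b = a + d\<close>.\<close>

definition split_rel where
  "split_rel m a b c \<longleftrightarrow> (\<exists>d. dead (Suc m) d \<and> cube_rel (Suc m) m a b c d)"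

definition join_rel where
  "join_rel m a b d \<longleftrightarrow> (\<exists>c. dead (Suc m) c \<and> cube_rel (Suc m) m a b c d)"

text \<open>The cubes are those of a leaf, but the shift at \<open>c\<close> is handed on to another
  presented function instead of a label; the two other vertices are raw.\<close>

lemma rich_link:
  assumes "rich m s X act Gs Z c"
  shows "rich m True {(l, e). \<exists>l'. (l, l') \<in> leaf_rel m \<and> (l', e) \<in> X} act Gs Z (3 * m + 11 + c)"
proof -
  have "rich m True (node_rel m (raw_rel m) X (raw_rel m)) (node_act (\<lambda>_ _ z. z) act (\<lambda>_ _ z. z))
      (node_funs {\<lambda>_. 1} Gs {\<lambda>_. 1}) ({()} \<times> Z \<times> {()}) (m + 5 + (m + 3) + c + (m + 3))"
    by (rule rich_node [OF rich_raw assms rich_raw])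
  moreover have "m + 5 + (m + 3) + c + (m + 3) = 3 * m + 11 + c" by simp
  ultimately have "rich m True (node_rel m (raw_rel m) X (raw_rel m)) (node_act (\<lambda>_ _ z. z) act (\<lambda>_ _ z. z))
      (node_funs {\<lambda>_. 1} Gs {\<lambda>_. 1}) ({()} \<times> Z \<times> {()}) (3 * m + 11 + c)" by (simp only:)
  then show ?thesis
  proof (rule rich_map)
    show "bij_betw (\<lambda>z. ((), z, ())) Z ({()} \<times> Z \<times> {()})"
      by (rule bij_betw_byWitness [where f' = "\<lambda>(_, z, _). z"]) auto
    show "\<exists>e. (l, e) \<in> node_rel m (raw_rel m) X (raw_rel m) \<and> (\<forall>y. \<forall>z\<in>Z.
      node_act (\<lambda>_ _ z. z) act (\<lambda>_ _ z. z) e y ((), z, ()) = ((), act e' y z, ()))"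
      if "(l, e') \<in> {(l, e). \<exists>l'. (l, l') \<in> leaf_rel m \<and> (l', e) \<in> X}" for l e'
      using that by (intro exI [of _ "((), e', ())"]) (auto simp: node_rel_def leaf_rel_def raw_rel_def node_act_def)
  qed (auto simp: node_funs_def)
qed

lemma rich_split:
  assumes "rich m s1 X1 act1 G1 Z1 c1" "rich m s2 X2 act2 G2 Z2 c2"
  shows "rich m True {(l, (e1, e2)). \<exists>l1 l2. split_rel m l l1 l2 \<and> (l1, e1) \<in> X1 \<and> (l2, e2) \<in> X2}
    (pair_act act1 act2) (pair_funs G1 G2) (Z1 \<times> Z2) (2 * m + 8 + c1 + c2)"
proof -
  have "rich m True (node_rel m X1 X2 (raw_rel m)) (node_act act1 act2 (\<lambda>_ _ z. z))
      (node_funs G1 G2 {\<lambda>_. 1}) (Z1 \<times> Z2 \<times> {()}) (m + 5 + c1 + c2 + (m + 3))"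
    by (rule rich_node [OF assms rich_raw])
  moreover have "m + 5 + c1 + c2 + (m + 3) = 2 * m + 8 + c1 + c2" by simp
  ultimately have "rich m True (node_rel m X1 X2 (raw_rel m)) (node_act act1 act2 (\<lambda>_ _ z. z))
      (node_funs G1 G2 {\<lambda>_. 1}) (Z1 \<times> Z2 \<times> {()}) (2 * m + 8 + c1 + c2)" by (simp only:)
  then show ?thesis
  proof (rule rich_map)
    show "bij_betw (\<lambda>(z1, z2). (z1, z2, ())) (Z1 \<times> Z2) (Z1 \<times> Z2 \<times> {()})"
      by (rule bij_betw_byWitness [where f' = "\<lambda>(z1, z2, _). (z1, z2)"]) auto
    show "(\<lambda>z. g (case z of (z1, z2) \<Rightarrow> (z1, z2, ()))) \<in> pair_funs G1 G2" if g: "g \<in> node_funs G1 G2 {\<lambda>_. 1}" for g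
    proof -
      obtain g1 g2 where "g1 \<in> G1" "g2 \<in> G2" "\<And>z. g z = (case z of (z1, z2, _) \<Rightarrow> g1 z1 * g2 z2)"
        using g unfolding node_funs_def by auto
      then show ?thesis unfolding pair_funs_def
        by (intro CollectI exI [of _ g1] exI [of _ g2]) (auto simp: fun_eq_iff)
    qed
    show "\<exists>e. (l, e) \<in> node_rel m X1 X2 (raw_rel m) \<and> (\<forall>y. \<forall>z\<in>Z1 \<times> Z2.
      node_act act1 act2 (\<lambda>_ _ z. z) e y (case z of (z1, z2) \<Rightarrow> (z1, z2, ())) =
        (case pair_act act1 act2 e' y z of (z1, z2) \<Rightarrow> (z1, z2, ())))"
      if "(l, e') \<in> {(l, (e1, e2)). \<exists>l1 l2. split_rel m l l1 l2 \<and> (l1, e1) \<in> X1 \<and> (l2, e2) \<in> X2}" for l e'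
      using that by (intro exI [of _ "(fst e', snd e', ())"])
        (auto simp: node_rel_def split_rel_def raw_rel_def node_act_def pair_act_def, blast)
  qed
qed

lemma rich_join:
  assumes "rich m s1 X1 act1 G1 Z1 c1" "rich m s2 X2 act2 G2 Z2 c2"
  shows "rich m True {(l, (e1, e2)). \<exists>l1 l2. join_rel m l l1 l2 \<and> (l1, e1) \<in> X1 \<and> (l2, e2) \<in> X2}
    (pair_act act1 act2) (pair_funs G1 G2) (Z1 \<times> Z2) (2 * m + 8 + c1 + c2)"
proof -
  have "rich m True (node_rel m X1 (raw_rel m) X2) (node_act act1 (\<lambda>_ _ z. z) act2)
      (node_funs G1 {\<lambda>_. 1} G2) (Z1 \<times> {()} \<times> Z2) (m + 5 + c1 + (m + 3) + c2)"
    by (rule rich_node [OF assms(1) rich_raw assms(2)])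
  moreover have "m + 5 + c1 + (m + 3) + c2 = 2 * m + 8 + c1 + c2" by simp
  ultimately have "rich m True (node_rel m X1 (raw_rel m) X2) (node_act act1 (\<lambda>_ _ z. z) act2)
      (node_funs G1 {\<lambda>_. 1} G2) (Z1 \<times> {()} \<times> Z2) (2 * m + 8 + c1 + c2)" by (simp only:)
  then show ?thesis
  proof (rule rich_map)
    show "bij_betw (\<lambda>(z1, z2). (z1, (), z2)) (Z1 \<times> Z2) (Z1 \<times> {()} \<times> Z2)"
      by (rule bij_betw_byWitness [where f' = "\<lambda>(z1, _, z2). (z1, z2)"]) auto
    show "(\<lambda>z. g (case z of (z1, z2) \<Rightarrow> (z1, (), z2))) \<in> pair_funs G1 G2" if g: "g \<in> node_funs G1 {\<lambda>_. 1} G2" for g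
    proof -
      obtain g1 g2 where "g1 \<in> G1" "g2 \<in> G2" "\<And>z. g z = (case z of (z1, _, z2) \<Rightarrow> g1 z1 * g2 z2)"
        using g unfolding node_funs_def by auto
      then show ?thesis unfolding pair_funs_def
        by (intro CollectI exI [of _ g1] exI [of _ g2]) (auto simp: fun_eq_iff)
    qed
    show "\<exists>e. (l, e) \<in> node_rel m X1 (raw_rel m) X2 \<and> (\<forall>y. \<forall>z\<in>Z1 \<times> Z2.
      node_act act1 (\<lambda>_ _ z. z) act2 e y (case z of (z1, z2) \<Rightarrow> (z1, (), z2)) =
        (case pair_act act1 act2 e' y z of (z1, z2) \<Rightarrow> (z1, (), z2)))"
      if "(l, e') \<in> {(l, (e1, e2)). \<exists>l1 l2. join_rel m l l1 l2 \<and> (l1, e1) \<in> X1 \<and> (l2, e2) \<in> X2}" for l e'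
      using that by (intro exI [of _ "(fst e', (), snd e')"])
        (auto simp: node_rel_def join_rel_def raw_rel_def node_act_def pair_act_def, blast)
  qed
qed

section \<open>Moves past three registers\<close>

abbreviation link where
  "link m a b \<equiv> (a, b) \<in> leaf_rel m"

text \<open>A move is a chain of such relations from the argument (shifted by \<open>w\<close>) past three registers
  \<open>P\<close>, \<open>Q\<close>, \<open>A\<close>. In the computations below, \<open>P\<close> holds a vector whose entries are multiplied into entry
  \<open>0\<close>, \<open>Q\<close> a partial product, and entry \<open>0\<close> of \<open>A\<close> the sum of the products found so far.\<close>

definition move :: "nat \<Rightarrow> (nat \<Rightarrow> int) \<Rightarrow> (nat \<Rightarrow> int) \<times> (nat \<Rightarrow> int) \<times> (nat \<Rightarrow> int) \<Rightarrow>
    (nat \<Rightarrow> int) \<times> (nat \<Rightarrow> int) \<times> (nat \<Rightarrow> int) \<Rightarrow> bool" where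
  "move m w = (\<lambda>(P, Q, A) (P', Q', A'). \<exists>v0 P0 P1 P2 v1 v2 Q0 Q1 Q2 v3 v4 A0 A1.
     link m w v0 \<and> join_rel m v0 P1 P0 \<and> link m P0 P \<and> split_rel m P1 P2 v1 \<and> link m P2 P' \<and>
     link m v1 v2 \<and> join_rel m v2 Q1 Q0 \<and> link m Q0 Q \<and> split_rel m Q1 Q2 v3 \<and> link m Q2 Q' \<and>
     link m v3 v4 \<and> join_rel m v4 A1 A0 \<and> link m A0 A \<and> link m A1 A')"

abbreviation S3 :: "('v \<times> 'v \<times> 'v) set" where
  "S3 \<equiv> S \<times> S \<times> S"

definition sh3 :: "nat \<Rightarrow> (nat \<Rightarrow> int) \<times> (nat \<Rightarrow> int) \<times> (nat \<Rightarrow> int) \<Rightarrow> (nat \<Rightarrow> 'v) \<Rightarrow> 'v \<times> 'v \<times> 'v \<Rightarrow> 'v \<times> 'v \<times> 'v" where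
  "sh3 t = (\<lambda>(a, b, c) y (u, v, w). (u + lc t a y, v + lc t b y, w + lc t c y))"

definition stepfun :: "nat \<Rightarrow> ('v \<Rightarrow> complex) \<Rightarrow> bool" where
  "stepfun m D \<longleftrightarrow> (\<exists>R G G'. (\<forall>v z z'. cmod (R v z z') \<le> 1) \<and> bdd G \<and> bdd G' \<and>
     (\<forall>w e e'. move m w e e' \<longrightarrow> (\<forall>v\<in>S. \<forall>z\<in>S3. \<forall>z'\<in>S3.
        (\<lambda>y. R (v + lc (Suc m) w y) (sh3 (Suc m) e y z) (sh3 (Suc m) e' y z')) \<in> L (Suc m))) \<and>
     (\<forall>v\<in>S. D v = expect S3 (\<lambda>z. expect S3 (\<lambda>z'. R v z z' * (G z * G' z')))))"

text \<open>Structure of degree \<open>Suc m\<close> is one degree better than what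
  \<open>rich_stepfun\<close> supplies, and then \<open>R\<close> can ignore the labels.\<close>

lemma structured_imp_stepfun:
  assumes "structured (Suc m) D" "bdd D"
  shows "stepfun m D"
  unfolding stepfun_def
proof (intro exI conjI)
  show "\<forall>v\<in>S. D v = expect S3 (\<lambda>z. expect S3 (\<lambda>z'. (\<lambda>v z z'. D v) v z z' * ((\<lambda>_. 1) z * (\<lambda>_. 1) z')))"
    using finite_S S_nonempty by simp
qed (use assms in \<open>auto simp: structured_def\<close>)

theorem rich_stepfun:
  assumes F: "bdd F"
  shows "\<exists>D. bdd D \<and> structured (m + 2) D \<and> stepfun m D \<and>
    unorm (m + 2) F ^ (2 ^ (25 * m + 85)) \<le> cmod (expect S (\<lambda>v. F v * D v))"
proof -
  \<comment> \<open>The nesting follows the chain in \<open>move\<close>; its leaves are, in order,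
    those of \<open>P'\<close>, \<open>Q'\<close>, \<open>A'\<close>, \<open>A\<close>,
    \<open>Q\<close>, \<open>P\<close>. Three links, three joins, two splits and six leaves cost
    \<open>25 * m + 85\<close>.\<close>
  note tree = rich_link [OF rich_join [OF rich_split [OF rich_leaf rich_link [OF rich_join [OF rich_split [OF
      rich_leaf rich_link [OF rich_join [OF rich_leaf rich_leaf]]] rich_leaf]]] rich_leaf]]
  let ?Z = "(S \<times> (S \<times> S \<times> S) \<times> S) \<times> S"
  let ?X = "{(l, e). \<exists>l'. link m l l' \<and> (l', e) \<in> {(l, (e1, e2)). \<exists>l1 l2. join_rel m l l1 l2 \<and>
      (l1, e1) \<in> {(l, (e1, e2)). \<exists>l1 l2. split_rel m l l1 l2 \<and> link m l1 e1 \<and>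
      (l2, e2) \<in> {(l, e). \<exists>l'. link m l l' \<and> (l', e) \<in> {(l, (e1, e2)). \<exists>l1 l2. join_rel m l l1 l2 \<and>
      (l1, e1) \<in> {(l, (e1, e2)). \<exists>l1 l2. split_rel m l l1 l2 \<and> link m l1 e1 \<and>
      (l2, e2) \<in> {(l, e). \<exists>l'. link m l l' \<and> (l', e) \<in> {(l, (e1, e2)). \<exists>l1 l2. join_rel m l l1 l2 \<and> link m l1 e1 \<and> link m l2 e2}}} \<and>
      link m l2 e2}}} \<and> link m l2 e2}}"
  let ?lf = "\<lambda>l y z. z + lc (Suc m) l y"
  have c: "3 * m + 11 + (2 * m + 8 + (2 * m + 8 + (m + 2) + (3 * m + 11 + (2 * m + 8 + (2 * m + 8 + (m + 2) +
    (3 * m + 11 + (2 * m + 8 + (m + 2) + (m + 2)))) + (m + 2)))) + (m + 2)) = 25 * m + 85" by simp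
  from tree [of m, unfolded c rich_def, THEN spec, THEN mp, OF F]
  obtain D where D: "bdd D" "structured (m + 2) D" "unorm (m + 2) F ^ (2 ^ (25 * m + 85)) \<le> cmod (expect S (\<lambda>v. F v * D v))"
    and P: "presented (Suc m) ?X
      (pair_act (pair_act ?lf (pair_act (pair_act ?lf (pair_act ?lf ?lf)) ?lf)) ?lf)
      (pair_funs (pair_funs {G. bdd G} (pair_funs (pair_funs {G. bdd G} (pair_funs {G. bdd G} {G. bdd G})) {G. bdd G})) {G. bdd G})
      ?Z D"
    by (elim exE conjE) (rule that, assumption, erule mp, rule TrueI, assumption+)
  have mem: "(w, ((P', ((Q', (A', A)), Q)), P)) \<in> ?X"
    if mv: "move m w (P, Q, A) (P', Q', A')" for w P Q A P' Q' A'
  proof -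
    from mv obtain v0 P0 P1 P2 v1 v2 Q0 Q1 Q2 v3 v4 A0 A1 where
      s: "link m w v0" "join_rel m v0 P1 P0" "link m P0 P" "split_rel m P1 P2 v1" "link m P2 P'"
        "link m v1 v2" "join_rel m v2 Q1 Q0" "link m Q0 Q" "split_rel m Q1 Q2 v3" "link m Q2 Q'"
        "link m v3 v4" "join_rel m v4 A1 A0" "link m A0 A" "link m A1 A'"
      unfolding move_def case_prod_conv by (elim exE conjE)
    show ?thesis
      unfolding mem_Collect_eq case_prod_conv
      by (rule exI [of _ v0], rule conjI, rule s(1), rule exI [of _ P1], rule exI [of _ P0], rule conjI, rule s(2),
        rule conjI, rule exI [of _ P2], rule exI [of _ v1], rule conjI, rule s(4), rule conjI, rule s(5),
        rule exI [of _ v2], rule conjI, rule s(6), rule exI [of _ Q1], rule exI [of _ Q0], rule conjI, rule s(7),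
        rule conjI, rule exI [of _ Q2], rule exI [of _ v3], rule conjI, rule s(9), rule conjI, rule s(10),
        rule exI [of _ v4], rule conjI, rule s(11), rule exI [of _ A1], rule exI [of _ A0],
        intro conjI, (rule s)+)
  qed
  from P obtain R G where R: "\<And>v z. cmod (R v z) \<le> 1"
    and G: "G \<in> pair_funs (pair_funs {G. bdd G} (pair_funs (pair_funs {G. bdd G} (pair_funs {G. bdd G} {G. bdd G})) {G. bdd G})) {G. bdd G}"
    and R3: "\<And>l e v z. (l, e) \<in> ?X \<Longrightarrow> v \<in> S \<Longrightarrow> z \<in> ?Z \<Longrightarrow>
      (\<lambda>y. R (v + lc (Suc m) l y) (pair_act (pair_act ?lf (pair_act (pair_act ?lf (pair_act ?lf ?lf)) ?lf)) ?lf e y z)) \<in> L (Suc m)"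
    and Dv: "\<And>v. v \<in> S \<Longrightarrow> D v = expect ?Z (\<lambda>z. R v z * G z)"
    by (erule presentedE)
  note Rf = R3 [OF mem]
  from G obtain g1 gP where g1: "g1 \<in> pair_funs {G. bdd G} (pair_funs (pair_funs {G. bdd G} (pair_funs {G. bdd G} {G. bdd G})) {G. bdd G})"
    "bdd gP" "\<And>a b. G (a, b) = g1 a * gP b" by (rule pair_funsE) blast
  from g1(1) obtain gP' g2 where g2: "g2 \<in> pair_funs (pair_funs {G. bdd G} (pair_funs {G. bdd G} {G. bdd G})) {G. bdd G}"
    "bdd gP'" "\<And>a b. g1 (a, b) = gP' a * g2 b" by (rule pair_funsE) blast
  from g2(1) obtain g3 gQ where g3: "g3 \<in> pair_funs {G. bdd G} (pair_funs {G. bdd G} {G. bdd G})"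
    "bdd gQ" "\<And>a b. g2 (a, b) = g3 a * gQ b" by (rule pair_funsE) blast
  from g3(1) obtain gQ' g4 where g4: "g4 \<in> pair_funs {G. bdd G} {G. bdd G}"
    "bdd gQ'" "\<And>a b. g3 (a, b) = gQ' a * g4 b" by (rule pair_funsE) blast
  from g4(1) obtain gA' gA where g5: "bdd gA'" "bdd gA" "\<And>a b. g4 (a, b) = gA' a * gA b"
    by (rule pair_funsE) blast
  have g: "G ((P', ((Q', (A', A)), Q)), P) = (gP P * (gQ Q * gA A)) * (gP' P' * (gQ' Q' * gA' A'))" for P Q A P' Q' A'
    unfolding g1(3) g2(3) g3(3) g4(3) g5(3) by (simp only: mult.commute mult.left_commute)
  define emb where "emb = (\<lambda>(P :: 'v, Q :: 'v, A :: 'v) (P' :: 'v, Q' :: 'v, A' :: 'v). ((P', ((Q', (A', A)), Q)), P))"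
  have "bij_betw (\<lambda>(z, z'). emb z z') (S3 \<times> S3) ?Z"
    by (rule bij_betw_byWitness [where f' = "\<lambda>((P', ((Q', (A', A)), Q)), P). ((P, Q, A), (P', Q', A'))"])
      (auto simp: emb_def)
  then have emb: "expect ?Z f = expect S3 (\<lambda>z. expect S3 (\<lambda>z'. f (emb z z')))" for f
    by (simp only: expect_bij [symmetric] expect_Times [of S3 S3] case_prod_conv)
  have "stepfun m D"
    unfolding stepfun_def
  proof (intro exI conjI)
    show "\<forall>v z z'. cmod (R v (emb z z')) \<le> 1" using R by blast
    show "bdd (\<lambda>(P, Q, A). gP P * (gQ Q * gA A))" "bdd (\<lambda>(P, Q, A). gP' P * (gQ' Q * gA' A))"
      using g1(2) g2(2) g3(2) g4(2) g5 by (auto simp: norm_mult intro!: mult_le_one)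
    show "\<forall>v\<in>S. D v = expect S3 (\<lambda>z. expect S3 (\<lambda>z'. R v (emb z z') *
        ((\<lambda>(P, Q, A). gP P * (gQ Q * gA A)) z * (\<lambda>(P, Q, A). gP' P * (gQ' Q * gA' A)) z')))"
    proof
      fix v assume "v \<in> S"
      have "G (emb z z') = (\<lambda>(P, Q, A). gP P * (gQ Q * gA A)) z * (\<lambda>(P, Q, A). gP' P * (gQ' Q * gA' A)) z'" for z z'
        by (cases z; cases z') (simp add: emb_def g)
      with Dv [OF \<open>v \<in> S\<close>] show "D v = expect S3 (\<lambda>z. expect S3 (\<lambda>z'. R v (emb z z') *
        ((\<lambda>(P, Q, A). gP P * (gQ Q * gA A)) z * (\<lambda>(P, Q, A). gP' P * (gQ' Q * gA' A)) z')))"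
        by (simp only: emb)
    qed
    show "\<forall>w e e'. move m w e e' \<longrightarrow> (\<forall>v\<in>S. \<forall>z\<in>S3. \<forall>z'\<in>S3.
        (\<lambda>y. R (v + lc (Suc m) w y) (emb (sh3 (Suc m) e y z) (sh3 (Suc m) e' y z'))) \<in> L (Suc m))"
    proof (intro allI impI ballI)
      fix w e e' v z z' assume mv: "move m w e e'" and v: "v \<in> S" and z: "z \<in> S3" "z' \<in> S3"
      obtain P Q A P' Q' A' where e: "e = (P, Q, A)" "e' = (P', Q', A')" by (cases e; cases e') blast
      obtain a b c a' b' c' where zz: "z = (a, b, c)" "z' = (a', b', c')" by (cases z; cases z') blast
      have "emb z z' \<in> ?Z" using z by (auto simp: emb_def zz)
      from Rf [OF mv [unfolded e] v this]
      show "(\<lambda>y. R (v + lc (Suc m) w y) (emb (sh3 (Suc m) e y z) (sh3 (Suc m) e' y z'))) \<in> L (Suc m)"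
        by (simp add: emb_def zz e sh3_def pair_act_def)
    qed
  qed
  then show ?thesis using D by blast
qed

text \<open>The map \<open>i\<close> matches the \<open>m\<close> directions with the
  \<open>m\<close> entries other than \<open>r\<close>. Each direction clears its entry, where the
  four vectors agree.\<close>

lemma cube_line:
  assumes r: "r < Suc m" and eq: "\<And>s. s \<noteq> r \<Longrightarrow> lb s = la s" "\<And>s. s \<noteq> r \<Longrightarrow> lg s = la s" "\<And>s. s \<noteq> r \<Longrightarrow> ld s = la s"
    and sum: "la r + ld r = lb r + lg r"
  shows "cube_rel (Suc m) m la lb lg ld"
proof -
  define i where "i s = (if s < r then s else Suc s)" for s
  define lam :: "nat \<Rightarrow> nat \<Rightarrow> int" where "lam s q = (if q = i s then - la q else 0)" for s q
  have inj: "i s = i s' \<longleftrightarrow> s = s'" for s s' by (auto simp: i_def)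
  have ds: "dead_shifts (Suc m) m l lam" if l: "\<And>s. s \<noteq> r \<Longrightarrow> l s = la s" for l
    unfolding dead_shifts_def dead_def
  proof (intro allI impI)
    fix W assume W: "W \<subseteq> {..<m}" "W \<noteq> {}"
    then obtain s where s: "s \<in> W" "s < m" by auto
    have fin: "finite W" using W finite_subset by blast
    have "(\<Sum>s'\<in>W. lam s' (i s)) = - la (i s)"
      using s fin by (subst sum.remove [of W s]) (auto simp: lam_def inj intro!: sum.neutral)
    moreover have "l (i s) = la (i s)" by (rule l) (auto simp: i_def)
    ultimately show "\<exists>q<Suc m. int p dvd l q + (\<Sum>s\<in>W. lam s q)"
      using s r by (intro exI [of _ "i s"]) (auto simp: i_def)
  qed
  have "la s + ld s = lb s + lg s" for s using eq sum by (cases "s = r") auto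
  then show ?thesis unfolding cube_rel_def using ds eq by blast
qed

lemma cube_dead:
  assumes "dead (Suc m) la" "dead (Suc m) lg"
  shows "cube_rel (Suc m) m la la lg lg"
  unfolding cube_rel_def dead_shifts_def
  by (intro conjI exI [of _ "\<lambda>_ _. 0"]) (use assms in auto)

text \<open>The relation between \<open>(2a, b)\<close> and \<open>(a, 2b)\<close> rests on a single cube: the shift by
  \<open>-(a, b)\<close>, used in two directions, kills every other vertex.\<close>

lemma cube_double:
  assumes r: "0 < r" "r < Suc m"
  shows "cube_rel (Suc m) m (l(0 := 2 * a, r := b)) (l(0 := a, r := 0)) (l(0 := a, r := 2 * b)) (l(0 := 0, r := b))"
proof -
  \<comment> \<open>Direction \<open>s\<close> clears entry \<open>Suc s\<close>, except that
    \<open>r - 1\<close> carries the shift. Alone it still clears entry 0 or \<open>r\<close>,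
    because each vertex has \<open>a\<close> in the former or \<open>b\<close> in the
    latter.\<close>
  define lam :: "nat \<Rightarrow> nat \<Rightarrow> int" where
    "lam s q = (if Suc s = r then (if q = 0 then - a else if q = r then - b else 0)
       else if q = Suc s then - l q else 0)" for s q
  have ds: "dead_shifts (Suc m) m (l(0 := x, r := y)) lam" if xy: "x = a \<or> y = b" for x y
    unfolding dead_shifts_def dead_def
  proof (intro allI impI)
    fix W assume W: "W \<subseteq> {..<m}" "W \<noteq> {}"
    have fin: "finite W" using W finite_subset by blast
    show "\<exists>q<Suc m. int p dvd (l(0 := x, r := y)) q + (\<Sum>s\<in>W. lam s q)"
    proof (cases "\<exists>s\<in>W. Suc s \<noteq> r")
      case True
      then obtain s where s: "s \<in> W" "Suc s \<noteq> r" by auto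
      have "(\<Sum>s'\<in>W. lam s' (Suc s)) = - l (Suc s)"
        using s fin by (subst sum.remove [of W s]) (auto simp: lam_def intro!: sum.neutral split: if_splits)
      then show ?thesis using s W by (intro exI [of _ "Suc s"]) auto
    next
      case False
      then have "W = {r - 1}" using W(2) r by force
      then show ?thesis using xy r by (elim disjE; intro exI [of _ "if x = a then 0 else r"]) (auto simp: lam_def)
    qed
  qed
  have "(l(0 := 2 * a, r := b)) q + (l(0 := 0, r := b)) q = (l(0 := a, r := 0)) q + (l(0 := a, r := 2 * b)) q" for q
    using r by auto
  then show ?thesis unfolding cube_rel_def using ds by blast
qed

lemma dead_0: "l 0 = 0 \<Longrightarrow> dead (Suc m) l"
  by (auto simp: dead_def intro: exI [of _ 0])

lemma dead_r: "l r = 0 \<Longrightarrow> r < Suc m \<Longrightarrow> dead (Suc m) l"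
  by (auto simp: dead_def intro: exI [of _ r])

lemma link_refl: "link m l l"
  unfolding leaf_rel_def
  by (intro CollectI case_prodI exI [of _ "l(0 := 0)"] conjI cube_line [of 0]) (auto simp: dead_0)

text \<open>A degenerate parallelogram links any two dead vectors, so a register with dead content
  can be overwritten at will.\<close>

lemma link_dead: "dead (Suc m) l \<Longrightarrow> dead (Suc m) l' \<Longrightarrow> link m l l'"
  unfolding leaf_rel_def using cube_dead by blast

lemma link_0: "l 0 = 0 \<Longrightarrow> l' 0 = 0 \<Longrightarrow> link m l l'"
  by (intro link_dead dead_0)

lemma link_sym: "link m l l' \<Longrightarrow> link m l' l"
  unfolding leaf_rel_def cube_rel_def by (auto simp: add.commute) metis

text \<open>The engine of multiplication: a factor 2 passes between two entries and their product is
  preserved.\<close>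

lemma link_double:
  assumes "0 < r" "r < Suc m"
  shows "link m (l(0 := 2 * a, r := b)) (l(0 := a, r := 2 * b))"
  unfolding leaf_rel_def
  by (rule CollectI, rule case_prodI, rule exI [of _ "l(0 := a, r := 0)"], rule exI [of _ "l(0 := 0, r := b)"])
    (use assms cube_double [OF assms] in \<open>auto intro: dead_r [of _ r] dead_0\<close>)

lemma split_line:
  assumes "r < Suc m" "\<And>s. s \<noteq> r \<Longrightarrow> b s = a s" "\<And>s. s \<noteq> r \<Longrightarrow> c s = a s" "a r = b r + c r"
  shows "split_rel m a b c"
  unfolding split_rel_def
  by (intro exI [of _ "a(r := 0)"] conjI cube_line [of r]) (use assms in \<open>auto intro: dead_r [of _ r]\<close>)

lemma join_line:
  assumes "r < Suc m" "\<And>s. s \<noteq> r \<Longrightarrow> b s = a s" "\<And>s. s \<noteq> r \<Longrightarrow> d s = a s" "b r = a r + d r"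
  shows "join_rel m a b d"
  unfolding join_rel_def
  by (intro exI [of _ "a(r := 0)"] conjI cube_line [of r]) (use assms in \<open>auto intro: dead_r [of _ r]\<close>)

section \<open>Elementary moves\<close>

lemma moveI:
  assumes "link m w v0" "join_rel m v0 P1 P0" "link m P0 P" "split_rel m P1 P2 v1" "link m P2 P'"
     "link m v1 v2" "join_rel m v2 Q1 Q0" "link m Q0 Q" "split_rel m Q1 Q2 v3" "link m Q2 Q'"
     "link m v3 v4" "join_rel m v4 A1 A0" "link m A0 A" "link m A1 A'"
  shows "move m w (P, Q, A) (P', Q', A')"
  unfolding move_def case_prod_conv
  by (rule exI [of _ v0], rule exI [of _ P0], rule exI [of _ P1], rule exI [of _ P2], rule exI [of _ v1],
    rule exI [of _ v2], rule exI [of _ Q0], rule exI [of _ Q1], rule exI [of _ Q2], rule exI [of _ v3],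
    rule exI [of _ v4], rule exI [of _ A0], rule exI [of _ A1], intro conjI assms)

text \<open>The chain passes each register as its content with entry 0 cleared. These vectors are
  dead, so they can be relinked from one register to the next.\<close>

lemma move_idle: "move m (\<lambda>_. 0) (P, Q, A) (P, Q, A)"
  by (rule moveI [of _ "P(0 := 0)" m P P P P "P(0 := 0)" P "Q(0 := 0)" Q Q Q Q "Q(0 := 0)" Q "A(0 := 0)" A A A A])
    (auto intro!: link_refl link_dead dead_0 split_line [of 0] join_line [of 0])

lemma move_load:
  assumes "dead (Suc m) P" "dead (Suc m) Q" "dead (Suc m) Q'"
  shows "move m w (P, Q, A) (w, Q', A)"
  by (rule moveI [of _ w m w "w(0 := 0)" P w "w(0 := 0)" w "Q'(0 := 0)" Q' Q' Q Q' "Q'(0 := 0)" Q' "A(0 := 0)" A A A A])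
    (use assms in \<open>auto intro!: link_refl link_dead dead_0 split_line [of 0] join_line [of 0]\<close>)

text \<open>The invariant is \<open>q\<close> plus the product of entries 0 and \<open>r\<close> of
  \<open>P\<close>. The last digit is split off as a vector with entries \<open>a\<close>,
  \<open>b\<close>, which is linked to one with entries \<open>a * b\<close>, 1 (equal if
  \<open>b = 1\<close>, both dead if \<open>b = 0\<close>). This agrees with \<open>Q\<close> in
  entry \<open>r\<close> and can be added to it.\<close>

lemma move_digit:
  assumes r: "0 < r" "r < Suc m" and b: "b = 0 \<or> b = 1"
  shows "move m (\<lambda>_. 0) (l(0 := a, r := 2 * c + b), l(0 := q, r := 1), A)
     (l(0 := 2 * a, r := c), l(0 := q + a * b, r := 1), A)"
proof -
  have v: "link m (l(0 := a, r := b)) (l(0 := a * b, r := 1))"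
  proof (cases "b = 0")
    case True
    then show ?thesis using r by (intro link_dead) (auto intro: dead_0 dead_r [of _ r])
  next
    case False
    then show ?thesis using b by (simp add: link_refl)
  qed
  show ?thesis
    by (rule moveI [of _ "l(0 := 0, r := 2 * c + b)" m "l(0 := a, r := 2 * c + b)" "l(0 := a, r := 2 * c + b)" _
     "l(0 := a, r := 2 * c)" "l(0 := a, r := b)" _ "l(0 := a * b, r := 1)" "l(0 := q + a * b, r := 1)" "l(0 := q, r := 1)" _
     "l(0 := q + a * b, r := 1)" "l(0 := 0, r := 1)" _ "A(0 := 0)" A A A A])
    (use r v in \<open>auto intro: link_refl link_0 link_sym [OF link_double [OF r]]
       split_line [of r] split_line [of 0] join_line [of 0]\<close>)
qed

text \<open>Meant to be run in reverse: the multiplier \<open>2 * c - 1\<close> becomes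
  \<open>c\<close>, and \<open>a\<close> is subtracted from the partial product.\<close>

lemma move_digit_inverse:
  assumes r: "0 < r" "r < Suc m"
  shows "move m (\<lambda>_. 0) (l(0 := 2 * a, r := c), l(0 := q - a, r := 1), A)
     (l(0 := a, r := 2 * c - 1), l(0 := q, r := 1), A)"
  by (rule moveI [of _ "l(0 := 0, r := 2 * c)" m "l(0 := a, r := 2 * c)" "l(0 := a, r := 2 * c)" _
     "l(0 := a, r := 2 * c - 1)" "l(0 := a, r := 1)" _ "l(0 := a, r := 1)" "l(0 := q, r := 1)" "l(0 := q - a, r := 1)" _
     "l(0 := q, r := 1)" "l(0 := 0, r := 1)" _ "A(0 := 0)" A A A A])
    (use r in \<open>auto intro: link_refl link_0 link_dead dead_0 dead_r link_sym [OF link_double [OF r]]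
       split_line [of r] split_line [of 0] join_line [of 0]\<close>)

text \<open>Entry 0 of \<open>P\<close> is filled on credit: the chain carries the debt
  \<open>- x 0\<close> on to \<open>Q\<close>, where it cancels the content.\<close>

lemma move_back:
  assumes "dead (Suc m) P" "dead (Suc m) Q'"
  shows "move m (\<lambda>_. 0) (P, x, A) (x, Q', A)"
  by (rule moveI [of _ "x(0 := 0)" m "x(0 := 0)" "x(0 := 0)" _ x "x(0 := - x 0)" _ "x(0 := - x 0)" "x(0 := 0)" x _
     "x(0 := 0)" "x(0 := 0)" _ "A(0 := 0)" A A A A])
    (use assms in \<open>auto intro!: link_refl link_dead dead_0 split_line [of 0] join_line [of 0]\<close>)

text \<open>Ones off entry 0 are the form in which a finished product leaves the multiplication, and
  \<open>join_line\<close> adds in entry 0 only vectors that agree elsewhere.\<close>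

definition acc :: "int \<Rightarrow> nat \<Rightarrow> int" where
  "acc a r = (if r = 0 then a else 1)"

lemma move_out:
  assumes "dead (Suc m) Q" "dead (Suc m) P'" "dead (Suc m) Q'"
  shows "move m (\<lambda>_. 0) (acc a, Q, acc b) (P', Q', acc (b + a))"
  by (rule moveI [of _ "acc 0" m "acc a" "acc a" _ "acc 0" "acc a" _ "acc a" "acc a" "acc 0" _
     "acc 0" "acc a" _ "acc a" "acc (b + a)" "acc b" _])
    (use assms in \<open>auto simp: acc_def intro!: link_refl link_dead dead_0 split_line [of 0] join_line [of 0]\<close>)

text \<open>This corresponds to the operator times its adjoint. The adjoint half runs a move in
  reverse and always has argument shift 0.\<close>

definition macro where
  "macro m w e e'' \<longleftrightarrow> (\<exists>e'. move m w e e' \<and> move m (\<lambda>_. 0) e'' e')"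

section \<open>Runs that multiply and accumulate\<close>

fun run where
  "run m [] e e' \<longleftrightarrow> e = e'"
| "run m (w # ws) e e'' \<longleftrightarrow> (\<exists>e'. macro m w e e' \<and> run m ws e' e'')"

lemma run_append: "run m (ws @ ws') e e'' \<longleftrightarrow> (\<exists>e'. run m ws e e' \<and> run m ws' e' e'')"
proof (induction ws arbitrary: e)
  case (Cons w ws)
  then show ?case unfolding append_Cons run.simps(2) by blast
qed simp

lemma macro_fwd: "move m w e (P, Q, A) \<Longrightarrow> macro m w e (P, Q, A)"
  unfolding macro_def using move_idle by blast

lemma macro_bwd: "move m (\<lambda>_. 0) e'' (P, Q, A) \<Longrightarrow> macro m (\<lambda>_. 0) (P, Q, A) e''"
  unfolding macro_def using move_idle by blast

lemma run_idle: "run m (replicate n (\<lambda>_. 0)) e e"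
  by (induction n) (auto intro!: exI [of _ e] macro_fwd move_idle split: prod.splits, metis macro_fwd move_idle prod_cases3)

text \<open>One binary digit of \<open>k\<close>, rounded towards zero, so that \<open>\<bar>k\<bar> < 2 ^ n\<close> is exhausted after \<open>n\<close> steps
  for either sign: a negative odd \<open>k\<close> is handled by a move run backwards.\<close>

lemma macro_digit:
  assumes r: "0 < r" "r < Suc m"
  shows "\<exists>c q'. 2 * \<bar>c\<bar> \<le> \<bar>k\<bar> \<and> q' + 2 * a * c = q + a * k \<and>
    macro m (\<lambda>_. 0) (l(0 := a, r := k), l(0 := q, r := 1), A) (l(0 := 2 * a, r := c), l(0 := q', r := 1), A)"
proof (cases "even k \<or> 0 \<le> k")
  case True
  define b where "b = k mod 2"
  have k: "k = 2 * (k div 2) + b" by (simp add: b_def)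
  have b: "b = 0 \<or> b = 1" by (auto simp: b_def)
  have "2 * \<bar>k div 2\<bar> \<le> \<bar>k\<bar>" using True b k by (auto elim: evenE)
  moreover have "(q + a * b) + 2 * a * (k div 2) = q + a * k" by (subst (2) k) (simp add: algebra_simps)
  moreover have "macro m (\<lambda>_. 0) (l(0 := a, r := k), l(0 := q, r := 1), A) (l(0 := 2 * a, r := k div 2), l(0 := q + a * b, r := 1), A)"
    using macro_fwd [OF move_digit [OF r b, of l a "k div 2" q A]] k by simp
  ultimately show ?thesis by blast
next
  case False
  then obtain c' where c': "k = 2 * c' + 1" "k < 0" by (auto elim: oddE)
  define c where "c = c' + 1"
  have k: "k = 2 * c - 1" using c' by (simp add: c_def)
  have "2 * \<bar>c\<bar> \<le> \<bar>k\<bar>" using c' k by linarith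
  moreover have "(q - a) + 2 * a * c = q + a * k" by (simp add: k algebra_simps)
  moreover have "macro m (\<lambda>_. 0) (l(0 := a, r := k), l(0 := q, r := 1), A) (l(0 := 2 * a, r := c), l(0 := q - a, r := 1), A)"
    unfolding k by (rule macro_bwd [OF move_digit_inverse [OF r]])
  ultimately show ?thesis by blast
qed

lemma run_digits:
  assumes r: "0 < r" "r < Suc m"
  shows "\<bar>k\<bar> < 2 ^ n \<Longrightarrow> \<exists>a'. run m (replicate n (\<lambda>_. 0)) (l(0 := a, r := k), l(0 := q, r := 1), A)
     (l(0 := a', r := 0), l(0 := q + a * k, r := 1), A)"
proof (induction n arbitrary: a k q)
  case 0
  then show ?case by auto
next
  case (Suc n)
  from macro_digit [OF r, of k a q l A] obtain c q' where c: "2 * \<bar>c\<bar> \<le> \<bar>k\<bar>" "q' + 2 * a * c = q + a * k"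
    "macro m (\<lambda>_. 0) (l(0 := a, r := k), l(0 := q, r := 1), A) (l(0 := 2 * a, r := c), l(0 := q', r := 1), A)" by blast
  have "\<bar>c\<bar> < 2 ^ n" using c(1) Suc.prems by simp
  from Suc.IH [OF this, of "2 * a" q', unfolded c(2)] obtain a' where
    "run m (replicate n (\<lambda>_. 0)) (l(0 := 2 * a, r := c), l(0 := q', r := 1), A) (l(0 := a', r := 0), l(0 := q + a * k, r := 1), A)"
    by blast
  with c(3) show ?case unfolding replicate_Suc run.simps(2) by blast
qed

text \<open>After \<open>n\<close> digits the multiplier is 0, so \<open>P\<close> is dead and one
  further step can fetch the product from \<open>Q\<close>.\<close>

lemma run_transfer:
  assumes r: "0 < r" "r < Suc m" and x: "\<bar>x r\<bar> < 2 ^ n" and Q: "dead (Suc m) Q"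
  shows "run m (replicate (Suc n) (\<lambda>_. 0)) (x, x(0 := 0, r := 1), A) (x(0 := x 0 * x r, r := 1), Q, A)"
proof -
  from run_digits [OF r x, of x "x 0" 0 A] obtain a' where
    a: "run m (replicate n (\<lambda>_. 0)) (x, x(0 := 0, r := 1), A) (x(0 := a', r := 0), x(0 := x 0 * x r, r := 1), A)" by auto
  have "macro m (\<lambda>_. 0) (x(0 := a', r := 0), x(0 := x 0 * x r, r := 1), A) (x(0 := x 0 * x r, r := 1), Q, A)"
    by (rule macro_fwd, rule move_back) (use r Q in \<open>auto intro: dead_r\<close>)
  with a have "run m (replicate n (\<lambda>_. 0) @ [\<lambda>_. 0]) (x, x(0 := 0, r := 1), A) (x(0 := x 0 * x r, r := 1), Q, A)"
    by (auto simp: run_append)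
  then show ?thesis by (simp only: replicate_append_same [symmetric] replicate_Suc)
qed

text \<open>\<open>x j\<close> is the state after \<open>j\<close> multiplications. \<open>Q\<close>
  is left with 0 in entry 0, hence dead, and with 1 in entry \<open>Suc j\<close>: the empty partial
  product that the next multiplication expects.\<close>

lemma run_transfers:
  assumes "\<And>r. 0 < r \<Longrightarrow> r < Suc m \<Longrightarrow> \<bar>w r\<bar> < 2 ^ n" "j \<le> m"
  defines "x \<equiv> \<lambda>j r. if r = 0 then (\<Prod>s\<le>j. w s) else if r \<le> j then 1 else w r"
  shows "run m (replicate (j * Suc n) (\<lambda>_. 0)) (w, w(0 := 0, Suc 0 := 1), A) (x j, (x j)(0 := 0, Suc j := 1), A)"
  using assms(2)
proof (induction j)
  case 0
  have "x 0 = w" by (auto simp: x_def fun_eq_iff)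
  then show ?case by simp
next
  case (Suc j)
  have eq: "(x j)(0 := x j 0 * x j (Suc j), Suc j := 1) = x (Suc j)"
    by (auto simp: x_def fun_eq_iff)
  have "run m (replicate (Suc n) (\<lambda>_. 0)) (x j, (x j)(0 := 0, Suc j := 1), A)
     ((x j)(0 := x j 0 * x j (Suc j), Suc j := 1), (x (Suc j))(0 := 0, Suc (Suc j) := 1), A)"
    by (rule run_transfer) (use Suc.prems assms(1) in \<open>auto simp: x_def intro: dead_0\<close>)
  then have tr: "run m (replicate (Suc n) (\<lambda>_. 0)) (x j, (x j)(0 := 0, Suc j := 1), A)
     (x (Suc j), (x (Suc j))(0 := 0, Suc (Suc j) := 1), A)"
    by (simp only: eq)
  have "run m (replicate (j * Suc n) (\<lambda>_. 0) @ replicate (Suc n) (\<lambda>_. 0)) (w, w(0 := 0, Suc 0 := 1), A)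
     (x (Suc j), (x (Suc j))(0 := 0, Suc (Suc j) := 1), A)"
    unfolding run_append
    by (rule exI, rule conjI, rule Suc.IH, use Suc.prems in simp, rule tr)
  then show ?case by (simp only: replicate_add [symmetric] mult_Suc add.commute)
qed

text \<open>Loading takes one step, each of the \<open>m\<close> multiplications
  \<open>Suc n\<close>, the output one.\<close>

lemma run_block:
  assumes "\<And>r. 0 < r \<Longrightarrow> r < Suc m \<Longrightarrow> \<bar>w r\<bar> < 2 ^ n" "\<And>r. m < r \<Longrightarrow> w r = 1"
  shows "run m (w # replicate (m * Suc n + 1) (\<lambda>_. 0)) (\<lambda>_. 0, \<lambda>_. 0, acc a)
    (\<lambda>_. 0, \<lambda>_. 0, acc (a + (\<Prod>s\<le>m. w s)))"
proof -
  define x where "x = (\<lambda>r. if r = 0 then (\<Prod>s\<le>m. w s) else if r \<le> m then 1 else w r)"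
  have "x = acc (\<Prod>s\<le>m. w s)" using assms(2) by (auto simp: x_def acc_def fun_eq_iff)
  with run_transfers [of m w n m "acc a"] assms(1) have
    1: "run m (replicate (m * Suc n) (\<lambda>_. 0)) (w, w(0 := 0, Suc 0 := 1), acc a)
      (acc (\<Prod>s\<le>m. w s), (acc (\<Prod>s\<le>m. w s))(0 := 0, Suc m := 1), acc a)"
    unfolding x_def by simp
  have 2: "macro m w (\<lambda>_. 0, \<lambda>_. 0, acc a) (w, w(0 := 0, Suc 0 := 1), acc a)"
    by (rule macro_fwd, rule move_load) (auto intro: dead_0)
  have 3: "macro m (\<lambda>_. 0) (acc (\<Prod>s\<le>m. w s), (acc (\<Prod>s\<le>m. w s))(0 := 0, Suc m := 1), acc a)
     (\<lambda>_. 0, \<lambda>_. 0, acc (a + (\<Prod>s\<le>m. w s)))"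
    by (rule macro_fwd, rule move_out) (auto intro: dead_0)
  have "run m (w # (replicate (m * Suc n) (\<lambda>_. 0) @ [\<lambda>_. 0])) (\<lambda>_. 0, \<lambda>_. 0, acc a) (\<lambda>_. 0, \<lambda>_. 0, acc (a + (\<Prod>s\<le>m. w s)))"
    unfolding run.simps run_append
    by (rule exI, rule conjI, rule 2, rule exI, rule conjI, rule 1, rule exI, rule conjI, rule 3, rule refl)
  then show ?thesis by (simp only: replicate_append_same replicate_Suc [symmetric] Suc_eq_plus1 [symmetric])
qed

end

section \<open>Iterated Cauchy--Schwarz for stepped functions\<close>

lemma prod_expect:
  assumes "finite I" "finite A"
  shows "(\<Prod>i\<in>I. expect A (f i)) = expect (I \<rightarrow>\<^sub>E A) (\<lambda>z. \<Prod>i\<in>I. f i (z i))"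
  using assms by (simp add: expect_def prod_dividef prod_sum_PiE card_PiE)

definition dot :: "nat \<Rightarrow> (nat \<Rightarrow> int) \<Rightarrow> (nat \<Rightarrow> int) \<Rightarrow> int" where
  "dot d c u = (\<Sum>q<d. c q * u q)"

context fp_space begin

definition xshift :: "nat \<Rightarrow> nat \<Rightarrow> (nat \<Rightarrow> nat \<Rightarrow> int) \<Rightarrow> (nat \<Rightarrow> 'v) \<Rightarrow> (nat \<Rightarrow> 'v) \<Rightarrow> nat \<Rightarrow> 'v" where
  "xshift d t u y x = (\<lambda>q\<in>{..<d}. x q + lc t (\<lambda>r. u r q) y)"

lemma lc_xshift: "lc d c (xshift d t u y x) = lc d c x + lc t (\<lambda>r. dot d c (u r)) y"
proof -
  have "lc d c (xshift d t u y x) = lc d c x + (\<Sum>q<d. \<Sum>r<t. (c q * u r q) *s y r)"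
    by (simp add: lc_def xshift_def scale_right_distrib sum.distrib scale_sum_right)
  also have "(\<Sum>q<d. \<Sum>r<t. (c q * u r q) *s y r) = (\<Sum>r<t. dot d c (u r) *s y r)"
    by (subst sum.swap) (simp add: dot_def scale_sum_left)
  finally show ?thesis by (simp add: lc_def)
qed

lemma expect_xshift: "y \<in> Y t \<Longrightarrow> expect (Y d) (\<lambda>x. g (xshift d t u y x)) = expect (Y d) g"
  unfolding xshift_def by (rule expect_Y_shift) (rule lc_S)

definition zshift :: "nat set \<Rightarrow> nat \<Rightarrow> (nat \<Rightarrow> (nat \<Rightarrow> int) \<times> (nat \<Rightarrow> int) \<times> (nat \<Rightarrow> int)) \<Rightarrow> (nat \<Rightarrow> 'v) \<Rightarrow>
    (nat \<Rightarrow> 'v \<times> 'v \<times> 'v) \<Rightarrow> nat \<Rightarrow> 'v \<times> 'v \<times> 'v" where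
  "zshift I t e y z = (\<lambda>i\<in>I. sh3 t (e i) y (z i))"

abbreviation states :: "nat set \<Rightarrow> (nat \<Rightarrow> 'v \<times> 'v \<times> 'v) set" where
  "states I \<equiv> I \<rightarrow>\<^sub>E S3"

lemma sh3_S3: "y \<in> Y t \<Longrightarrow> z \<in> S3 \<Longrightarrow> sh3 t e y z \<in> S3"
  by (cases e; cases z) (auto simp: sh3_def add_S lc_S)

lemma expect_zshift:
  assumes "y \<in> Y t"
  shows "expect (states I) (\<lambda>z. g (zshift I t e y z)) = expect (states I) g"
proof (rule expect_bij)
  define neg :: "(nat \<Rightarrow> int) \<times> (nat \<Rightarrow> int) \<times> (nat \<Rightarrow> int) \<Rightarrow> _" where
    "neg = (\<lambda>(a, b, c). (\<lambda>r. - a r, \<lambda>r. - b r, \<lambda>r. - c r))"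
  have m: "lc t (\<lambda>r. - l r) y = - lc t l y" for l by (simp add: lc_def sum_negf)
  have n: "sh3 t (neg e) y (sh3 t e y z) = z" "sh3 t e y (sh3 t (neg e) y z) = z" for e and z :: "'v \<times> 'v \<times> 'v"
    by (cases e; cases z; simp add: sh3_def neg_def m)+
  show "bij_betw (zshift I t e y) (states I) (states I)"
  proof (rule bij_betw_byWitness [where f' = "zshift I t (\<lambda>i. neg (e i)) y"])
    show "\<forall>z\<in>states I. zshift I t (\<lambda>i. neg (e i)) y (zshift I t e y z) = z"
      by (auto simp: zshift_def n fun_eq_iff PiE_iff extensional_def)
    show "\<forall>z\<in>states I. zshift I t e y (zshift I t (\<lambda>i. neg (e i)) y z) = z"
      by (auto simp: zshift_def n fun_eq_iff PiE_iff extensional_def)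
  qed (auto simp: zshift_def simp del: mem_Sigma_iff intro!: PiE_I sh3_S3 assms elim!: PiE_mem)
qed

lemma finite_states: "finite I \<Longrightarrow> finite (states I)"
  by (simp add: finite_PiE finite_S)

lemma states_nonempty: "states I \<noteq> {}"
  using zero_S by (auto simp: PiE_eq_empty_iff)

end

locale stepped_system = fp_space scale S p for scale :: "int \<Rightarrow> 'v::ab_group_add \<Rightarrow> 'v" (infixr \<open>*s\<close> 75)
    and S p +
  fixes m d :: nat and I :: "nat set" and al :: "nat \<Rightarrow> nat \<Rightarrow> int" and be :: "nat \<Rightarrow> int"
    and f :: "'v \<Rightarrow> complex" and R :: "nat \<Rightarrow> 'v \<Rightarrow> 'v \<times> 'v \<times> 'v \<Rightarrow> 'v \<times> 'v \<times> 'v \<Rightarrow> complex"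
    and G0 :: "(nat \<Rightarrow> 'v \<times> 'v \<times> 'v) \<Rightarrow> complex"
  assumes finite_I: "finite I" and f_bdd: "bdd f" and R_bdd: "i \<in> I \<Longrightarrow> cmod (R i v z z') \<le> 1"
    and R_L: "i \<in> I \<Longrightarrow> move m w e e' \<Longrightarrow> v \<in> S \<Longrightarrow> z \<in> S3 \<Longrightarrow> z' \<in> S3 \<Longrightarrow>
        (\<lambda>y. R i (v + lc (Suc m) w y) (sh3 (Suc m) e y z) (sh3 (Suc m) e' y z')) \<in> L (Suc m)"
    and G0_bdd: "bdd G0"
begin

abbreviation "t \<equiv> Suc m"

section \<open>The operator of a stepped system\<close>

definition Ker where
  "Ker x z z' = (\<Prod>i\<in>I. R i (lc d (al i) x) (z i) (z' i))"

definition fwd where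
  "fwd H z = expect (Y d) (\<lambda>x. expect (states I) (\<lambda>z'. f (lc d be x) * Ker x z z' * H z'))"

definition bwd where
  "bwd H z' = expect (Y d) (\<lambda>x. expect (states I) (\<lambda>z. cnj (f (lc d be x) * Ker x z z') * H z))"

definition ip where
  "ip H H' = expect (states I) (\<lambda>z. H z * cnj (H' z))"

lemma ip_fwd: "ip (fwd H) H' = ip H (bwd H')"
proof -
  have "ip (fwd H) H' = expect (states I) (\<lambda>z. expect (Y d) (\<lambda>x. expect (states I) (\<lambda>z'. f (lc d be x) * Ker x z z' * H z' * cnj (H' z))))"
    by (simp only: ip_def fwd_def expect_mult_right)
  also have "\<dots> = expect (Y d) (\<lambda>x. expect (states I) (\<lambda>z. expect (states I) (\<lambda>z'. f (lc d be x) * Ker x z z' * H z' * cnj (H' z))))"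
    by (rule expect_swap)
  also have "\<dots> = expect (Y d) (\<lambda>x. expect (states I) (\<lambda>z'. expect (states I) (\<lambda>z. f (lc d be x) * Ker x z z' * H z' * cnj (H' z))))"
    by (rule expect_cong [OF refl], rule expect_swap)
  also have "\<dots> = expect (states I) (\<lambda>z'. expect (Y d) (\<lambda>x. expect (states I) (\<lambda>z. f (lc d be x) * Ker x z z' * H z' * cnj (H' z))))"
    by (rule expect_swap)
  also have "\<dots> = ip H (bwd H')"
    unfolding ip_def bwd_def cnj_expect expect_mult_left [symmetric]
    by (intro expect_cong refl) (simp add: mult.commute mult.left_commute)
  finally show ?thesis .
qed

lemma ip_cnj: "cnj (ip H H') = ip H' H"
  by (simp add: ip_def cnj_expect mult.commute)

definition step where "step H = fwd (bwd H)"

lemma ip_bwd: "ip (bwd H) H' = ip H (fwd H')"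
proof -
  have "ip (bwd H) H' = cnj (ip (fwd H') H)" by (simp only: ip_cnj ip_fwd)
  then show ?thesis by (simp only: ip_cnj)
qed

lemma ip_step: "ip (step H) H' = ip H (step H')"
  by (simp only: step_def ip_fwd ip_bwd)

lemma ip_step_pow: "ip ((step ^^ n) H) H' = ip H ((step ^^ n) H')"
proof (induction n arbitrary: H')
  case (Suc n)
  have "ip ((step ^^ Suc n) H) H' = ip H ((step ^^ n) (step H'))"
    by (simp only: funpow.simps o_apply ip_step Suc)
  then show ?case by (simp only: funpow.simps o_apply funpow_swap1)
qed simp

lemma ip_le: "bdd H' \<Longrightarrow> (cmod (ip H H'))\<^sup>2 \<le> cmod (ip H H)"
proof -
  assume "bdd H'"
  then have "(cmod (ip H H'))\<^sup>2 \<le> Re (ip H H)"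
    unfolding ip_def by (intro expect_cs) auto
  also have "\<dots> \<le> cmod (ip H H)" by (rule complex_Re_le_cmod)
  finally show ?thesis .
qed

text \<open>The first Cauchy--Schwarz turns the operator into \<open>step\<close>. Since
  \<open>step\<close> is self-adjoint, each later one, against the bounded \<open>G0\<close>,
  doubles the number of steps.\<close>

lemma ip_step_power_bound:
  assumes "bdd G'"
  shows "cmod (ip (fwd G') G0) ^ (2 * 2 ^ n) \<le> cmod (ip ((step ^^ (2 ^ n)) G0) G0)"
proof (induction n)
  case 0
  have "(cmod (ip (fwd G') G0))\<^sup>2 = (cmod (ip (bwd G0) G'))\<^sup>2"
    by (metis complex_mod_cnj ip_cnj ip_fwd)
  also have "\<dots> \<le> cmod (ip (bwd G0) (bwd G0))" by (rule ip_le [OF assms])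
  also have "\<dots> = cmod (ip (step G0) G0)" by (simp add: step_def ip_fwd)
  finally show ?case by simp
next
  case (Suc n)
  have "cmod (ip (fwd G') G0) ^ (2 * 2 ^ Suc n) = (cmod (ip (fwd G') G0) ^ (2 * 2 ^ n))\<^sup>2"
    by (simp add: power_mult [symmetric] mult.commute)
  also have "\<dots> \<le> (cmod (ip ((step ^^ (2 ^ n)) G0) G0))\<^sup>2" by (rule power_mono [OF Suc]) simp
  also have "\<dots> \<le> cmod (ip ((step ^^ (2 ^ n)) G0) ((step ^^ (2 ^ n)) G0))" by (rule ip_le [OF G0_bdd])
  also have "\<dots> = cmod (ip ((step ^^ (2 ^ Suc n)) G0) G0)"
    by (simp add: ip_step_pow [symmetric] mult_2 funpow_add)
  finally show ?case .
qed

definition flat where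
  "flat e H \<longleftrightarrow> (\<forall>z\<in>states I. (\<lambda>y. H (zshift I t e y z)) \<in> L t)"

lemma Ker_L:
  assumes "\<And>i. i \<in> I \<Longrightarrow> move m (w i) (e i) (e' i)" "\<And>i r. i \<in> I \<Longrightarrow> r < t \<Longrightarrow> w i r = dot d (al i) (u r)"
    "x \<in> Y d" "z \<in> states I" "z' \<in> states I"
  shows "(\<lambda>y. Ker (xshift d t u y x) (zshift I t e y z) (zshift I t e' y z')) \<in> L t"
proof -
  have "(\<lambda>y. \<Prod>i\<in>I. R i (lc d (al i) x + lc t (w i) y) (sh3 t (e i) y (z i)) (sh3 t (e' i) y (z' i))) \<in> L t"
  proof (rule L_prod_set [OF zero_less_Suc])
    fix i assume i: "i \<in> I"
    show "(\<lambda>y. R i (lc d (al i) x + lc t (w i) y) (sh3 t (e i) y (z i)) (sh3 t (e' i) y (z' i))) \<in> L t"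
      by (rule R_L [OF i assms(1) [OF i] lc_S [OF assms(3)] PiE_mem [OF assms(4) i] PiE_mem [OF assms(5) i]])
  qed
  then show ?thesis
  proof (rule L_cong)
    fix y
    show "(\<Prod>i\<in>I. R i (lc d (al i) x + lc t (w i) y) (sh3 t (e i) y (z i)) (sh3 t (e' i) y (z' i))) =
      Ker (xshift d t u y x) (zshift I t e y z) (zshift I t e' y z')"
      unfolding Ker_def lc_xshift
      by (intro prod.cong refl) (simp add: zshift_def lc_cong [OF assms(2)])
  qed
qed

text \<open>The shifts of \<open>x\<close> and of the far state are changes of variable in averages.
  Hence flatness at the far end of a step passes to its near end, provided that \<open>f\<close> is
  hidden by a dead shift.\<close>

lemma fwd_flat:
  assumes mv: "\<And>i. i \<in> I \<Longrightarrow> move m (w i) (e i) (e' i)" and w: "\<And>i r. i \<in> I \<Longrightarrow> r < t \<Longrightarrow> w i r = dot d (al i) (u r)"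
    and k: "dead t (\<lambda>r. dot d be (u r))" and H: "flat e' H"
  shows "flat e (fwd H)"
  unfolding flat_def
proof
  fix z assume z: "z \<in> states I"
  have "(\<lambda>y. expect (Y d) (\<lambda>x. expect (states I) (\<lambda>z'. f (lc d be x + lc t (\<lambda>r. dot d be (u r)) y) *
     Ker (xshift d t u y x) (zshift I t e y z) (zshift I t e' y z') * H (zshift I t e' y z')))) \<in> L t"
    by (intro L_expect L_mult L_dead Ker_L [of w] finite_Y Y_nonempty finite_states states_nonempty)
      (use mv w k H z finite_I f_bdd in \<open>auto simp: flat_def\<close>)
  then show "(\<lambda>y. fwd H (zshift I t e y z)) \<in> L t"
  proof (rule L_cong)
    fix y assume y: "y \<in> Y t"
    have "fwd H (zshift I t e y z) = expect (Y d) (\<lambda>x. expect (states I) (\<lambda>z'. f (lc d be (xshift d t u y x)) *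
      Ker (xshift d t u y x) (zshift I t e y z) z' * H z'))"
      unfolding fwd_def by (rule expect_xshift [OF y, symmetric])
    also have "\<dots> = expect (Y d) (\<lambda>x. expect (states I) (\<lambda>z'. f (lc d be (xshift d t u y x)) *
      Ker (xshift d t u y x) (zshift I t e y z) (zshift I t e' y z') * H (zshift I t e' y z')))"
      by (rule expect_cong [OF refl], rule expect_zshift [OF y, symmetric])
    finally show "expect (Y d) (\<lambda>x. expect (states I) (\<lambda>z'. f (lc d be x + lc t (\<lambda>r. dot d be (u r)) y) *
      Ker (xshift d t u y x) (zshift I t e y z) (zshift I t e' y z') * H (zshift I t e' y z'))) = fwd H (zshift I t e y z)"
      by (simp only: lc_xshift)
  qed
qed

lemma bwd_flat:
  assumes mv: "\<And>i. i \<in> I \<Longrightarrow> move m (w i) (e i) (e' i)" and w: "\<And>i r. i \<in> I \<Longrightarrow> r < t \<Longrightarrow> w i r = dot d (al i) (u r)"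
    and k: "dead t (\<lambda>r. dot d be (u r))" and H: "flat e H"
  shows "flat e' (bwd H)"
  unfolding flat_def
proof
  fix z' assume z: "z' \<in> states I"
  have "(\<lambda>y. expect (Y d) (\<lambda>x. expect (states I) (\<lambda>z. cnj (f (lc d be x + lc t (\<lambda>r. dot d be (u r)) y) *
     Ker (xshift d t u y x) (zshift I t e y z) (zshift I t e' y z')) * H (zshift I t e y z)))) \<in> L t"
    by (intro L_expect L_mult L_cnj L_dead Ker_L [of w] finite_Y Y_nonempty finite_states states_nonempty)
      (use mv w k H z finite_I f_bdd in \<open>auto simp: flat_def\<close>)
  then show "(\<lambda>y. bwd H (zshift I t e' y z')) \<in> L t"
  proof (rule L_cong)
    fix y assume y: "y \<in> Y t"
    have "bwd H (zshift I t e' y z') = expect (Y d) (\<lambda>x. expect (states I) (\<lambda>z. cnj (f (lc d be (xshift d t u y x)) *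
      Ker (xshift d t u y x) z (zshift I t e' y z')) * H z))"
      unfolding bwd_def by (rule expect_xshift [OF y, symmetric])
    also have "\<dots> = expect (Y d) (\<lambda>x. expect (states I) (\<lambda>z. cnj (f (lc d be (xshift d t u y x)) *
      Ker (xshift d t u y x) (zshift I t e y z) (zshift I t e' y z')) * H (zshift I t e y z)))"
      by (rule expect_cong [OF refl], rule expect_zshift [OF y, symmetric])
    finally show "expect (Y d) (\<lambda>x. expect (states I) (\<lambda>z. cnj (f (lc d be x + lc t (\<lambda>r. dot d be (u r)) y) *
      Ker (xshift d t u y x) (zshift I t e y z) (zshift I t e' y z')) * H (zshift I t e y z))) = bwd H (zshift I t e' y z')"
      by (simp only: lc_xshift)
  qed
qed

lemma dead_zero: "dead t (\<lambda>_. 0)"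
  by (auto simp: dead_def)

lemma dot_zero: "dot d c (\<lambda>_. 0) = 0"
  by (simp add: dot_def)

text \<open>Flatness is carried from the end of the path to its start, one half step at a time; the
  adjoint halves use the zero shift, which hides \<open>f\<close> as well.\<close>

lemma step_pow_flat:
  assumes "flat e_end G0"
  shows "(\<And>i. i \<in> I \<Longrightarrow> run m (map (w i) us) (e i) (e_end i)) \<Longrightarrow>
    (\<And>u i r. u \<in> set us \<Longrightarrow> i \<in> I \<Longrightarrow> r < t \<Longrightarrow> w i u r = dot d (al i) (u r)) \<Longrightarrow>
    (\<And>u. u \<in> set us \<Longrightarrow> dead t (\<lambda>r. dot d be (u r))) \<Longrightarrow> flat e ((step ^^ length us) G0)"
proof (induction us arbitrary: e)
  case Nil
  have "zshift I t e y z = zshift I t e_end y z" for y z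
    using Nil(1) by (auto simp: zshift_def fun_eq_iff)
  then show ?case using assms by (simp add: flat_def)
next
  case (Cons u us)
  have "\<exists>e'. \<forall>i\<in>I. macro m (w i u) (e i) (e' i) \<and> run m (map (w i) us) (e' i) (e_end i)"
    using Cons.prems(1) by (intro bchoice ballI) simp
  then obtain e' where e': "\<And>i. i \<in> I \<Longrightarrow> macro m (w i u) (e i) (e' i)"
    "\<And>i. i \<in> I \<Longrightarrow> run m (map (w i) us) (e' i) (e_end i)" by blast
  have "\<exists>e1. \<forall>i\<in>I. move m (w i u) (e i) (e1 i) \<and> move m (\<lambda>_. 0) (e' i) (e1 i)"
    using e'(1) unfolding macro_def by (intro bchoice ballI)
  then obtain e1 where e1: "\<And>i. i \<in> I \<Longrightarrow> move m (w i u) (e i) (e1 i)"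
    "\<And>i. i \<in> I \<Longrightarrow> move m (\<lambda>_. 0) (e' i) (e1 i)" by blast
  have "flat e' ((step ^^ length us) G0)"
    by (rule Cons.IH) (use e'(2) Cons.prems in auto)
  then have "flat e1 (bwd ((step ^^ length us) G0))"
    by (rule bwd_flat [where u = "\<lambda>_ _. 0" and w = "\<lambda>_ _. 0", OF e1(2), rotated -1]) (auto simp: dot_zero dead_zero)
  then have "flat e (fwd (bwd ((step ^^ length us) G0)))"
    by (rule fwd_flat [where u = u and w = "\<lambda>i. w i u", OF e1(1), rotated -1]) (use Cons.prems in auto)
  then show ?case by (simp only: list.size add_0_right add_Suc_right funpow.simps o_apply step_def [of "(step ^^ length us) G0"])
qed

text \<open>Here the shift is visible to \<open>f\<close>. With \<open>x\<close> and both states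
  fixed, all other factors are invisible in \<open>y\<close>, so \<open>L_bound\<close> applies to
  the average over \<open>y\<close>.\<close>

lemma root_bound:
  assumes mv: "\<And>i. i \<in> I \<Longrightarrow> move m (w i) (e i) (e' i)" and w: "\<And>i r. i \<in> I \<Longrightarrow> r < t \<Longrightarrow> w i r = dot d (al i) (u r)"
    and k: "\<And>r. r < t \<Longrightarrow> \<not> int p dvd dot d be (u r)" and H: "flat e' H" and G: "flat e G0"
  shows "cmod (ip (fwd H) G0) \<le> unorm t f"
proof -
  define F where "F z x z' = f (lc d be x) * (Ker x z z' * H z' * cnj (G0 z))" for z x z'
  let ?F = "\<lambda>y z x z'. F (zshift I t e y z) (xshift d t u y x) (zshift I t e' y z')"
  have V: "ip (fwd H) G0 = expect (states I) (\<lambda>z. expect (Y d) (\<lambda>x. expect (states I) (\<lambda>z'. F z x z')))"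
    by (simp only: ip_def fwd_def expect_mult_right [symmetric] F_def mult.assoc)
  have sh: "ip (fwd H) G0 = expect (states I) (\<lambda>z. expect (Y d) (\<lambda>x. expect (states I) (\<lambda>z'. ?F y z x z')))" if y: "y \<in> Y t" for y
  proof -
    have "ip (fwd H) G0 = expect (states I) (\<lambda>z. expect (Y d) (\<lambda>x. expect (states I) (\<lambda>z'. F (zshift I t e y z) x z')))"
      unfolding V by (rule expect_zshift [OF y, symmetric])
    also have "\<dots> = expect (states I) (\<lambda>z. expect (Y d) (\<lambda>x. expect (states I) (\<lambda>z'. F (zshift I t e y z) (xshift d t u y x) z')))"
      by (rule expect_cong [OF refl], rule expect_xshift [OF y, symmetric])
    also have "\<dots> = expect (states I) (\<lambda>z. expect (Y d) (\<lambda>x. expect (states I) (\<lambda>z'. ?F y z x z')))"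
      by (rule expect_cong [OF refl], rule expect_cong [OF refl], rule expect_zshift [OF y, symmetric])
    finally show ?thesis .
  qed
  have "ip (fwd H) G0 = expect (Y t) (\<lambda>y. ip (fwd H) G0)"
    by (simp add: finite_Y Y_nonempty)
  also have "\<dots> = expect (Y t) (\<lambda>y. expect (states I) (\<lambda>z. expect (Y d) (\<lambda>x. expect (states I) (\<lambda>z'. ?F y z x z'))))"
    by (rule expect_cong [OF refl]) (rule sh)
  also have "\<dots> = expect (states I) (\<lambda>z. expect (Y t) (\<lambda>y. expect (Y d) (\<lambda>x. expect (states I) (\<lambda>z'. ?F y z x z'))))"
    by (rule expect_swap)
  also have "\<dots> = expect (states I) (\<lambda>z. expect (Y d) (\<lambda>x. expect (Y t) (\<lambda>y. expect (states I) (\<lambda>z'. ?F y z x z'))))"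
    by (rule expect_cong [OF refl], rule expect_swap)
  also have "\<dots> = expect (states I) (\<lambda>z. expect (Y d) (\<lambda>x. expect (states I) (\<lambda>z'. expect (Y t) (\<lambda>y. ?F y z x z'))))"
    by (rule expect_cong [OF refl], rule expect_cong [OF refl], rule expect_swap)
  finally have "cmod (ip (fwd H) G0) \<le> mean (states I) (\<lambda>z. mean (Y d) (\<lambda>x. mean (states I) (\<lambda>z'. cmod (expect (Y t) (\<lambda>y. ?F y z x z')))))"
    by (simp only:) (intro order_trans [OF cmod_expect_le_mean] mean_mono order_refl)
  also have "\<dots> \<le> unorm t f"
  proof (intro mean_le finite_states finite_I finite_Y unorm_nonneg)
    fix z x z' assume z: "z \<in> states I" and x: "x \<in> Y d" and z': "z' \<in> states I"
    have "(\<lambda>y. Ker (xshift d t u y x) (zshift I t e y z) (zshift I t e' y z') * H (zshift I t e' y z') * cnj (G0 (zshift I t e y z))) \<in> L t"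
      by (intro L_mult L_cnj Ker_L [of w] mv w) (use H G x z z' in \<open>auto simp: flat_def\<close>)
    from L_bound [OF this zero_less_Suc k lc_S [OF x, of be], where F = f] show "cmod (expect (Y t) (\<lambda>y. ?F y z x z')) \<le> unorm t f"
      by (simp add: F_def lc_xshift)
  qed auto
  finally show ?thesis .
qed

lemma stepped_bound:
  assumes G': "bdd G'" and len: "Suc (length us) = 2 ^ n"
    and run: "\<And>i. i \<in> I \<Longrightarrow> run m (map (w i) (u0 # us)) (e i) (e_end i)"
    and w: "\<And>u i r. u \<in> set (u0 # us) \<Longrightarrow> i \<in> I \<Longrightarrow> r < t \<Longrightarrow> w i u r = dot d (al i) (u r)"
    and k: "\<And>u. u \<in> set us \<Longrightarrow> dead t (\<lambda>r. dot d be (u r))" and k0: "\<And>r. r < t \<Longrightarrow> \<not> int p dvd dot d be (u0 r)"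
    and fl: "flat e G0" "flat e_end G0"
  shows "cmod (ip (fwd G') G0) ^ (2 * 2 ^ n) \<le> unorm t f"
proof -
  have "\<exists>e'. \<forall>i\<in>I. macro m (w i u0) (e i) (e' i) \<and> run m (map (w i) us) (e' i) (e_end i)"
    using run by (intro bchoice ballI) simp
  then obtain e' where e': "\<And>i. i \<in> I \<Longrightarrow> macro m (w i u0) (e i) (e' i)"
    "\<And>i. i \<in> I \<Longrightarrow> run m (map (w i) us) (e' i) (e_end i)" by blast
  have "\<exists>e1. \<forall>i\<in>I. move m (w i u0) (e i) (e1 i) \<and> move m (\<lambda>_. 0) (e' i) (e1 i)"
    using e'(1) unfolding macro_def by (intro bchoice ballI)
  then obtain e1 where e1: "\<And>i. i \<in> I \<Longrightarrow> move m (w i u0) (e i) (e1 i)"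
    "\<And>i. i \<in> I \<Longrightarrow> move m (\<lambda>_. 0) (e' i) (e1 i)" by blast
  have "flat e' ((step ^^ length us) G0)"
    by (rule step_pow_flat [OF fl(2) e'(2)]) (use w k in auto)
  then have "flat e1 (bwd ((step ^^ length us) G0))"
    by (rule bwd_flat [where u = "\<lambda>_ _. 0" and w = "\<lambda>_ _. 0", OF e1(2), rotated -1]) (auto simp: dot_zero dead_zero)
  then have "cmod (ip (fwd (bwd ((step ^^ length us) G0))) G0) \<le> unorm t f"
    by (rule root_bound [where u = u0 and w = "\<lambda>i. w i u0", OF e1(1), rotated -2]) (use w k0 fl in auto)
  moreover have "fwd (bwd ((step ^^ length us) G0)) = (step ^^ (2 ^ n)) G0"
    unfolding len [symmetric] by (simp only: funpow.simps o_apply step_def [of "(step ^^ length us) G0"])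
  ultimately show ?thesis using ip_step_power_bound [OF G', of n] by simp
qed

end

section \<open>Long paths assembled from multiplication blocks\<close>

context fp_space begin

lemma run_blocks:
  assumes "\<And>u. u \<in> set us \<Longrightarrow> (\<forall>r. 0 < r \<and> r < Suc m \<longrightarrow> \<bar>w u r\<bar> < 2 ^ n) \<and> (\<forall>r>m. w u r = 1)"
  shows "run m (concat (map (\<lambda>u. w u # replicate (m * Suc n + 1) (\<lambda>_. 0)) us)) (\<lambda>_. 0, \<lambda>_. 0, acc a)
    (\<lambda>_. 0, \<lambda>_. 0, acc (a + (\<Sum>u\<leftarrow>us. \<Prod>s\<le>m. w u s)))"
  using assms
proof (induction us arbitrary: a)
  case (Cons u us)
  have 1: "run m (w u # replicate (m * Suc n + 1) (\<lambda>_. 0)) (\<lambda>_. 0, \<lambda>_. 0, acc a)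
      (\<lambda>_. 0, \<lambda>_. 0, acc (a + (\<Prod>s\<le>m. w u s)))"
    by (rule run_block) (use Cons.prems in auto)
  have 2: "run m (concat (map (\<lambda>u. w u # replicate (m * Suc n + 1) (\<lambda>_. 0)) us))
      (\<lambda>_. 0, \<lambda>_. 0, acc (a + (\<Prod>s\<le>m. w u s)))
      (\<lambda>_. 0, \<lambda>_. 0, acc (a + (\<Prod>s\<le>m. w u s) + (\<Sum>u\<leftarrow>us. \<Prod>s\<le>m. w u s)))"
    by (rule Cons.IH) (use Cons.prems in auto)
  show ?case
    unfolding list.map concat.simps run_append sum_list.Cons add.assoc [symmetric] using 1 2 by blast
qed simp

lemma sh3_acc_upd:
  assumes "int p dvd a" "y \<in> Y (Suc m)" "c \<in> S"
  shows "sh3 (Suc m) (\<lambda>_. 0, \<lambda>_. 0, acc a) (y(0 := c)) z = sh3 (Suc m) (\<lambda>_. 0, \<lambda>_. 0, acc a) y z"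
proof -
  have "lc (Suc m) (acc a) (y(0 := c)) = lc (Suc m) (acc a) y"
    by (rule lc_upd) (use assms in \<open>auto simp: acc_def\<close>)
  then show ?thesis by (cases z) (simp add: sh3_def lc_def)
qed

theorem stepfun_system_bound:
  fixes I :: "nat set"
  assumes fin: "finite I" and f: "bdd f" and D: "\<And>i. i \<in> I \<Longrightarrow> stepfun m (D i)"
    and small: "\<And>u i r. u \<in> set (u0 # us) \<Longrightarrow> i \<in> I \<Longrightarrow> 0 < r \<Longrightarrow> r \<le> m \<Longrightarrow> \<bar>dot d (al i) (u r)\<bar> < 2 ^ n"
    and root: "\<And>r. r \<le> m \<Longrightarrow> \<not> int p dvd dot d be (u0 r)"
    and dead: "\<And>u. u \<in> set us \<Longrightarrow> \<exists>r\<le>m. int p dvd dot d be (u r)"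
    and rel: "\<And>i. i \<in> I \<Longrightarrow> int p dvd (\<Sum>u\<leftarrow>u0 # us. \<Prod>s\<le>m. dot d (al i) (u s))"
    and N: "Suc (length us) * (m * Suc n + 2) \<le> 2 ^ N"
  shows "cmod (expect (Y d) (\<lambda>x. f (lc d be x) * (\<Prod>i\<in>I. D i (lc d (al i) x)))) ^ (2 * 2 ^ N) \<le> unorm (Suc m) f"
proof -
  let ?P = "\<lambda>i X. case X of (R, G, G') \<Rightarrow> (\<forall>v z z'. cmod (R v z z') \<le> 1) \<and> bdd G \<and> bdd G' \<and>
     (\<forall>w e e'. move m w e e' \<longrightarrow> (\<forall>v\<in>S. \<forall>z\<in>S3. \<forall>z'\<in>S3.
        (\<lambda>y. R (v + lc (Suc m) w y) (sh3 (Suc m) e y z) (sh3 (Suc m) e' y z')) \<in> L (Suc m))) \<and>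
     (\<forall>v\<in>S. D i v = expect S3 (\<lambda>z. expect S3 (\<lambda>z'. R v z z' * (G z * G' z'))))"
  have "\<exists>X. \<forall>i\<in>I. ?P i (X i)"
    by (rule bchoice) (use D in \<open>simp add: stepfun_def\<close>)
  then obtain X where X: "\<forall>i\<in>I. ?P i (X i)" by blast
  define R where "R i = fst (X i)" for i
  define G where "G i = fst (snd (X i))" for i
  define G' where "G' i = snd (snd (X i))" for i
  have X: "\<And>i v z z'. i \<in> I \<Longrightarrow> cmod (R i v z z') \<le> 1" "\<And>i. i \<in> I \<Longrightarrow> bdd (G i)" "\<And>i. i \<in> I \<Longrightarrow> bdd (G' i)"
    "\<And>i w e e' v z z'. i \<in> I \<Longrightarrow> move m w e e' \<Longrightarrow> v \<in> S \<Longrightarrow> z \<in> S3 \<Longrightarrow> z' \<in> S3 \<Longrightarrow>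
        (\<lambda>y. R i (v + lc (Suc m) w y) (sh3 (Suc m) e y z) (sh3 (Suc m) e' y z')) \<in> L (Suc m)"
    "\<And>i v. i \<in> I \<Longrightarrow> v \<in> S \<Longrightarrow> D i v = expect S3 (\<lambda>z. expect S3 (\<lambda>z'. R i v z z' * (G i z * G' i z')))"
    unfolding R_def G_def G'_def using X unfolding split_beta by blast+
  \<comment> \<open>Conjugated because \<open>ip\<close> conjugates its second argument.\<close>
  define G0 where "G0 z = cnj (\<Prod>i\<in>I. G i (z i))" for z
  define G1 where "G1 z = (\<Prod>i\<in>I. G' i (z i))" for z
  interpret stepped_system "(*s)" S p m d I al be f R G0
  proof unfold_locales
    show "bdd G0"
      by (simp add: G0_def prod_norm [symmetric] prod_le_1 X(2) [rule_format] del: split_paired_All)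
  qed (use fin f X(1,4) in auto)
  have G1: "bdd G1"
    by (simp add: G1_def prod_norm [symmetric] prod_le_1 X(3) [rule_format] del: split_paired_All)
  have eq: "expect (Y d) (\<lambda>x. f (lc d be x) * (\<Prod>i\<in>I. D i (lc d (al i) x))) = ip (fwd G1) G0"
  proof -
    have *: "(\<Prod>i\<in>I. D i (lc d (al i) x)) = expect (states I) (\<lambda>z. expect (states I) (\<lambda>z'. Ker x z z' * G1 z' * cnj (G0 z)))"
      if x: "x \<in> Y d" for x
    proof -
      have "(\<Prod>i\<in>I. D i (lc d (al i) x)) = (\<Prod>i\<in>I. expect S3 (\<lambda>z. expect S3 (\<lambda>z'.
          R i (lc d (al i) x) z z' * (G i z * G' i z'))))"
        by (rule prod.cong [OF refl]) (use X(5) lc_S [OF x] in auto)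
      also have "\<dots> = expect (states I) (\<lambda>z. \<Prod>i\<in>I. expect S3 (\<lambda>z'. R i (lc d (al i) x) (z i) z' * (G i (z i) * G' i z')))"
        by (rule prod_expect) (auto simp: fin finite_S)
      also have "\<dots> = expect (states I) (\<lambda>z. expect (states I) (\<lambda>z'. \<Prod>i\<in>I. R i (lc d (al i) x) (z i) (z' i) * (G i (z i) * G' i (z' i))))"
        by (rule expect_cong [OF refl], rule prod_expect) (auto simp: fin finite_S)
      also have "\<dots> = expect (states I) (\<lambda>z. expect (states I) (\<lambda>z'. Ker x z z' * G1 z' * cnj (G0 z)))"
        by (rule expect_cong [OF refl], rule expect_cong [OF refl])
          (simp add: Ker_def G1_def G0_def prod.distrib)
      finally show ?thesis .
    qed
    have "expect (Y d) (\<lambda>x. f (lc d be x) * (\<Prod>i\<in>I. D i (lc d (al i) x))) =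
      expect (Y d) (\<lambda>x. expect (states I) (\<lambda>z. expect (states I) (\<lambda>z'. f (lc d be x) * (Ker x z z' * G1 z' * cnj (G0 z)))))"
      by (rule expect_cong [OF refl]) (simp only: * expect_mult_left)
    also have "\<dots> = expect (states I) (\<lambda>z. expect (Y d) (\<lambda>x. expect (states I) (\<lambda>z'. f (lc d be x) * (Ker x z z' * G1 z' * cnj (G0 z)))))"
      by (rule expect_swap)
    also have "\<dots> = ip (fwd G1) G0"
      by (simp only: ip_def fwd_def expect_mult_right [symmetric] mult.assoc)
    finally show ?thesis .
  qed
  \<comment> \<open>\<open>run_block\<close> wants the value 1 beyond \<open>m\<close>, idle steps want 0: the unused slot \<open>Suc m\<close> tells them apart.\<close>
  define mark where "mark u = u(Suc m := \<lambda>_. 1)" for u :: "nat \<Rightarrow> nat \<Rightarrow> int"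
  define w where "w i u r = (if r \<le> m then dot d (al i) (u r) else if u (Suc m) 0 = 0 then 0 else 1)" for i u r
  have w0: "w i (\<lambda>_ _. 0) = (\<lambda>_. 0)" for i by (auto simp: w_def dot_zero)
  define blk where "blk us = concat (map (\<lambda>u. mark u # replicate (m * Suc n + 1) (\<lambda>_ _. 0)) us)" for us
  \<comment> \<open>Idle steps pad the path to a power of two, as repeated squaring
    requires.\<close>
  define idle where "idle = 2 ^ N - Suc (length us) * (m * Suc n + 2)"
  define us' where "us' = replicate (m * Suc n + 1) (\<lambda>_ _. 0) @ blk us @ replicate idle (\<lambda>_ _. 0)"
  have full: "mark u0 # us' = blk (u0 # us) @ replicate idle (\<lambda>_ _. 0)"
    by (simp add: us'_def blk_def)
  have len_blk: "length (blk us) = length us * (m * Suc n + 2)" for us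
    by (induction us) (simp_all add: blk_def)
  define c where "c i = (\<Sum>u\<leftarrow>u0 # us. \<Prod>s\<le>m. w i (mark u) s)" for i
  have wm: "w i (mark u) r = (if r \<le> m then dot d (al i) (u r) else 1)" for i u r
    by (auto simp: w_def mark_def)
  have c: "c i = (\<Sum>u\<leftarrow>u0 # us. \<Prod>s\<le>m. dot d (al i) (u s))" for i
    by (simp add: c_def wm)
  have run: "run m (map (w i) (mark u0 # us')) (\<lambda>_. 0, \<lambda>_. 0, acc 0) (\<lambda>_. 0, \<lambda>_. 0, acc (c i))" if i: "i \<in> I" for i
  proof -
    have "run m (concat (map (\<lambda>u. w i (mark u) # replicate (m * Suc n + 1) (\<lambda>_. 0)) (u0 # us))) (\<lambda>_. 0, \<lambda>_. 0, acc 0)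
      (\<lambda>_. 0, \<lambda>_. 0, acc (0 + (\<Sum>u\<leftarrow>u0 # us. \<Prod>s\<le>m. w i (mark u) s)))"
      by (rule run_blocks) (use small i in \<open>auto simp: wm less_Suc_eq_le\<close>)
    moreover have "map (w i) (blk us) = concat (map (\<lambda>u. w i (mark u) # replicate (m * Suc n + 1) (\<lambda>_. 0)) us)" for us
      by (simp add: blk_def map_concat comp_def w0)
    ultimately have "run m (map (w i) (blk (u0 # us))) (\<lambda>_. 0, \<lambda>_. 0, acc 0) (\<lambda>_. 0, \<lambda>_. 0, acc (c i))"
      by (simp only: c_def add_0)
    then show ?thesis
      unfolding full map_append run_append map_replicate w0 using run_idle by blast
  qed
  \<comment> \<open>At both ends of the path only the accumulator is shifted, by a vector with entry
    0 divisible by \<open>p\<close>: by 0 at the start, by the relation \<open>rel\<close> at the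
    end. So the end functions do not see variable 0.\<close>
  have flat: "flat (\<lambda>i. (\<lambda>_. 0, \<lambda>_. 0, acc (a i))) G0" if a: "\<And>i. i \<in> I \<Longrightarrow> int p dvd a i" for a
    unfolding flat_def
  proof
    fix z assume "z \<in> states I"
    show "(\<lambda>y. G0 (zshift I t (\<lambda>i. (\<lambda>_. 0, \<lambda>_. 0, acc (a i))) y z)) \<in> L t"
    proof (rule L_slice [of 0])
      fix y c assume "y \<in> Y t" "c \<in> S"
      then show "G0 (zshift I t (\<lambda>i. (\<lambda>_. 0, \<lambda>_. 0, acc (a i))) (y(0 := c)) z) =
          G0 (zshift I t (\<lambda>i. (\<lambda>_. 0, \<lambda>_. 0, acc (a i))) y z)"
        unfolding G0_def zshift_def by (simp add: sh3_acc_upd a)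
    qed (use G0_bdd in auto)
  qed
  have us'_cases: "u = (\<lambda>_ _. 0) \<or> u \<in> mark ` set us" if "u \<in> set us'" for u
    using that by (auto simp: us'_def blk_def)
  show ?thesis
    unfolding eq
  proof (rule stepped_bound [OF G1 _ run])
    show "Suc (length us') = 2 ^ N"
      using arg_cong [OF full, of length] N by (simp add: len_blk idle_def)
    show "w i u r = dot d (al i) (u r)" if "r < t" for i u r
      using that by (simp add: w_def)
    show "dead t (\<lambda>r. dot d be (u r))" if "u \<in> set us'" for u
      using us'_cases [OF that]
    proof
      assume "u \<in> mark ` set us"
      then obtain u' where u': "u' \<in> set us" "u = mark u'" by blast
      with dead obtain r where "r \<le> m" "int p dvd dot d be (u' r)" by blast
      then show ?thesis unfolding dead_def by (intro exI [of _ r]) (simp add: u' mark_def)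
    qed (simp add: dot_zero dead_zero)
    show "\<not> int p dvd dot d be (mark u0 r)" if "r < t" for r
      using root that by (auto simp: mark_def)
  qed (use flat rel in \<open>auto simp: c\<close>)
qed

end

section \<open>Relations between evaluations of tensor powers\<close>

text \<open>The Fredholm alternative over the prime field, by Gaussian elimination on the
  coordinates \<open>I\<close>. Each pivot contributes one point of \<open>X\<close>, which bounds
  the length of \<open>ps\<close>.\<close>

lemma mod_elimination:
  fixes v :: "'i \<Rightarrow> 'x \<Rightarrow> int"
  assumes "prime p" "finite I"
  shows "(\<exists>b. (\<forall>x\<in>X. int p dvd (\<Sum>i\<in>I. b i * v i x)) \<and> \<not> int p dvd (\<Sum>i\<in>I. b i * v i x\<^sub>0)) \<or>
    (\<exists>ps. length ps \<le> card I \<and> snd ` set ps \<subseteq> X \<and>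
      (\<forall>i\<in>I. [v i x\<^sub>0 = (\<Sum>(c, x)\<leftarrow>ps. c * v i x)] (mod int p)))"
  using assms(2)
proof (induction I arbitrary: v)
  case empty
  show ?case by (auto intro: exI [of _ "[]"])
next
  case (insert i I v)
  show ?case
  proof (cases "\<forall>x\<in>X. int p dvd v i x")
    case True
    show ?thesis
    proof (cases "int p dvd v i x\<^sub>0")
      case False
      have "(\<Sum>j\<in>insert i I. (if j = i then 1 else 0) * v j x) = v i x" for x
        using insert.hyps by (simp add: if_distrib [of "\<lambda>a. a * _"] cong: if_cong)
      with True False show ?thesis by (intro disjI1 exI [of _ "\<lambda>j. if j = i then 1 else 0"]) simp
    next
      case zero: True
      from insert.IH [of v] show ?thesis
      proof (elim disjE exE conjE)
        fix b assume b: "\<forall>x\<in>X. int p dvd (\<Sum>j\<in>I. b j * v j x)" "\<not> int p dvd (\<Sum>j\<in>I. b j * v j x\<^sub>0)"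
        have "(\<Sum>j\<in>insert i I. (b(i := 0)) j * v j x) = (\<Sum>j\<in>I. b j * v j x)" for x
          using insert.hyps by (auto intro!: sum.cong)
        with b show ?thesis by (intro disjI1 exI [of _ "b(i := 0)"]) simp
      next
        fix ps assume ps: "length ps \<le> card I" "snd ` set ps \<subseteq> X"
          "\<forall>j\<in>I. [v j x\<^sub>0 = (\<Sum>(c, x)\<leftarrow>ps. c * v j x)] (mod int p)"
        have "int p dvd (\<Sum>(c, x)\<leftarrow>ps. c * v i x)"
          using ps(2) True by (induction ps) auto
        then have "[v i x\<^sub>0 = (\<Sum>(c, x)\<leftarrow>ps. c * v i x)] (mod int p)"
          using zero by (simp add: cong_def dvd_eq_mod_eq_0)
        with ps show ?thesis using insert.hyps by (intro disjI2 exI [of _ ps]) auto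
      qed
    qed
  next
    case False
    then obtain x1 where x1: "x1 \<in> X" "\<not> int p dvd v i x1" by blast
    obtain q where q: "[v i x1 * q = 1] (mod int p)"
      using inverse_mod [OF assms(1) x1(2)] by (auto simp: cong_iff_dvd_diff)
    \<comment> \<open>Coordinate \<open>i\<close> is eliminated: modulo \<open>p\<close> every
      \<open>v' j\<close> vanishes at the pivot \<open>x1\<close>.\<close>
    define v' where "v' j x = v j x - q * v j x1 * v i x" for j x
    from insert.IH [of v'] show ?thesis
    proof (elim disjE exE conjE)
      fix b assume b: "\<forall>x\<in>X. int p dvd (\<Sum>j\<in>I. b j * v' j x)" "\<not> int p dvd (\<Sum>j\<in>I. b j * v' j x\<^sub>0)"
      define b' where "b' = b(i := - (\<Sum>j\<in>I. b j * q * v j x1))"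
      have "(\<Sum>j\<in>insert i I. b' j * v j x) = (\<Sum>j\<in>I. b j * v' j x)" for x
      proof -
        have "(\<Sum>j\<in>insert i I. b' j * v j x) = - (\<Sum>j\<in>I. b j * q * v j x1) * v i x + (\<Sum>j\<in>I. b j * v j x)"
          using insert.hyps by (auto simp: b'_def intro!: sum.cong)
        also have "\<dots> = (\<Sum>j\<in>I. b j * v' j x)"
          by (simp add: v'_def algebra_simps sum_subtractf sum_distrib_left)
        finally show ?thesis .
      qed
      with b show ?thesis by (intro disjI1 exI [of _ b']) simp
    next
      fix ps assume ps: "length ps \<le> card I" "snd ` set ps \<subseteq> X"
        "\<forall>j\<in>I. [v' j x\<^sub>0 = (\<Sum>(c, x)\<leftarrow>ps. c * v' j x)] (mod int p)"
      define s where "s j = (\<Sum>(c, x)\<leftarrow>ps. c * v j x)" for j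
      \<comment> \<open>The weight of the pivot is determined by coordinate
        \<open>i\<close>.\<close>
      define c0 where "c0 = q * (v i x\<^sub>0 - s i)"
      have s': "(\<Sum>(c, x)\<leftarrow>ps. c * v' j x) = s j - q * v j x1 * s i" for j
        unfolding s_def v'_def by (induction ps) (auto simp: algebra_simps)
      have "[v j x\<^sub>0 = c0 * v j x1 + s j] (mod int p)" if "j \<in> I" for j
      proof -
        have "[v j x\<^sub>0 - q * v j x1 * v i x\<^sub>0 = s j - q * v j x1 * s i] (mod int p)"
          using bspec [OF ps(3) that] unfolding s' by (simp only: v'_def)
        from cong_add [OF this cong_refl [of "q * v j x1 * v i x\<^sub>0"]] show ?thesis
          by (simp add: c0_def algebra_simps)
      qed
      moreover have "[v i x\<^sub>0 = c0 * v i x1 + s i] (mod int p)"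
      proof -
        have "[(v i x1 * q) * (v i x\<^sub>0 - s i) + s i = 1 * (v i x\<^sub>0 - s i) + s i] (mod int p)"
          by (intro cong_add cong_mult q cong_refl)
        then show ?thesis by (simp add: c0_def cong_sym_eq mult_ac)
      qed
      ultimately show ?thesis
        using ps(1,2) x1(1) insert.hyps by (intro disjI2 exI [of _ "(c0, x1) # ps"]) (auto simp: s_def)
    qed
  qed
qed

definition unit :: "nat \<Rightarrow> nat \<Rightarrow> int" where
  "unit q = (\<lambda>q'. if q' = q then 1 else 0)"

lemma dot_unit [simp]: "q < d \<Longrightarrow> dot d c (unit q) = c q"
  by (simp add: dot_def unit_def if_distrib [of "\<lambda>a. _ * a"] cong: if_cong)

lemma dot_lin: "dot d c (\<lambda>q. a * u q + b * v q) = a * dot d c u + b * dot d c v"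
  by (simp add: dot_def algebra_simps sum.distrib sum_distrib_left)

lemma dot_scale: "dot d c (\<lambda>q. a * u q) = a * dot d c u"
  by (simp add: dot_def sum_distrib_left mult.left_commute)

text \<open>The root tuple is \<open>(e\<^sub>\<beta>, \<dots>, e\<^sub>\<beta>)\<close>. It is eliminated by tuples of unit vectors with one slot
  projected to the kernel of \<open>be\<close>; a functional vanishing on the latter but not on the root would
  exhibit the tensor power of \<open>be\<close> as a combination of the others.\<close>

theorem tensor_relation:
  fixes al :: "nat \<Rightarrow> nat \<Rightarrow> int" and I :: "nat set" and m :: nat
  assumes p: "prime p" and fin: "finite I" and \<beta>: "\<beta> < d" "\<not> int p dvd be \<beta>"
    and B: "\<And>q. q < d \<Longrightarrow> \<bar>be q\<bar> \<le> B" "\<And>i q. i \<in> I \<Longrightarrow> q < d \<Longrightarrow> \<bar>al i q\<bar> \<le> B" "2 * B\<^sup>2 < 2 ^ n"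
    and indep: "\<nexists>c. \<forall>u. int p dvd (\<Prod>s\<le>m. dot d be (u s)) - (\<Sum>i\<in>I. c i * (\<Prod>s\<le>m. dot d (al i) (u s)))"
  obtains u0 us where "length us \<le> card I"
    "\<And>u i r. u \<in> set (u0 # us) \<Longrightarrow> i \<in> I \<Longrightarrow> 0 < r \<Longrightarrow> r \<le> m \<Longrightarrow> \<bar>dot d (al i) (u r)\<bar> < 2 ^ n"
    "\<And>r. r \<le> m \<Longrightarrow> \<not> int p dvd dot d be (u0 r)"
    "\<And>u. u \<in> set us \<Longrightarrow> \<exists>r\<le>m. int p dvd dot d be (u r)"
    "\<And>i. i \<in> I \<Longrightarrow> int p dvd (\<Sum>u\<leftarrow>u0 # us. \<Prod>s\<le>m. dot d (al i) (u s))"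
proof -
  define tens where "tens i u = (\<Prod>s\<le>m. dot d (al i) (u s))" for i and u :: "nat \<Rightarrow> nat \<Rightarrow> int"
  define ker where "ker y = (\<lambda>q. be \<beta> * y q + (- dot d be y) * unit \<beta> q)" for y
  have dot_ker: "dot d c (ker y) = be \<beta> * dot d c y - dot d be y * c \<beta>" for c y
    unfolding ker_def dot_lin using \<beta>(1) by simp
  define g where "g r r' q = (if r' = r then ker (unit q) else unit q)" for r r' q :: nat
  define X where "X = {u. \<exists>r\<le>m. \<exists>b. (\<forall>r'\<le>m. b r' < d) \<and> (\<forall>r'\<le>m. u r' = g r r' (b r'))}"
  define u0 where "u0 = (\<lambda>r :: nat. unit \<beta>)"
  from mod_elimination [OF p fin, of X tens u0] show thesis
  proof (elim disjE exE conjE)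
    fix b assume b: "\<forall>u\<in>X. int p dvd (\<Sum>i\<in>I. b i * tens i u)" "\<not> int p dvd (\<Sum>i\<in>I. b i * tens i u0)"
    define W where "W u = (\<Sum>i\<in>I. b i * tens i u)" for u
    \<comment> \<open>By multilinearity a tuple with one projected slot expands into members of
      \<open>X\<close>, on which \<open>W\<close> vanishes.\<close>
    have W_ker: "int p dvd W (u(r := ker (u r)))" if r: "r \<le> m" for u r
    proof -
      have 1: "dot d c ((u(r := ker (u r))) s) = (\<Sum>q<d. u s q * dot d c (g r s q))" for c s
      proof (cases "s = r")
        case True
        have "(\<Sum>q<d. u r q * dot d c (ker (unit q))) = (\<Sum>q<d. u r q * (be \<beta> * c q - be q * c \<beta>))"
          by (intro sum.cong refl) (simp add: dot_ker)
        also have "\<dots> = be \<beta> * dot d c (u r) - dot d be (u r) * c \<beta>"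
          by (simp add: dot_def algebra_simps sum_subtractf sum_distrib_left)
        finally show ?thesis using True by (simp add: g_def dot_ker)
      next
        case False
        have "(\<Sum>q<d. u s q * dot d c (unit q)) = (\<Sum>q<d. u s q * c q)"
          by (intro sum.cong refl) simp
        with False show ?thesis by (simp add: g_def dot_def mult.commute)
      qed
      have "W (u(r := ker (u r))) = (\<Sum>i\<in>I. \<Sum>f\<in>{..m} \<rightarrow>\<^sub>E {..<d}. b i * (\<Prod>s\<le>m. u s (f s) * dot d (al i) (g r s (f s))))"
        unfolding W_def tens_def 1 by (simp add: prod_sum_PiE sum_distrib_left)
      also have "\<dots> = (\<Sum>f\<in>{..m} \<rightarrow>\<^sub>E {..<d}. \<Sum>i\<in>I. b i * (\<Prod>s\<le>m. u s (f s) * dot d (al i) (g r s (f s))))"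
        by (rule sum.swap)
      also have "\<dots> = (\<Sum>f\<in>{..m} \<rightarrow>\<^sub>E {..<d}. (\<Prod>s\<le>m. u s (f s)) * (\<Sum>i\<in>I. b i * tens i (\<lambda>s. g r s (f s))))"
        by (simp add: tens_def prod.distrib sum_distrib_left mult.left_commute)
      also have "int p dvd \<dots>"
      proof (rule dvd_sum, rule dvd_mult, rule b(1) [rule_format])
        fix f assume "f \<in> {..m} \<rightarrow>\<^sub>E {..<d}"
        then show "(\<lambda>s. g r s (f s)) \<in> X" using r unfolding X_def by (auto intro!: exI [of _ r] exI [of _ f])
      qed
      finally show ?thesis .
    qed
    \<comment> \<open>Vanishing on the projection of \<open>u r\<close> means that
      \<open>u r\<close> may be exchanged for the unit vector at the price of these factors. Doing
      this in all slots makes \<open>W\<close> proportional to the tensor power of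
      \<open>be\<close>.\<close>
    have step: "[be \<beta> * W u = dot d be (u r) * W (u(r := unit \<beta>))] (mod int p)" if r: "r \<le> m" for u r
    proof -
      have sp: "tens i (u(r := x)) = dot d (al i) x * (\<Prod>s\<in>{..m} - {r}. dot d (al i) (u s))" for i x
        using r by (simp add: tens_def prod.remove [of "{..m}" r])
      have "W (u(r := ker (u r))) = be \<beta> * W (u(r := u r)) - dot d be (u r) * W (u(r := unit \<beta>))"
        unfolding W_def sp dot_ker using \<beta>(1)
        by (simp add: algebra_simps sum_subtractf sum_distrib_left)
      with W_ker [OF r, of u] show ?thesis by (simp add: cong_iff_dvd_diff)
    qed
    have main: "l \<le> Suc m \<Longrightarrow> [be \<beta> ^ l * W u = (\<Prod>r<l. dot d be (u r)) * W (\<lambda>r. if r < l then unit \<beta> else u r)] (mod int p)" for l u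
    proof (induction l)
      case (Suc l)
      define U where "U = (\<lambda>r. if r < l then unit \<beta> else u r)"
      have U: "U(l := unit \<beta>) = (\<lambda>r. if r < Suc l then unit \<beta> else u r)" by (auto simp: U_def)
      have "[be \<beta> * (be \<beta> ^ l * W u) = be \<beta> * ((\<Prod>r<l. dot d be (u r)) * W U)] (mod int p)"
        using Suc unfolding U_def by (intro cong_mult [OF cong_refl]) simp
      also have "be \<beta> * ((\<Prod>r<l. dot d be (u r)) * W U) = (\<Prod>r<l. dot d be (u r)) * (be \<beta> * W U)"
        by simp
      also have "[\<dots> = (\<Prod>r<l. dot d be (u r)) * (dot d be (U l) * W (U(l := unit \<beta>)))] (mod int p)"
        using Suc.prems by (intro cong_mult [OF cong_refl] step) simp
      also have "(\<Prod>r<l. dot d be (u r)) * (dot d be (U l) * W (U(l := unit \<beta>))) =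
          (\<Prod>r<Suc l. dot d be (u r)) * W (\<lambda>r. if r < Suc l then unit \<beta> else u r)"
        unfolding U by (simp add: U_def)
      finally show ?case by (simp add: mult.assoc)
    qed simp
    have W0: "\<not> int p dvd W u0" using b(2) by (simp add: W_def)
    obtain \<omega> where \<omega>: "[W u0 * \<omega> = 1] (mod int p)"
      using inverse_mod [OF p W0] by (auto simp: cong_iff_dvd_diff)
    have "int p dvd (\<Prod>s\<le>m. dot d be (u s)) - (\<Sum>i\<in>I. \<omega> * be \<beta> ^ Suc m * b i * (\<Prod>s\<le>m. dot d (al i) (u s)))" for u
    proof -
      have "W (\<lambda>r. if r < Suc m then unit \<beta> else u r) = W u0"
        by (simp add: W_def tens_def u0_def)
      with main [of "Suc m" u] have "[be \<beta> ^ Suc m * W u = (\<Prod>s\<le>m. dot d be (u s)) * W u0] (mod int p)"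
        by (simp add: lessThan_Suc_atMost)
      then have "[\<omega> * (be \<beta> ^ Suc m * W u) = \<omega> * ((\<Prod>s\<le>m. dot d be (u s)) * W u0)] (mod int p)"
        by (rule cong_mult [OF cong_refl])
      also have "\<omega> * ((\<Prod>s\<le>m. dot d be (u s)) * W u0) = (W u0 * \<omega>) * (\<Prod>s\<le>m. dot d be (u s))" by simp
      also have "[\<dots> = 1 * (\<Prod>s\<le>m. dot d be (u s))] (mod int p)"
        by (rule cong_mult [OF \<omega> cong_refl])
      finally have "int p dvd (\<Prod>s\<le>m. dot d be (u s)) - \<omega> * (be \<beta> ^ Suc m * W u)"
        by (simp add: cong_iff_dvd_diff dvd_diff_commute)
      also have "\<omega> * (be \<beta> ^ Suc m * W u) = (\<Sum>i\<in>I. \<omega> * be \<beta> ^ Suc m * b i * (\<Prod>s\<le>m. dot d (al i) (u s)))"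
        by (simp add: W_def tens_def sum_distrib_left mult_ac)
      finally show ?thesis .
    qed
    then have "\<exists>c. \<forall>u. int p dvd (\<Prod>s\<le>m. dot d be (u s)) - (\<Sum>i\<in>I. c i * (\<Prod>s\<le>m. dot d (al i) (u s)))"
      by (intro exI [of _ "\<lambda>i. \<omega> * be \<beta> ^ Suc m * b i"] allI)
    with indep show thesis by (rule notE)
  next
    fix ps assume ps: "length ps \<le> card I" "snd ` set ps \<subseteq> X"
      "\<forall>i\<in>I. [tens i u0 = (\<Sum>(c, u)\<leftarrow>ps. c * tens i u)] (mod int p)"
    \<comment> \<open>The coefficients, of uncontrolled size, go into slot 0. Only the other slots
      serve as multipliers and need few binary digits.\<close>
    define mv :: "int \<times> (nat \<Rightarrow> nat \<Rightarrow> int) \<Rightarrow> nat \<Rightarrow> nat \<Rightarrow> int"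
      where "mv = (\<lambda>(c, u). u(0 := \<lambda>q. - c * u 0 q))"
    have tens_mv: "tens i (mv (c, u)) = - (c * tens i u)" for i c u
    proof -
      have sp: "tens i (u(0 := x)) = dot d (al i) x * (\<Prod>s\<in>{..m} - {0}. dot d (al i) (u s))" for x
        by (simp add: tens_def prod.remove [of "{..m}" 0])
      have "tens i (mv (c, u)) = - c * tens i (u(0 := u 0))"
        unfolding mv_def prod.case sp by (simp only: dot_scale mult.assoc)
      then show ?thesis by simp
    qed
    have B1: "x < 2 ^ n" if "x \<le> B" "0 \<le> x" for x
    proof -
      have "B * 1 \<le> B * (2 * B)" using that by (cases "B = 0") (auto intro: mult_left_mono)
      with B(3) that show ?thesis by (simp add: power2_eq_square)
    qed
    have B2: "\<bar>be \<beta> * al i q - be q * al i \<beta>\<bar> < 2 ^ n" if "i \<in> I" "q < d" for i q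
    proof -
      have "\<bar>be \<beta> * al i q\<bar> \<le> B * B" "\<bar>be q * al i \<beta>\<bar> \<le> B * B"
        unfolding abs_mult using that B(1) [OF \<beta>(1)] B(1) [OF that(2)] B(2) [OF that] B(2) [OF that(1) \<beta>(1)]
        by (auto intro!: mult_mono)
      with B(3) show ?thesis by (simp add: power2_eq_square)
    qed
    show thesis
    proof (rule that [of "map mv ps" u0])
      show "length (map mv ps) \<le> card I" using ps(1) by simp
      show "\<not> int p dvd dot d be (u0 r)" for r
        using \<beta> by (simp add: u0_def)
      show "\<bar>dot d (al i) (u r)\<bar> < 2 ^ n" if u: "u \<in> set (u0 # map mv ps)" and i: "i \<in> I" and r: "0 < r" "r \<le> m" for u i r
      proof (cases "u = u0")
        case True
        then show ?thesis using B1 B(2) [OF i \<beta>(1)] \<beta>(1) by (simp add: u0_def)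
      next
        case False
        with u obtain c u' where u': "(c, u') \<in> set ps" "u = mv (c, u')" by auto
        then have "u' \<in> X" using ps(2) by force
        then obtain s b where sb: "b r < d" "u' r = g s r (b r)" using r unfolding X_def by auto
        have "u r = g s r (b r)" using u'(2) r sb by (simp add: mv_def)
        then show ?thesis using sb(1) B1 B(2) [OF i sb(1)] B2 [OF i sb(1)] by (cases "r = s") (simp_all add: g_def dot_ker)
      qed
      show "\<exists>r\<le>m. int p dvd dot d be (u r)" if u: "u \<in> set (map mv ps)" for u
      proof -
        from u obtain c u' where u': "(c, u') \<in> set ps" "u = mv (c, u')" by auto
        then have "u' \<in> X" using ps(2) by force
        then obtain s b where sb: "s \<le> m" "b s < d" "u' s = g s s (b s)" unfolding X_def by auto
        then have "dot d be (u' s) = 0" by (simp add: g_def dot_ker)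
        then have "dot d be (u s) = 0" using u'(2) by (auto simp: mv_def dot_scale minus_mult_left [symmetric] simp del: mult_minus_left)
        with sb(1) show ?thesis by auto
      qed
      show "int p dvd (\<Sum>u\<leftarrow>u0 # map mv ps. \<Prod>s\<le>m. dot d (al i) (u s))" if i: "i \<in> I" for i
      proof -
        have "(\<Sum>u\<leftarrow>map mv ps. tens i u) = - (\<Sum>(c, u)\<leftarrow>ps. c * tens i u)"
          by (induction ps) (auto simp: tens_mv)
        with ps(3) i show ?thesis
          unfolding tens_def [symmetric] by (simp add: cong_iff_dvd_diff)
      qed
    qed
  qed
qed

section \<open>Systems of linear forms\<close>

definition spanned :: "nat \<Rightarrow> nat \<Rightarrow> nat \<Rightarrow> (nat \<Rightarrow> nat \<Rightarrow> int) \<Rightarrow> nat \<Rightarrow> nat \<Rightarrow> bool" where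
  "spanned p d k al j t \<longleftrightarrow> (\<exists>c. \<forall>u. int p dvd
     (\<Prod>r<t. dot d (al j) (u r)) - (\<Sum>i\<in>{..<k} - {j}. c i * (\<Prod>r<t. dot d (al i) (u r))))"

lemma not_spanned_nonzero:
  assumes "\<not> spanned p d k al j t" "0 < t"
  obtains q where "q < d" "\<not> int p dvd al j q"
proof -
  have "\<exists>q<d. \<not> int p dvd al j q"
  proof (rule ccontr)
    assume "\<not> ?thesis"
    then have "int p dvd dot d (al j) u" for u by (auto simp: dot_def intro!: dvd_sum)
    then have "int p dvd (\<Prod>r<t. dot d (al j) (u r))" for u
      using assms(2) by (intro dvd_trans [OF _ dvd_prodI [of _ 0]]) auto
    then have "spanned p d k al j t" unfolding spanned_def by (intro exI [of _ "\<lambda>_. 0"]) simp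
    with assms(1) show False by contradiction
  qed
  then show thesis using that by blast
qed

text \<open>Otherwise the kernel of the form \<open>i\<close> lies in that of \<open>j\<close>, so
  the latter form is a multiple \<open>l\<close> of the former and its tensor power is
  \<open>l ^ t\<close> times the other one.\<close>

lemma not_spanned_separate:
  assumes p: "prime p" and ns: "\<not> spanned p d k al j t" "0 < t" and i: "i < k" "i \<noteq> j"
  shows "\<exists>u. int p dvd dot d (al i) u \<and> \<not> int p dvd dot d (al j) u"
proof (rule ccontr)
  assume "\<not> ?thesis"
  then have ker: "int p dvd dot d (al j) u" if "int p dvd dot d (al i) u" for u
    using that by blast
  from ns obtain \<beta>' where \<beta>': "\<beta>' < d" "\<not> int p dvd al j \<beta>'" by (rule not_spanned_nonzero)
  then have "\<not> int p dvd al i \<beta>'" using ker [of "unit \<beta>'"] by auto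
  then obtain \<beta> where \<beta>: "\<beta> < d" "\<not> int p dvd al i \<beta>" using \<beta>'(1) by blast
  obtain q where q: "int p dvd al i \<beta> * q - 1" by (rule inverse_mod [OF p \<beta>(2)])
  define l where "l = q * al j \<beta>"
  have mult: "[dot d (al j) u = l * dot d (al i) u] (mod int p)" for u
  proof -
    have "int p dvd dot d (al j) (\<lambda>q. al i \<beta> * u q + (- dot d (al i) u) * unit \<beta> q)"
      by (rule ker) (simp only: dot_lin dot_unit [OF \<beta>(1)], simp)
    then have "[al i \<beta> * dot d (al j) u = dot d (al i) u * al j \<beta>] (mod int p)"
      by (simp only: dot_lin dot_unit [OF \<beta>(1)] cong_iff_dvd_diff) simp
    then have "[q * (al i \<beta> * dot d (al j) u) = q * (dot d (al i) u * al j \<beta>)] (mod int p)"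
      by (rule cong_mult [OF cong_refl])
    moreover have "[(al i \<beta> * q) * dot d (al j) u = 1 * dot d (al j) u] (mod int p)"
      by (rule cong_mult [OF _ cong_refl]) (use q in \<open>simp add: cong_iff_dvd_diff\<close>)
    ultimately show ?thesis
      unfolding l_def by (simp add: mult_ac) (metis cong_sym cong_trans)
  qed
  have "int p dvd (\<Prod>r<t. dot d (al j) (u r)) - (\<Sum>i'\<in>{..<k} - {j}. (if i' = i then l ^ t else 0) * (\<Prod>r<t. dot d (al i') (u r)))" for u
  proof -
    have "(\<Sum>i'\<in>{..<k} - {j}. (if i' = i then l ^ t else 0) * (\<Prod>r<t. dot d (al i') (u r))) =
        (\<Prod>r<t. l * dot d (al i) (u r))"
      using i by (simp add: if_distrib [of "\<lambda>a. a * _"] prod.distrib cong: if_cong)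
    moreover have "[(\<Prod>r<t. dot d (al j) (u r)) = (\<Prod>r<t. l * dot d (al i) (u r))] (mod int p)"
      by (rule cong_prod) (rule mult)
    ultimately show ?thesis by (simp add: cong_iff_dvd_diff)
  qed
  then have "spanned p d k al j t" unfolding spanned_def by (intro exI [of _ "\<lambda>i'. if i' = i then l ^ t else 0"] allI)
  with ns(1) show False by contradiction
qed

text \<open>With \<open>k - 1\<close> slots every other form can be given a slot where it vanishes
  while the form \<open>j\<close> does not; a relation evaluated there fails.\<close>

lemma not_spanned_large:
  assumes p: "prime p" and ns: "\<not> spanned p d k al j t" "0 < t" and "j < k" and t': "k - 1 \<le> t'"
  shows "\<not> spanned p d k al j t'"
proof
  assume "spanned p d k al j t'"
  then obtain c where c: "\<And>u. int p dvd
     (\<Prod>r<t'. dot d (al j) (u r)) - (\<Sum>i\<in>{..<k} - {j}. c i * (\<Prod>r<t'. dot d (al i) (u r)))"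
    unfolding spanned_def by blast
  obtain q where q: "q < d" "\<not> int p dvd al j q" using ns by (rule not_spanned_nonzero)
  have "\<exists>w. \<forall>i\<in>{..<k} - {j}. int p dvd dot d (al i) (w i) \<and> \<not> int p dvd dot d (al j) (w i)"
    by (rule bchoice) (use not_spanned_separate [OF p ns] in blast)
  then obtain w where w: "\<And>i. i \<in> {..<k} - {j} \<Longrightarrow> int p dvd dot d (al i) (w i) \<and> \<not> int p dvd dot d (al j) (w i)" by blast
  have "card ({..<k} - {j}) = k - 1" using \<open>j < k\<close> by simp
  then obtain h where h: "bij_betw h {..<k - 1} ({..<k} - {j})"
    using ex_bij_betw_nat_finite [of "{..<k} - {j}"] by (auto simp: atLeast0LessThan)
  define u where "u r = (if r < k - 1 then w (h r) else unit q)" for r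
  have j: "\<not> int p dvd dot d (al j) (u r)" for r
    using w [of "h r"] bij_betwE [OF h] q by (auto simp: u_def)
  have "int p dvd (\<Prod>r<t'. dot d (al i) (u r))" if i: "i \<in> {..<k} - {j}" for i
  proof -
    have "i \<in> h ` {..<k - 1}" using bij_betw_imp_surj_on [OF h] i by simp
    then obtain r where r: "r < k - 1" "h r = i" by blast
    then have "int p dvd dot d (al i) (u r)" using w [OF i] by (simp add: u_def)
    then show ?thesis using r t' by (intro dvd_trans [OF _ dvd_prodI [of _ r]]) auto
  qed
  then have "int p dvd (\<Sum>i\<in>{..<k} - {j}. c i * (\<Prod>r<t'. dot d (al i) (u r)))" by (intro dvd_sum dvd_mult)
  from dvd_add [OF c [of u] this] have "int p dvd (\<Prod>r<t'. dot d (al j) (u r))" by simp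
  with j p show False by (simp add: prime_dvd_prod_iff)
qed

section \<open>Tame functions\<close>

context fp_space begin

lemma unorm_cnj: "unorm t (\<lambda>x. cnj (F x)) = unorm t F"
proof -
  have c: "(cnj ^^ n) (cnj z) = cnj ((cnj ^^ n) z)" for n z by (simp add: funpow_swap1)
  have "gow t (\<lambda>x. cnj (F x)) = cnj (gow t F)"
    by (simp add: gow_def cnj_expect split_beta c)
  then show ?thesis by (simp add: unorm_def)
qed

lemma unorm_1: "unorm (Suc 0) F = cmod (expect S F)"
  by (simp add: unorm_def gow_1 complex_mult_cnj cmod_def sqrt_def)

text \<open>Structure gives control at degree \<open>T\<close>, and steps at \<open>T - 2\<close>
  are what the path argument needs to reach degree \<open>T - 1\<close>.\<close>

definition tame :: "nat \<Rightarrow> ('v \<Rightarrow> complex) \<Rightarrow> bool" where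
  "tame T D \<longleftrightarrow> bdd D \<and> structured T D \<and> (2 \<le> T \<longrightarrow> stepfun (T - 2) D)"

lemma tame_mono:
  assumes "tame T D" "T \<le> T'"
  shows "tame T' D"
proof (cases "T = T'")
  case False
  have "structured T' D" using assms structured_mono by (auto simp: tame_def)
  moreover have "stepfun (T' - 2) D" if "2 \<le> T'"
  proof (rule structured_imp_stepfun)
    show "structured (Suc (T' - 2)) D"
      by (rule structured_mono [of T]) (use assms False that in \<open>auto simp: tame_def\<close>)
  qed (use assms in \<open>auto simp: tame_def\<close>)
  ultimately show ?thesis using assms by (simp add: tame_def)
qed (use assms in simp)

lemma rich_tame:
  assumes "bdd F" "0 < T" "25 * T + 85 \<le> c"
  obtains D where "tame T D" "unorm T F ^ (2 ^ c) \<le> cmod (expect S (\<lambda>v. F v * D v))"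
proof (cases "T = 1")
  \<comment> \<open>In degree 1 the norm is the modulus of the mean, and the constant 1 serves as
    \<open>D\<close>.\<close>
  case True
  have "cmod (expect S F) \<le> 1" using assms(1) by (intro cmod_expect_le_1) auto
  then have "unorm T F ^ (2 ^ c) \<le> unorm T F"
    using True by (simp add: unorm_1 power_le_one_iff power_decreasing [of 1 "2 ^ c", simplified])
  moreover have "tame T (\<lambda>_. 1)"
    using True by (auto simp: tame_def structured_def L_const)
  ultimately show thesis using that [of "\<lambda>_. 1"] True by (simp add: unorm_1)
next
  case False
  then obtain m where m: "T = m + 2" using assms(2) by (metis One_nat_def Suc_leI add_2_eq_Suc' le_Suc_ex le_antisym nat_less_le plus_1_eq_Suc not_less_eq_eq add.commute add_Suc)
  from rich_stepfun [OF assms(1), of m] obtain D where D: "bdd D" "structured (m + 2) D" "stepfun m D"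
    "unorm (m + 2) F ^ (2 ^ (25 * m + 85)) \<le> cmod (expect S (\<lambda>v. F v * D v))" by blast
  have "cmod (expect S (\<lambda>v. F v * D v)) \<le> 1"
    using assms(1) D(1) by (intro cmod_expect_le_1) (simp add: norm_mult mult_le_one)
  with D(4) have "unorm (m + 2) F ^ (2 ^ (25 * m + 85)) \<le> 1" by linarith
  then have "unorm T F \<le> 1"
    using unorm_nonneg [of T F] m by (simp add: power_le_one_iff)
  then have "unorm T F ^ (2 ^ c) \<le> unorm T F ^ (2 ^ (25 * m + 85))"
    using assms m unorm_nonneg [of T F] by (intro power_decreasing power_increasing) auto
  with D m show thesis using that [of D] by (simp add: tame_def)
qed

end

lemma power_two_power_antimono:
  "0 \<le> (x::real) \<Longrightarrow> x \<le> 1 \<Longrightarrow> a \<le> b \<Longrightarrow> x ^ (2 ^ b) \<le> x ^ (2 ^ a)"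
  by (intro power_decreasing power_increasing) auto

lemma power_two_power_power: "((x::real) ^ (2 ^ a)) ^ (2 ^ b) = x ^ (2 ^ (a + b))"
  by (simp add: power_mult [symmetric] power_add)

section \<open>Replacement of functions one at a time\<close>

locale form_system = fp_space scale S p for scale :: "int \<Rightarrow> 'v::ab_group_add \<Rightarrow> 'v" (infixr \<open>*s\<close> 75)
    and S p +
  fixes d k s :: nat and al :: "nat \<Rightarrow> nat \<Rightarrow> int"
  assumes indep: "j < k \<Longrightarrow> s < t \<Longrightarrow> \<not> spanned p d k al j t"
begin

abbreviation "form i \<equiv> lc d (al i)"

definition Lam :: "(nat \<Rightarrow> 'v \<Rightarrow> complex) \<Rightarrow> complex" where
  "Lam fs = expect (Y d) (\<lambda>x. \<Prod>i<k. fs i (form i x))"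

lemma Lam_le_1: "\<forall>i. bdd (fs i) \<Longrightarrow> cmod (Lam fs) \<le> 1"
  unfolding Lam_def by (intro cmod_expect_le_1) (simp add: prod_norm [symmetric] prod_le_1)

lemma Lam_split: "j < k \<Longrightarrow> Lam fs = expect (Y d) (\<lambda>x. fs j (form j x) * (\<Prod>i\<in>{..<k} - {j}. fs i (form i x)))"
  by (simp add: Lam_def prod.remove [of "{..<k}" j])

lemma separate: "j < k \<Longrightarrow> i < k \<Longrightarrow> i \<noteq> j \<Longrightarrow> \<exists>u. int p dvd dot d (al i) u \<and> \<not> int p dvd dot d (al j) u"
  using not_spanned_separate [OF prime_p indep [of j "Suc s"]] by blast

lemma nonzero: assumes "j < k" obtains u where "\<not> int p dvd dot d (al j) u"
  using not_spanned_nonzero [OF indep [OF assms lessI]] that [of "unit _"] dot_unit by (metis zero_less_Suc)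

lemma nonzero_normalized: assumes "j < k" obtains u where "int p dvd dot d (al j) u - 1"
proof -
  obtain u where "\<not> int p dvd dot d (al j) u" using assms by (rule nonzero)
  then obtain q where "int p dvd dot d (al j) u * q - 1" by (rule inverse_mod [OF prime_p])
  then show thesis using that [of "\<lambda>r. q * u r"] by (simp add: dot_scale mult.commute)
qed

text \<open>The variables are shifted by the tuple \<open>u\<close>. A function at another form
  becomes invisible because it is structured, or because its form vanishes on some
  direction.\<close>

lemma Lam_le_unorm:
  assumes j: "j < k" and T: "0 < T" and bd: "\<forall>i. bdd (fs i)" and u: "\<And>r. r < T \<Longrightarrow> \<not> int p dvd dot d (al j) (u r)"
    and dead: "\<And>i. i < k \<Longrightarrow> i \<noteq> j \<Longrightarrow> structured T (fs i) \<or> (\<exists>r<T. int p dvd dot d (al i) (u r))"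
  shows "cmod (Lam fs) \<le> unorm T (fs j)"
proof -
  define g where "g x y = (\<Prod>i\<in>{..<k} - {j}. fs i (form i x + lc T (\<lambda>r. dot d (al i) (u r)) y))" for x y
  have sh: "Lam fs = expect (Y d) (\<lambda>x. fs j (form j x + lc T (\<lambda>r. dot d (al j) (u r)) y) * g x y)" if y: "y \<in> Y T" for y
    unfolding Lam_split [OF j] g_def lc_xshift [symmetric] by (rule expect_xshift [OF y, symmetric])
  have "Lam fs = expect (Y T) (\<lambda>y. Lam fs)" by (simp add: finite_Y Y_nonempty)
  also have "\<dots> = expect (Y T) (\<lambda>y. expect (Y d) (\<lambda>x. fs j (form j x + lc T (\<lambda>r. dot d (al j) (u r)) y) * g x y))"
    by (rule expect_cong [OF refl]) (rule sh)
  also have "\<dots> = expect (Y d) (\<lambda>x. expect (Y T) (\<lambda>y. fs j (form j x + lc T (\<lambda>r. dot d (al j) (u r)) y) * g x y))"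
    by (rule expect_swap)
  finally have eq: "Lam fs = expect (Y d) (\<lambda>x. expect (Y T) (\<lambda>y. fs j (form j x + lc T (\<lambda>r. dot d (al j) (u r)) y) * g x y))" .
  have "cmod (Lam fs) \<le> mean (Y d) (\<lambda>x. cmod (expect (Y T) (\<lambda>y. fs j (form j x + lc T (\<lambda>r. dot d (al j) (u r)) y) * g x y)))"
    unfolding eq by (rule cmod_expect_le_mean)
  also have "\<dots> \<le> unorm T (fs j)"
  proof (rule mean_le [OF finite_Y _ unorm_nonneg [OF T]])
    fix x assume x: "x \<in> Y d"
    have "g x \<in> L T"
      unfolding g_def
    proof (rule L_prod_set [OF T])
      fix i assume "i \<in> {..<k} - {j}"
      then consider "structured T (fs i)" | "dead T (\<lambda>r. dot d (al i) (u r))"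
        using dead [of i] by (auto simp: dead_def)
      then show "(\<lambda>y. fs i (form i x + lc T (\<lambda>r. dot d (al i) (u r)) y)) \<in> L T"
      proof cases
        case 1
        then show ?thesis using lc_S [OF x] unfolding structured_def by blast
      next
        case 2
        then show ?thesis by (rule L_dead) (use bd in blast)
      qed
    qed
    then show "cmod (expect (Y T) (\<lambda>y. fs j (form j x + lc T (\<lambda>r. dot d (al j) (u r)) y) * g x y)) \<le> unorm T (fs j)"
      using L_bound [OF _ T u lc_S [OF x], where F = "fs j" and g = "g x"] by simp
  qed
  finally show ?thesis .
qed

text \<open>Instead of conditioning on the fibre over \<open>y\<close>, each \<open>x\<close> is
  moved into it along \<open>u\<close>, on which the form \<open>j\<close> takes the value 1. The
  average stays over all of \<open>Y d\<close>.\<close>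

definition dual :: "nat \<Rightarrow> (nat \<Rightarrow> int) \<Rightarrow> (nat \<Rightarrow> 'v \<Rightarrow> complex) \<Rightarrow> 'v \<Rightarrow> complex" where
  "dual j u fs y = expect (Y d) (\<lambda>x. \<Prod>i\<in>{..<k} - {j}. fs i (form i x + dot d (al i) u *s (y - form j x)))"

lemma dual_bdd: "\<forall>i. bdd (fs i) \<Longrightarrow> bdd (dual j u fs)"
  unfolding dual_def by (intro allI cmod_expect_le_1) (simp add: prod_norm [symmetric] prod_le_1)

lemma Lam_dual:
  assumes j: "j < k" and u: "int p dvd dot d (al j) u - 1"
  shows "Lam (fs(j := g)) = expect S (\<lambda>y. g y * dual j u fs y)"
proof -
  define P where "P x h = (\<Prod>i\<in>{..<k} - {j}. fs i (form i x + dot d (al i) u *s h))" for x h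
  have sh: "form i (xshift d (Suc 0) (\<lambda>_. u) (\<lambda>r\<in>{..<Suc 0}. h) x) = form i x + dot d (al i) u *s h" for i x h
    unfolding lc_xshift by (simp add: lc_def)
  have unit: "dot d (al j) u *s h = h" if "h \<in> S" for h
    using scale_dvd [OF u that] by (simp add: scale_left_diff_distrib)
  have "expect S (\<lambda>y. g y * dual j u fs y) = expect S (\<lambda>y. expect (Y d) (\<lambda>x. g y * P x (y - form j x)))"
    by (simp only: dual_def P_def expect_mult_left)
  also have "\<dots> = expect (Y d) (\<lambda>x. expect S (\<lambda>y. g y * P x (y - form j x)))"
    by (rule expect_swap)
  also have "\<dots> = expect (Y d) (\<lambda>x. expect S (\<lambda>h. g (form j x + h) * P x h))"
  proof (rule expect_cong [OF refl])
    fix x assume "x \<in> Y d"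
    then show "expect S (\<lambda>y. g y * P x (y - form j x)) = expect S (\<lambda>h. g (form j x + h) * P x h)"
      using expect_S_shift' [of "form j x" "\<lambda>y. g y * P x (y - form j x)"] lc_S by simp
  qed
  also have "\<dots> = expect S (\<lambda>h. expect (Y d) (\<lambda>x. g (form j x + h) * P x h))"
    by (rule expect_swap)
  also have "\<dots> = expect S (\<lambda>h. Lam (fs(j := g)))"
  proof (rule expect_cong [OF refl])
    fix h assume h: "h \<in> S"
    have "expect (Y d) (\<lambda>x. g (form j x + h) * P x h) = expect (Y d) (\<lambda>x. g (form j x + dot d (al j) u *s h) * P x h)"
      by (simp only: unit [OF h])
    also have "\<dots> = Lam (fs(j := g))"
      unfolding Lam_split [OF j] P_def sh [symmetric]
      by (subst expect_xshift) (use h in \<open>auto simp: Y_def intro!: expect_cong prod.cong\<close>)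
    finally show "expect (Y d) (\<lambda>x. g (form j x + h) * P x h) = Lam (fs(j := g))" .
  qed
  finally show ?thesis by (simp add: finite_S S_nonempty)
qed

lemma replace_one:
  assumes j: "j < k" and bd: "\<forall>i. bdd (fs i)" and T: "0 < T" "25 * T + 85 \<le> c"
    and bound: "\<And>g. bdd g \<Longrightarrow> cmod (Lam (fs(j := g))) ^ (2 ^ e) \<le> unorm T g"
  obtains D where "tame T D" "cmod (Lam fs) ^ (2 ^ (e + 1 + c)) \<le> cmod (Lam (fs(j := D)))"
proof -
  obtain u where u: "int p dvd dot d (al j) u - 1" using j by (rule nonzero_normalized)
  define F where "F = dual j u fs"
  have F: "bdd F" unfolding F_def by (rule dual_bdd [OF bd])
  have dual: "Lam (fs(j := g)) = expect S (\<lambda>y. F y * g y)" for g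
    unfolding Lam_dual [OF j u] F_def by (simp add: mult.commute)
  have "(cmod (Lam fs))\<^sup>2 \<le> Re (expect S (\<lambda>y. F y * cnj (F y)))"
    using dual [of "fs j"] bd by (simp add: expect_cs)
  also have "\<dots> \<le> cmod (Lam (fs(j := \<lambda>y. cnj (F y))))" unfolding dual by (rule complex_Re_le_cmod)
  finally have "((cmod (Lam fs))\<^sup>2) ^ (2 ^ e) \<le> cmod (Lam (fs(j := \<lambda>y. cnj (F y)))) ^ (2 ^ e)"
    by (rule power_mono) simp
  also have "\<dots> \<le> unorm T F" using bound [of "\<lambda>y. cnj (F y)"] F by (simp add: unorm_cnj)
  finally have "(((cmod (Lam fs))\<^sup>2) ^ (2 ^ e)) ^ (2 ^ c) \<le> unorm T F ^ (2 ^ c)" by (rule power_mono) simp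
  moreover obtain D where D: "tame T D" "unorm T F ^ (2 ^ c) \<le> cmod (expect S (\<lambda>v. F v * D v))"
    using rich_tame [OF F T] by blast
  ultimately have "cmod (Lam fs) ^ (2 ^ (e + 1 + c)) \<le> cmod (Lam (fs(j := D)))"
    unfolding dual by (simp add: power_mult [symmetric] power_add mult_ac)
  with D(1) show thesis by (rule that)
qed

text \<open>\<open>K\<close> records what previous rounds achieved. It follows from the new
  tameness, so it survives each replacement and remains available to \<open>bound\<close>.\<close>

lemma replace_all:
  assumes A: "finite A" "A \<subseteq> {..<k} - {i\<^sub>0}" and T: "0 < T" "25 * T + 85 \<le> c" and K: "\<And>D. tame T D \<Longrightarrow> K D"
    and bound: "\<And>j fs. j \<in> {..<k} - {i\<^sub>0} \<Longrightarrow> \<forall>i. bdd (fs i) \<Longrightarrow> \<forall>i\<in>{..<k} - {i\<^sub>0, j}. K (fs i) \<Longrightarrow>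
      cmod (Lam fs) ^ (2 ^ e) \<le> unorm T (fs j)"
    and fs: "\<forall>i. bdd (fs i)" "\<forall>i\<in>{..<k} - {i\<^sub>0}. K (fs i)"
  shows "\<exists>Ds. (\<forall>i. bdd (Ds i)) \<and> (\<forall>i\<in>{..<k} - {i\<^sub>0}. K (Ds i)) \<and> (\<forall>i\<in>A. tame T (Ds i)) \<and> Ds i\<^sub>0 = fs i\<^sub>0 \<and>
    cmod (Lam fs) ^ (2 ^ (card A * (e + 1 + c))) \<le> cmod (Lam Ds)"
  using A
proof (induction A rule: finite_induct)
  case empty
  show ?case using fs by (intro exI [of _ fs]) simp
next
  case (insert j A)
  then obtain Ds where Ds: "\<forall>i. bdd (Ds i)" "\<forall>i\<in>{..<k} - {i\<^sub>0}. K (Ds i)" "\<forall>i\<in>A. tame T (Ds i)" "Ds i\<^sub>0 = fs i\<^sub>0"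
    "cmod (Lam fs) ^ (2 ^ (card A * (e + 1 + c))) \<le> cmod (Lam Ds)" by auto
  have j: "j < k" "j \<noteq> i\<^sub>0" using insert.prems by auto
  have "cmod (Lam (Ds(j := g))) ^ (2 ^ e) \<le> unorm T g" if "bdd g" for g
    using bound [of j "Ds(j := g)"] that Ds(1,2) j by simp
  then obtain D where D: "tame T D" "cmod (Lam Ds) ^ (2 ^ (e + 1 + c)) \<le> cmod (Lam (Ds(j := D)))"
    using replace_one [OF j(1) Ds(1) T] by blast
  have "cmod (Lam fs) ^ (2 ^ (card (insert j A) * (e + 1 + c))) =
      (cmod (Lam fs) ^ (2 ^ (card A * (e + 1 + c)))) ^ (2 ^ (e + 1 + c))"
    using insert.hyps by (simp add: power_mult [symmetric] power_add mult_ac)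
  also have "\<dots> \<le> cmod (Lam Ds) ^ (2 ^ (e + 1 + c))" by (rule power_mono [OF Ds(5)]) simp
  also have "\<dots> \<le> cmod (Lam (Ds(j := D)))" by (rule D(2))
  finally have fin: "cmod (Lam fs) ^ (2 ^ (card (insert j A) * (e + 1 + c))) \<le> cmod (Lam (Ds(j := D)))" .
  have "bdd D" using D(1) by (simp add: tame_def)
  with Ds(1-4) D(1) K [OF D(1)] j show ?case by (intro exI [of _ "Ds(j := D)"] conjI fin) auto
qed

end

section \<open>Lowering the degree round by round\<close>

locale bounded_form_system = form_system scale S p d k s al for scale :: "int \<Rightarrow> 'v::ab_group_add \<Rightarrow> 'v" (infixr \<open>*s\<close> 75)
    and S p d k s al +
  fixes B :: int and n N :: nat
  assumes k: "2 \<le> k" and s: "s + 2 \<le> k"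
    and B: "i < k \<Longrightarrow> q < d \<Longrightarrow> \<bar>al i q\<bar> \<le> B" "2 * B\<^sup>2 < 2 ^ n" and N: "k * (k * Suc n + 2) \<le> 2 ^ N"
begin

lemma Lam_stepfun:
  assumes j: "j < k" and m: "m < k" and ns: "\<not> spanned p d k al j (Suc m)" and bd: "\<forall>i. bdd (fs i)"
    and st: "\<And>i. i < k \<Longrightarrow> i \<noteq> j \<Longrightarrow> stepfun m (fs i)"
  shows "cmod (Lam fs) ^ (2 ^ (1 + N)) \<le> unorm (Suc m) (fs j)"
proof -
  let ?I = "{..<k} - {j}"
  obtain q where q: "q < d" "\<not> int p dvd al j q" using ns by (rule not_spanned_nonzero) simp
  obtain u0 us where u: "length us \<le> card ?I"
    "\<And>u i r. u \<in> set (u0 # us) \<Longrightarrow> i \<in> ?I \<Longrightarrow> 0 < r \<Longrightarrow> r \<le> m \<Longrightarrow> \<bar>dot d (al i) (u r)\<bar> < 2 ^ n"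
    "\<And>r. r \<le> m \<Longrightarrow> \<not> int p dvd dot d (al j) (u0 r)"
    "\<And>u. u \<in> set us \<Longrightarrow> \<exists>r\<le>m. int p dvd dot d (al j) (u r)"
    "\<And>i. i \<in> ?I \<Longrightarrow> int p dvd (\<Sum>u\<leftarrow>u0 # us. \<Prod>s\<le>m. dot d (al i) (u s))"
  proof (rule tensor_relation [OF prime_p, of ?I q d "al j" B al n m])
    show "\<nexists>c. \<forall>u. int p dvd (\<Prod>s\<le>m. dot d (al j) (u s)) - (\<Sum>i\<in>?I. c i * (\<Prod>s\<le>m. dot d (al i) (u s)))"
      using ns by (simp add: spanned_def lessThan_Suc_atMost)
  qed (use q B j in auto)
  have "Suc (length us) \<le> k" using u(1) j by simp
  then have "Suc (length us) * (m * Suc n + 2) \<le> k * (k * Suc n + 2)"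
    using m by (intro mult_le_mono add_mono order_refl) auto
  with N have "Suc (length us) * (m * Suc n + 2) \<le> 2 ^ N" by linarith
  then have "cmod (expect (Y d) (\<lambda>x. fs j (form j x) * (\<Prod>i\<in>?I. fs i (form i x)))) ^ (2 * 2 ^ N) \<le> unorm (Suc m) (fs j)"
    by (intro stepfun_system_bound [where ?u0.0 = u0 and us = us]) (use bd st u in auto)
  then show ?thesis by (simp add: Lam_split [OF j])
qed

abbreviation "c \<equiv> 25 * k + 85"

text \<open>The function at \<open>i\<^sub>0\<close> is first made tame of degree
  \<open>Suc T\<close>. All others are structured of this degree except the one at \<open>j\<close>,
  which is hidden by the direction \<open>u\<close>. Then only \<open>j\<close> lacks steps, and
  \<open>Lam_stepfun\<close> applies.\<close>

lemma stage_bound: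
  assumes T: "s < T" "T + 1 < k" and i0: "i\<^sub>0 < k" and j: "j \<in> {..<k} - {i\<^sub>0}" and bd: "\<forall>i. bdd (fs i)"
    and fs: "\<forall>i\<in>{..<k} - {i\<^sub>0, j}. tame (Suc T) (fs i)"
  shows "cmod (Lam fs) ^ (2 ^ (2 + c + N)) \<le> unorm T (fs j)"
proof -
  obtain u where u: "int p dvd dot d (al j) u" "\<not> int p dvd dot d (al i\<^sub>0) u"
    using separate [of i\<^sub>0 j] i0 j by blast
  have b: "cmod (Lam (fs(i\<^sub>0 := g))) ^ (2 ^ 0) \<le> unorm (Suc T) g" if "bdd g" for g
    using Lam_le_unorm [OF i0, of "Suc T" "fs(i\<^sub>0 := g)" "\<lambda>_. u"] u bd fs that by (fastforce simp: tame_def)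
  obtain D where D: "tame (Suc T) D" "cmod (Lam fs) ^ (2 ^ (0 + 1 + c)) \<le> cmod (Lam (fs(i\<^sub>0 := D)))"
    by (rule replace_one [OF i0 bd _ _ b, where c = "25 * k + 85"]) (use T in auto)
  obtain m where m: "T = Suc m" using T by (cases T) auto
  have 1: "cmod (Lam (fs(i\<^sub>0 := D))) ^ (2 ^ (1 + N)) \<le> unorm (Suc m) ((fs(i\<^sub>0 := D)) j)"
    by (rule Lam_stepfun) (use T j m bd fs D(1) indep in \<open>auto simp: tame_def\<close>)
  have 2: "(cmod (Lam fs) ^ (2 ^ (0 + 1 + c))) ^ (2 ^ (1 + N)) \<le> cmod (Lam (fs(i\<^sub>0 := D))) ^ (2 ^ (1 + N))"
    by (rule power_mono [OF D(2)]) simp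
  have "0 + 1 + c + (1 + N) = 2 + c + N" "(fs(i\<^sub>0 := D)) j = fs j" using j by auto
  with order_trans [OF 2 1] show ?thesis unfolding power_two_power_power m by (simp only:)
qed

lemma initial_bound:
  assumes j: "j < k" and bd: "\<forall>i. bdd (fs i)"
  shows "cmod (Lam fs) \<le> unorm (k - 1) (fs j)"
proof -
  have "\<exists>w. \<forall>i\<in>{..<k} - {j}. int p dvd dot d (al i) (w i) \<and> \<not> int p dvd dot d (al j) (w i)"
    by (rule bchoice) (use separate [OF j] in blast)
  then obtain w where w: "\<And>i. i \<in> {..<k} - {j} \<Longrightarrow> int p dvd dot d (al i) (w i) \<and> \<not> int p dvd dot d (al j) (w i)" by blast
  have "card ({..<k} - {j}) = k - 1" using j by simp
  then obtain h where h: "bij_betw h {..<k - 1} ({..<k} - {j})"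
    using ex_bij_betw_nat_finite [of "{..<k} - {j}"] by (auto simp: atLeast0LessThan)
  show ?thesis
  proof (rule Lam_le_unorm [OF j _ bd, where u = "\<lambda>r. w (h r)"])
    show "\<not> int p dvd dot d (al j) (w (h r))" if "r < k - 1" for r
      using w bij_betwE [OF h] that by blast
    fix i assume "i < k" "i \<noteq> j"
    then have "i \<in> h ` {..<k - 1}" using bij_betw_imp_surj_on [OF h] by simp
    then obtain r where "r < k - 1" "h r = i" by blast
    with w [of i] \<open>i < k\<close> \<open>i \<noteq> j\<close> show "structured (k - 1) (fs i) \<or> (\<exists>r<k - 1. int p dvd dot d (al i) (w (h r)))" by blast
  qed (use k in simp)
qed

text \<open>One replacement in \<open>replace_all\<close>, at cost \<open>e + 1 + c\<close> with
  \<open>e\<close> taken from \<open>stage_bound\<close>.\<close>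

abbreviation "weight \<equiv> 3 + 2 * c + N"

text \<open>Round \<open>l\<close> ends at degree \<open>k - 1 - l\<close>, and the premise keeps
  this at least \<open>s + 1\<close>; below that, \<open>indep\<close> gives no control of the
  forms.\<close>

lemma stages:
  assumes i0: "i\<^sub>0 < k" and bd: "\<forall>i. bdd (fs i)"
  shows "l + s + 2 \<le> k \<Longrightarrow> \<exists>Ds. (\<forall>i. bdd (Ds i)) \<and> (\<forall>i\<in>{..<k} - {i\<^sub>0}. tame (k - 1 - l) (Ds i)) \<and> Ds i\<^sub>0 = fs i\<^sub>0 \<and>
    cmod (Lam fs) ^ (2 ^ (Suc l * ((k - 1) * weight))) \<le> cmod (Lam Ds)"
proof (induction l)
  case 0
  have "\<exists>Ds. (\<forall>i. bdd (Ds i)) \<and> (\<forall>i\<in>{..<k} - {i\<^sub>0}. True) \<and> (\<forall>i\<in>{..<k} - {i\<^sub>0}. tame (k - 1) (Ds i)) \<and> Ds i\<^sub>0 = fs i\<^sub>0 \<and>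
    cmod (Lam fs) ^ (2 ^ (card ({..<k} - {i\<^sub>0}) * (0 + 1 + c))) \<le> cmod (Lam Ds)"
    by (rule replace_all) (use k bd initial_bound in auto)
  then obtain Ds where Ds: "\<forall>i. bdd (Ds i)" "\<forall>i\<in>{..<k} - {i\<^sub>0}. tame (k - 1) (Ds i)" "Ds i\<^sub>0 = fs i\<^sub>0"
    "cmod (Lam fs) ^ (2 ^ (card ({..<k} - {i\<^sub>0}) * (0 + 1 + c))) \<le> cmod (Lam Ds)" by blast
  have "card ({..<k} - {i\<^sub>0}) * (0 + 1 + c) \<le> Suc 0 * ((k - 1) * weight)"
    using i0 by (simp only: card_Diff_singleton card_lessThan lessThan_iff finite_lessThan mult_1 One_nat_def [symmetric])
      (rule mult_le_mono2, simp)
  from order_trans [OF power_two_power_antimono [OF norm_ge_zero Lam_le_1 [OF bd] this] Ds(4)] Ds(1-3)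
  show ?case by (intro exI [of _ Ds]) simp
next
  case (Suc l)
  then obtain Ds where Ds: "\<forall>i. bdd (Ds i)" "\<forall>i\<in>{..<k} - {i\<^sub>0}. tame (k - 1 - l) (Ds i)" "Ds i\<^sub>0 = fs i\<^sub>0"
    "cmod (Lam fs) ^ (2 ^ (Suc l * ((k - 1) * weight))) \<le> cmod (Lam Ds)" by auto
  define T where "T = k - 1 - Suc l"
  have T: "k - 1 - l = Suc T" "s < T" "T + 1 < k" using Suc.prems by (auto simp: T_def)
  have "\<exists>Es. (\<forall>i. bdd (Es i)) \<and> (\<forall>i\<in>{..<k} - {i\<^sub>0}. tame (Suc T) (Es i)) \<and> (\<forall>i\<in>{..<k} - {i\<^sub>0}. tame T (Es i)) \<and>
    Es i\<^sub>0 = Ds i\<^sub>0 \<and> cmod (Lam Ds) ^ (2 ^ (card ({..<k} - {i\<^sub>0}) * ((2 + c + N) + 1 + c))) \<le> cmod (Lam Es)"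
  proof (rule replace_all)
    show "cmod (Lam gs) ^ (2 ^ (2 + c + N)) \<le> unorm T (gs j)" if "j \<in> {..<k} - {i\<^sub>0}" "\<forall>i. bdd (gs i)"
      "\<forall>i\<in>{..<k} - {i\<^sub>0, j}. tame (Suc T) (gs i)" for j gs
      using stage_bound [OF T(2,3) i0 that] .
  qed (use T Ds tame_mono in auto)
  then obtain Es where Es: "\<forall>i. bdd (Es i)" "\<forall>i\<in>{..<k} - {i\<^sub>0}. tame T (Es i)" "Es i\<^sub>0 = Ds i\<^sub>0"
    "cmod (Lam Ds) ^ (2 ^ (card ({..<k} - {i\<^sub>0}) * ((2 + c + N) + 1 + c))) \<le> cmod (Lam Es)" by blast
  have e: "card ({..<k} - {i\<^sub>0}) * ((2 + c + N) + 1 + c) = (k - 1) * weight" using i0 by simp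
  have "cmod (Lam fs) ^ (2 ^ (Suc (Suc l) * ((k - 1) * weight))) =
      (cmod (Lam fs) ^ (2 ^ (Suc l * ((k - 1) * weight)))) ^ (2 ^ ((k - 1) * weight))"
    unfolding power_two_power_power by (simp only: mult_Suc [of "Suc l"] add.commute)
  also have "\<dots> \<le> cmod (Lam Ds) ^ (2 ^ ((k - 1) * weight))" by (rule power_mono [OF Ds(4)]) simp
  also have "\<dots> \<le> cmod (Lam Es)" using Es(4) unfolding e .
  finally show ?case using Es(1-3) Ds(3) by (intro exI [of _ Es]) (simp add: T_def)
qed

theorem Lam_le_unorm_pow:
  assumes i0: "i\<^sub>0 < k" and s0: "s\<^sub>0 \<le> s" "s \<le> s\<^sub>0 + 1" "\<And>t. s\<^sub>0 < t \<Longrightarrow> \<not> spanned p d k al i\<^sub>0 t" and bd: "\<forall>i. bdd (fs i)"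
  shows "cmod (Lam fs) ^ (2 ^ (k * k * weight)) \<le> unorm (s\<^sub>0 + 1) (fs i\<^sub>0)"
proof -
  define l where "l = k - (s + 2)"
  have l: "l + s + 2 \<le> k" "k - 1 - l = s + 1" "Suc l \<le> k - 1" using s by (auto simp: l_def)
  obtain Ds where Ds: "\<forall>i. bdd (Ds i)" "\<forall>i\<in>{..<k} - {i\<^sub>0}. tame (s + 1) (Ds i)" "Ds i\<^sub>0 = fs i\<^sub>0"
    "cmod (Lam fs) ^ (2 ^ (Suc l * ((k - 1) * weight))) \<le> cmod (Lam Ds)"
    using stages [OF i0 bd l(1)] unfolding l(2) by blast
  \<comment> \<open>Structure of degree \<open>s + 1\<close> suffices if
    \<open>s = s\<^sub>0\<close>. Otherwise the steps are used once more, with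
    \<open>i\<^sub>0\<close> as the remaining form.\<close>
  have fin: "cmod (Lam Ds) ^ (2 ^ (1 + N)) \<le> unorm (s\<^sub>0 + 1) (fs i\<^sub>0)"
  proof (cases "s = s\<^sub>0")
    case True
    obtain u where "\<not> int p dvd dot d (al i\<^sub>0) u" using i0 by (rule nonzero)
    then have "cmod (Lam Ds) \<le> unorm (s + 1) (Ds i\<^sub>0)"
      using Ds(2) by (intro Lam_le_unorm [OF i0 _ Ds(1), where u = "\<lambda>_. u"]) (auto simp: tame_def)
    with power_two_power_antimono [OF norm_ge_zero Lam_le_1 [OF Ds(1)], of 0 "1 + N"] show ?thesis
      using True Ds(3) by simp
  next
    case False
    then have s': "s = Suc s\<^sub>0" using s0 by simp
    have "cmod (Lam Ds) ^ (2 ^ (1 + N)) \<le> unorm (Suc s\<^sub>0) (Ds i\<^sub>0)"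
      by (rule Lam_stepfun) (use i0 s s' s0(3) Ds(1,2) in \<open>auto simp: tame_def\<close>)
    then show ?thesis using Ds(3) by simp
  qed
  have sq: "a * (a * w) + x \<le> Suc a * Suc a * w" if "x \<le> w" for a x w :: nat
    using that by (simp add: algebra_simps)
  have "Suc l * ((k - 1) * weight) + (1 + N) \<le> (k - 1) * ((k - 1) * weight) + (1 + N)"
    by (rule add_mono [OF mult_le_mono1 [OF l(3)] order_refl])
  also have "\<dots> \<le> Suc (k - 1) * Suc (k - 1) * weight" by (rule sq) simp
  finally have e: "Suc l * ((k - 1) * weight) + (1 + N) \<le> k * k * weight" using k by simp
  have "cmod (Lam fs) ^ (2 ^ (k * k * weight)) \<le> cmod (Lam fs) ^ (2 ^ (Suc l * ((k - 1) * weight) + (1 + N)))"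
    by (rule power_two_power_antimono [OF norm_ge_zero Lam_le_1 [OF bd] e])
  also have "\<dots> = (cmod (Lam fs) ^ (2 ^ (Suc l * ((k - 1) * weight)))) ^ (2 ^ (1 + N))"
    by (rule power_two_power_power [symmetric])
  also have "\<dots> \<le> cmod (Lam Ds) ^ (2 ^ (1 + N))" by (rule power_mono [OF Ds(4)]) simp
  also note fin
  finally show ?thesis .
qed

end

section \<open>Vectors over prime fields as an abelian group\<close>

text \<open>Row \<open>q\<close> consists of residues modulo \<open>q\<close>, so that one type contains \<open>\<F>\<^sub>p\<^sup>n\<close> for all \<open>p\<close> and \<open>n\<close>:
  as the functions supported on the first \<open>n\<close> entries of row \<open>p\<close>.\<close>

typedef zvec = "{g :: nat \<Rightarrow> nat \<Rightarrow> int. \<forall>q m. g q m mod int q = g q m}"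
  morphisms coord Zvec
  by (rule exI [of _ "\<lambda>_ _. 0"]) simp

lemma coord_mod [simp]: "coord a q m mod int q = coord a q m"
  using coord [of a] by simp

lemma zvec_eqI: "(\<And>q m. coord a q m = coord b q m) \<Longrightarrow> a = b"
  by (metis coord_inject ext)

lemma coord_Zvec: "(\<And>q m. g q m mod int q = g q m) \<Longrightarrow> coord (Zvec g) = g"
  by (rule Zvec_inverse) simp

instantiation zvec :: ab_group_add
begin

definition "0 = Zvec (\<lambda>_ _. 0)"
definition "a + b = Zvec (\<lambda>q m. (coord a q m + coord b q m) mod int q)"
definition "- a = Zvec (\<lambda>q m. (- coord a q m) mod int q)"
definition "a - b = Zvec (\<lambda>q m. (coord a q m - coord b q m) mod int q)"

lemma coord_zero: "coord 0 q m = 0"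
  by (simp add: zero_zvec_def coord_Zvec)

lemma coord_plus: "coord (a + b) q m = (coord a q m + coord b q m) mod int q"
  by (simp add: plus_zvec_def coord_Zvec)

lemma coord_uminus: "coord (- a) q m = (- coord a q m) mod int q"
  by (simp add: uminus_zvec_def coord_Zvec)

lemma coord_minus: "coord (a - b) q m = (coord a q m - coord b q m) mod int q"
  by (simp add: minus_zvec_def coord_Zvec)

instance
  by standard (auto intro!: zvec_eqI simp: coord_zero coord_plus coord_uminus coord_minus mod_simps add_ac)

end

definition zscale :: "int \<Rightarrow> zvec \<Rightarrow> zvec" where
  "zscale c a = Zvec (\<lambda>q m. (c * coord a q m) mod int q)"

lemma coord_zscale: "coord (zscale c a) q m = (c * coord a q m) mod int q"
  by (simp add: zscale_def coord_Zvec)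

lemma coord_sum: "coord (sum f A) q m = (\<Sum>i\<in>A. coord (f i) q m) mod int q"
  by (induction A rule: infinite_finite_induct) (auto simp: coord_zero coord_plus mod_simps)

definition zspace :: "nat \<Rightarrow> nat \<Rightarrow> zvec set" where
  "zspace p n = {a. \<forall>q m. q \<noteq> p \<or> n \<le> m \<longrightarrow> coord a q m = 0}"

definition vec :: "nat \<Rightarrow> nat \<Rightarrow> (nat \<Rightarrow> int) \<Rightarrow> zvec" where
  "vec p n x = Zvec (\<lambda>q m. if q = p \<and> m < n then x m mod int p else 0)"

definition row :: "nat \<Rightarrow> nat \<Rightarrow> zvec \<Rightarrow> nat \<Rightarrow> int" where
  "row p n a = (\<lambda>m\<in>{..<n}. coord a p m)"

lemma coord_vec: "coord (vec p n x) q m = (if q = p \<and> m < n then x m mod int p else 0)"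
  by (simp add: vec_def coord_Zvec)

lemma Fp_vec_iff: "prime p \<Longrightarrow> x \<in> Fp_vec p n \<longleftrightarrow> x \<in> extensional {..<n} \<and> (\<forall>m<n. x m mod int p = x m)"
proof -
  assume "prime p"
  then have p: "0 < int p" by (simp add: prime_gt_0_nat)
  have "0 \<le> a \<and> a < int p" if "a mod int p = a" for a
    using pos_mod_bound [OF p, of a] pos_mod_sign [OF p, of a] unfolding that by simp
  then have "a \<in> carrier (Fp p) \<longleftrightarrow> a mod int p = a" for a
    by (auto simp: residue_ring_def)
  then show ?thesis by (auto simp: Fp_vec_def PiE_iff)
qed

lemma row_Fp_vec: "prime p \<Longrightarrow> row p n a \<in> Fp_vec p n"
  by (simp add: Fp_vec_iff row_def)

lemma vec_zspace: "vec p n x \<in> zspace p n"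
  by (simp add: zspace_def coord_vec)

lemma row_vec: "prime p \<Longrightarrow> x \<in> Fp_vec p n \<Longrightarrow> row p n (vec p n x) = x"
  by (auto simp: Fp_vec_iff row_def coord_vec fun_eq_iff extensional_def)

lemma vec_row: "a \<in> zspace p n \<Longrightarrow> vec p n (row p n a) = a"
  by (rule zvec_eqI) (auto simp: coord_vec row_def zspace_def)

lemma finite_Fp_vec: "finite (Fp_vec p n)"
  by (simp add: Fp_vec_def residue_ring_def finite_PiE)

lemma bij_vec: "prime p \<Longrightarrow> bij_betw (vec p n) (Fp_vec p n) (zspace p n)"
  by (rule bij_betw_byWitness [where f' = "row p n"]) (auto simp: row_vec vec_row vec_zspace row_Fp_vec)

lemma bij_vecs: "prime p \<Longrightarrow> bij_betw (\<lambda>x. \<lambda>j\<in>J. vec p n (x j)) (J \<rightarrow>\<^sub>E Fp_vec p n) (J \<rightarrow>\<^sub>E zspace p n)"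
  by (rule bij_betw_byWitness [where f' = "\<lambda>y. \<lambda>j\<in>J. row p n (y j)"])
    (auto simp: fun_eq_iff PiE_iff extensional_def row_vec [THEN fun_cong] vec_row vec_zspace row_Fp_vec)

lemma fp_space_zspace:
  assumes "prime p"
  shows "fp_space zscale (zspace p n) p"
proof
  show "finite (zspace p n)"
    using bij_vec [OF assms, of n] finite_Fp_vec [of p n] by (metis bij_betw_finite)
  show "zscale (int p) a = 0" if "a \<in> zspace p n" for a
  proof (rule zvec_eqI)
    show "coord (zscale (int p) a) q m = coord 0 q m" for q m
      using that by (cases "q = p") (auto simp: coord_zscale coord_zero zspace_def)
  qed
qed (use assms in \<open>auto intro!: zvec_eqI simp: coord_zero coord_plus coord_zscale zspace_def mod_simps algebra_simps\<close>)

section \<open>Linear forms modulo \<open>p\<close>\<close>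

lemma linear_form_coefficients:
  assumes p: "prime p" and \<phi>: "linear_form p d \<phi>"
  obtains a where "\<And>j. 0 \<le> a j \<and> a j < int p" "\<And>x. x \<in> Fp_vec p d \<Longrightarrow> \<phi> x = (\<Sum>j<d. a j * x j) mod int p"
proof -
  interpret residues "int p" "Fp p"
    using prime_gt_1_nat [OF p] by unfold_locales auto
  define e where "e l = (\<lambda>j\<in>{..<d}. if j = l then 1 else 0 :: int)" for l
  define a where "a l = \<phi> (e l)" for l
  have one: "1 < int p" using prime_gt_1_nat [OF p] by simp
  have eF: "e l \<in> Fp_vec p d" for l using one by (auto simp: Fp_vec_iff [OF p] e_def)
  have val: "\<phi> x mod int p = \<phi> x" if "x \<in> Fp_vec p d" for x
    using \<phi> that one unfolding linear_form_def by (auto simp: Pi_iff res_carrier_eq)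
  have main: "l \<le> d \<Longrightarrow> \<phi> (\<lambda>j\<in>{..<d}. if j < l then x j else 0) = (\<Sum>j<l. a j * x j) mod int p"
    if x: "x \<in> Fp_vec p d" for x l
  proof (induction l)
    case 0
    have "\<phi> (\<lambda>j\<in>{..<d}. 0 \<otimes>\<^bsub>Fp p\<^esub> x j) = 0 \<otimes>\<^bsub>Fp p\<^esub> \<phi> x"
      using \<phi> x one unfolding linear_form_def by (auto simp: res_carrier_eq)
    then show ?case by (simp add: res_mult_eq restrict_def)
  next
    case (Suc l)
    have xl: "x l mod int p = x l" using x Suc.prems by (simp add: Fp_vec_iff [OF p])
    have xl_carrier: "x l \<in> carrier (Fp p)" using mod_in_carrier [of "x l"] unfolding xl .
    let ?u = "\<lambda>j\<in>{..<d}. if j < l then x j else 0"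
    let ?v = "\<lambda>j\<in>{..<d}. x l \<otimes>\<^bsub>Fp p\<^esub> e l j"
    have u: "?u \<in> Fp_vec p d" and v: "?v \<in> Fp_vec p d"
      using x by (auto simp: Fp_vec_iff [OF p] res_mult_eq)
    have "(\<lambda>j\<in>{..<d}. if j < Suc l then x j else 0) = (\<lambda>j\<in>{..<d}. ?u j \<oplus>\<^bsub>Fp p\<^esub> ?v j)"
      using x xl by (auto simp: fun_eq_iff res_add_eq res_mult_eq e_def Fp_vec_iff [OF p] less_Suc_eq)
    moreover have "\<phi> (\<lambda>j\<in>{..<d}. ?u j \<oplus>\<^bsub>Fp p\<^esub> ?v j) = \<phi> ?u \<oplus>\<^bsub>Fp p\<^esub> \<phi> ?v"
      using \<phi> u v unfolding linear_form_def by blast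
    ultimately have "\<phi> (\<lambda>j\<in>{..<d}. if j < Suc l then x j else 0) = \<phi> ?u \<oplus>\<^bsub>Fp p\<^esub> \<phi> ?v"
      by (simp only:)
    also have "\<phi> ?v = x l \<otimes>\<^bsub>Fp p\<^esub> \<phi> (e l)"
      using \<phi> xl_carrier eF unfolding linear_form_def by blast
    finally show ?case
      using Suc by (simp add: res_add_eq res_mult_eq a_def mod_simps mult.commute)
  qed
  show thesis
  proof (rule that)
    have "0 \<le> \<phi> (e j) mod int p \<and> \<phi> (e j) mod int p < int p" for j using one by simp
    then show "0 \<le> a j \<and> a j < int p" for j unfolding val [OF eF] a_def .
    show "\<phi> x = (\<Sum>j<d. a j * x j) mod int p" if "x \<in> Fp_vec p d" for x
    proof -
      have "x = (\<lambda>j\<in>{..<d}. if j < d then x j else 0)"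
        using that by (auto simp: Fp_vec_iff [OF p] fun_eq_iff extensional_def)
      with main [OF that, of d] show ?thesis by simp
    qed
  qed
qed

text \<open>Both conditions depend on residues only, so vectors and coefficients can be reduced or
  lifted freely.\<close>

lemma tensor_power_in_span_iff:
  assumes p: "prime p" and j: "j < k"
    and rep: "\<And>i x. i < k \<Longrightarrow> x \<in> Fp_vec p d \<Longrightarrow> \<Phi> i x = (\<Sum>q<d. a i q * x q) mod int p"
  shows "tensor_power_in_span p d k \<Phi> j t \<longleftrightarrow> spanned p d k a j t"
proof -
  interpret residues "int p" "Fp p"
    using prime_gt_1_nat [OF p] by unfold_locales auto
  have tp: "tensor_power p t (\<Phi> i) v = (\<Prod>r<t. dot d (a i) (v r)) mod int p"
    if "i < k" "v \<in> {..<t} \<rightarrow>\<^sub>E Fp_vec p d" for i v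
  proof -
    have "tensor_power p t (\<Phi> i) v = (\<Otimes>\<^bsub>Fp p\<^esub>r\<in>{..<t}. dot d (a i) (v r) mod int p)"
      unfolding tensor_power_def by (rule finprod_cong) (use that rep in \<open>auto simp: dot_def PiE_iff simp_implies_def\<close>)
    then show ?thesis by (simp add: prod_cong)
  qed
  have eq: "tensor_power p t (\<Phi> j) v = (\<Oplus>\<^bsub>Fp p\<^esub>i\<in>{..<k} - {j}. c i mod int p \<otimes>\<^bsub>Fp p\<^esub> tensor_power p t (\<Phi> i) v) \<longleftrightarrow>
      int p dvd (\<Prod>r<t. dot d (a j) (v r)) - (\<Sum>i\<in>{..<k} - {j}. c i * (\<Prod>r<t. dot d (a i) (v r)))"
    if v: "v \<in> {..<t} \<rightarrow>\<^sub>E Fp_vec p d" for c v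
  proof -
    have "(\<Oplus>\<^bsub>Fp p\<^esub>i\<in>{..<k} - {j}. c i mod int p \<otimes>\<^bsub>Fp p\<^esub> tensor_power p t (\<Phi> i) v) =
        (\<Oplus>\<^bsub>Fp p\<^esub>i\<in>{..<k} - {j}. (c i * (\<Prod>r<t. dot d (a i) (v r))) mod int p)"
      by (rule finsum_cong) (auto simp: tp [OF _ v] mult_cong simp_implies_def)
    also have "\<dots> = (\<Sum>i\<in>{..<k} - {j}. c i * (\<Prod>r<t. dot d (a i) (v r))) mod int p"
      by (simp add: sum_cong)
    finally show ?thesis by (simp add: tp [OF j v] mod_eq_dvd_iff)
  qed
  show ?thesis
  proof
    assume "tensor_power_in_span p d k \<Phi> j t"
    then obtain c where c: "c \<in> {..<k} - {j} \<rightarrow> carrier (Fp p)" "\<forall>v \<in> {..<t} \<rightarrow>\<^sub>E Fp_vec p d.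
        tensor_power p t (\<Phi> j) v = (\<Oplus>\<^bsub>Fp p\<^esub>i\<in>{..<k} - {j}. c i \<otimes>\<^bsub>Fp p\<^esub> tensor_power p t (\<Phi> i) v)"
      unfolding tensor_power_in_span_def by blast
    have cm: "c i mod int p = c i" if "i \<in> {..<k} - {j}" for i
      using c(1) that by (auto simp: Pi_iff res_carrier_eq)
    have "int p dvd (\<Prod>r<t. dot d (a j) (u r)) - (\<Sum>i\<in>{..<k} - {j}. c i * (\<Prod>r<t. dot d (a i) (u r)))" for u
    proof -
      define v where "v = (\<lambda>r\<in>{..<t}. \<lambda>q\<in>{..<d}. u r q mod int p)"
      have v: "v \<in> {..<t} \<rightarrow>\<^sub>E Fp_vec p d"
        by (auto simp: v_def Fp_vec_iff [OF p])
      have dv: "[dot d (a i) (u r) = dot d (a i) (v r)] (mod int p)" if "r < t" for i r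
        unfolding dot_def v_def using that
        by (intro Cong.cong_sum cong_mult cong_refl) (simp add: cong_def)
      have pv: "[(\<Prod>r<t. dot d (a i) (u r)) = (\<Prod>r<t. dot d (a i) (v r))] (mod int p)" for i
        by (rule Cong.cong_prod) (use dv in auto)
      have "(\<Oplus>\<^bsub>Fp p\<^esub>i\<in>{..<k} - {j}. c i mod int p \<otimes>\<^bsub>Fp p\<^esub> tensor_power p t (\<Phi> i) v) =
          (\<Oplus>\<^bsub>Fp p\<^esub>i\<in>{..<k} - {j}. c i \<otimes>\<^bsub>Fp p\<^esub> tensor_power p t (\<Phi> i) v)"
        by (rule finsum_cong) (auto simp: cm tp [OF _ v] res_mult_eq simp_implies_def)
      with bspec [OF c(2) v] eq [OF v, of c] have
        "int p dvd (\<Prod>r<t. dot d (a j) (v r)) - (\<Sum>i\<in>{..<k} - {j}. c i * (\<Prod>r<t. dot d (a i) (v r)))" by simp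
      moreover have "[(\<Prod>r<t. dot d (a j) (u r)) - (\<Sum>i\<in>{..<k} - {j}. c i * (\<Prod>r<t. dot d (a i) (u r))) =
          (\<Prod>r<t. dot d (a j) (v r)) - (\<Sum>i\<in>{..<k} - {j}. c i * (\<Prod>r<t. dot d (a i) (v r)))] (mod int p)"
        by (intro cong_diff Cong.cong_sum pv cong_mult [OF cong_refl])
      ultimately show ?thesis by (simp add: cong_dvd_iff)
    qed
    then show "spanned p d k a j t" unfolding spanned_def by blast
  next
    assume "spanned p d k a j t"
    then obtain c where c: "\<And>u. int p dvd (\<Prod>r<t. dot d (a j) (u r)) - (\<Sum>i\<in>{..<k} - {j}. c i * (\<Prod>r<t. dot d (a i) (u r)))"
      unfolding spanned_def by blast
    then show "tensor_power_in_span p d k \<Phi> j t"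
      unfolding tensor_power_in_span_def using eq
      by (intro bexI [of _ "\<lambda>i. c i mod int p"]) auto
  qed
qed

section \<open>Transfer to the counting operator and the Gowers norms\<close>

lemma gowers_norm_eq_unorm:
  assumes p: "prime p" and f: "\<And>x. x \<in> Fp_vec p n \<Longrightarrow> F (vec p n x) = f x"
  shows "gowers_norm p n t f = fp_space.unorm (zspace p n) t F"
proof -
  interpret residues "int p" "Fp p"
    using prime_gt_1_nat [OF p] by unfold_locales auto
  interpret fp_space zscale "zspace p n" p by (rule fp_space_zspace [OF p])
  let ?b = "\<lambda>(x, h). (vec p n x, \<lambda>r\<in>{..<t}. vec p n (h r))"
  have bij: "bij_betw ?b (Fp_vec p n \<times> ({..<t} \<rightarrow>\<^sub>E Fp_vec p n)) (zspace p n \<times> Y t)"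
    unfolding Y_def using bij_betw_map_prod [OF bij_vec [OF p, of n] bij_vecs [OF p, of n "{..<t}"]]
    by (simp add: map_prod_def)
  have pt: "F (vec p n x + (\<Sum>r\<in>W. (\<lambda>r\<in>{..<t}. vec p n (h r)) r)) =
      f (\<lambda>m\<in>{..<n}. x m \<oplus>\<^bsub>Fp p\<^esub> (\<Oplus>\<^bsub>Fp p\<^esub>r\<in>W. h r m))"
    if x: "x \<in> Fp_vec p n" and h: "h \<in> {..<t} \<rightarrow>\<^sub>E Fp_vec p n" and W: "W \<subseteq> {..<t}" for x h W
  proof -
    let ?z = "\<lambda>m\<in>{..<n}. x m \<oplus>\<^bsub>Fp p\<^esub> (\<Oplus>\<^bsub>Fp p\<^esub>r\<in>W. h r m)"
    have hm: "h r m mod int p = h r m" if "r \<in> W" "m < n" for r m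
      using h W that Fp_vec_iff [OF p, of "h r" n] by (auto simp: PiE_iff)
    have hc: "h r m \<in> carrier (Fp p)" if "r \<in> W" "m < n" for r m
      using mod_in_carrier [of "h r m"] unfolding hm [OF that] .
    have fin: "finite W" using W finite_subset by blast
    have sm: "(\<Oplus>\<^bsub>Fp p\<^esub>r\<in>W. h r m) = (\<Sum>r\<in>W. h r m) mod int p" if "m < n" for m
    proof -
      have "(\<Oplus>\<^bsub>Fp p\<^esub>r\<in>W. h r m) = (\<Oplus>\<^bsub>Fp p\<^esub>r\<in>W. h r m mod int p)"
        by (rule finsum_cong) (use hm hc that in \<open>auto simp: simp_implies_def\<close>)
      then show ?thesis by (simp add: sum_cong fin)
    qed
    have "vec p n x + (\<Sum>r\<in>W. (\<lambda>r\<in>{..<t}. vec p n (h r)) r) = vec p n ?z"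
    proof (rule zvec_eqI)
      fix q m
      have "(\<Sum>r\<in>W. coord ((\<lambda>r\<in>{..<t}. vec p n (h r)) r) q m) = (\<Sum>r\<in>W. coord (vec p n (h r)) q m)"
        by (intro sum.cong refl) (use W in auto)
      moreover have "(\<Sum>r\<in>W. coord (vec p n (h r)) q m) = (\<Sum>r\<in>W. h r m)" if "q = p" "m < n"
        by (intro sum.cong refl) (use that hm in \<open>simp add: coord_vec\<close>)
      ultimately show "coord (vec p n x + (\<Sum>r\<in>W. (\<lambda>r\<in>{..<t}. vec p n (h r)) r)) q m = coord (vec p n ?z) q m"
        unfolding coord_plus coord_sum by (cases "q = p \<and> m < n") (auto simp: coord_vec sm res_add_eq mod_simps)
    qed
    moreover have "?z \<in> Fp_vec p n" by (simp add: Fp_vec_iff [OF p] res_add_eq)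
    ultimately show ?thesis using f by simp
  qed
  have "gow t F = expect (Fp_vec p n \<times> ({..<t} \<rightarrow>\<^sub>E Fp_vec p n)) (\<lambda>xh. (\<lambda>(x, h). \<Prod>W\<in>Pow {..<t}. (cnj ^^ card W)
      (F (x + (\<Sum>r\<in>W. h r)))) (?b xh))"
    unfolding gow_def by (rule expect_bij [OF bij, symmetric])
  also have "\<dots> = expect (Fp_vec p n \<times> ({..<t} \<rightarrow>\<^sub>E Fp_vec p n)) (\<lambda>(x, h). \<Prod>W\<in>Pow {..<t}. (cnj ^^ card W)
          (f (\<lambda>m\<in>{..<n}. x m \<oplus>\<^bsub>Fp p\<^esub> (\<Oplus>\<^bsub>Fp p\<^esub>r\<in>W. h r m))))"
    by (rule expect_cong [OF refl]) (clarsimp simp del: restrict_apply simp: pt intro!: prod.cong)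
  finally show ?thesis by (simp add: gowers_norm_def unorm_def)
qed

lemma Lambda_eq_expect:
  assumes p: "prime p"
    and rep: "\<And>i x. i < k \<Longrightarrow> x \<in> Fp_vec p d \<Longrightarrow> \<Phi> i x = (\<Sum>q<d. a i q * x q) mod int p"
    and f: "\<And>i x. i < k \<Longrightarrow> x \<in> Fp_vec p n \<Longrightarrow> F i (vec p n x) = f i x"
  shows "Lambda p n d k \<Phi> f = expect ({..<d} \<rightarrow>\<^sub>E zspace p n) (\<lambda>y. \<Prod>i<k. F i (\<Sum>q<d. zscale (a i q) (y q)))"
proof -
  have pt: "F i (\<Sum>q<d. zscale (a i q) ((\<lambda>j\<in>{..<d}. vec p n (x j)) q)) = f i (\<lambda>m\<in>{..<n}. \<Phi> i (\<lambda>j\<in>{..<d}. x j m))"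
    if i: "i < k" and x: "x \<in> {..<d} \<rightarrow>\<^sub>E Fp_vec p n" for i x
  proof -
    let ?z = "\<lambda>m\<in>{..<n}. \<Phi> i (\<lambda>j\<in>{..<d}. x j m)"
    have col: "(\<lambda>j\<in>{..<d}. x j m) \<in> Fp_vec p d" if "m < n" for m
      using x that by (auto simp: Fp_vec_iff [OF p] PiE_iff)
    have val: "?z m = (\<Sum>q<d. a i q * x q m) mod int p" if "m < n" for m
      using that rep [OF i col] by simp
    have "(\<Sum>q<d. zscale (a i q) ((\<lambda>j\<in>{..<d}. vec p n (x j)) q)) = vec p n ?z"
    proof (rule zvec_eqI)
      fix q m
      show "coord (\<Sum>q<d. zscale (a i q) ((\<lambda>j\<in>{..<d}. vec p n (x j)) q)) q m = coord (vec p n ?z) q m"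
      proof (cases "q = p \<and> m < n")
        case True
        then show ?thesis using val [of m] by (simp add: coord_sum coord_zscale coord_vec mod_simps mod_sum_eq)
      qed (auto simp: coord_sum coord_zscale coord_vec)
    qed
    moreover have "?z \<in> Fp_vec p n" using val by (auto simp: Fp_vec_iff [OF p] rep [OF i col])
    ultimately show ?thesis using f [OF i] by simp
  qed
  have "expect ({..<d} \<rightarrow>\<^sub>E zspace p n) (\<lambda>y. \<Prod>i<k. F i (\<Sum>q<d. zscale (a i q) (y q))) =
      expect ({..<d} \<rightarrow>\<^sub>E Fp_vec p n) (\<lambda>x. \<Prod>i<k. F i (\<Sum>q<d. zscale (a i q) ((\<lambda>j\<in>{..<d}. vec p n (x j)) q)))"
    by (rule expect_bij [OF bij_vecs [OF p], symmetric])
  also have "\<dots> = Lambda p n d k \<Phi> f"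
    unfolding Lambda_def by (rule expect_cong [OF refl], rule prod.cong [OF refl]) (use pt in auto)
  finally show ?thesis by simp
qed

section \<open>The exponent\<close>

text \<open>\<open>e\<close> counts binary digits and \<open>N\<close> is the logarithm of the path
  length. The factor 10 makes \<open>ln (10 * L)\<close> at least 2, so that its logarithm is
  positive.\<close>

lemma exponent_bound:
  fixes L :: real and k :: nat
  assumes L: "1 \<le> L" and k: "2 \<le> k"
  obtains e N :: nat where "2 * L\<^sup>2 < 2 ^ e" "k * (k * Suc e + 2) \<le> 2 ^ N"
    "real (k * k * (3 + 2 * (25 * k + 85) + N)) \<le> 300 * real k ^ 3 * (ln (real k) + ln (ln (10 * L)))"
proof -
  define E where "E = ln (10 * L)"
  define e where "e = nat \<lceil>log 2 (2 * L\<^sup>2)\<rceil> + 1"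
  define X where "X = real (k * (k * Suc e + 2))"
  define N where "N = nat \<lceil>log 2 X\<rceil>"
  have "(exp (1 / 2 :: real))\<^sup>2 \<le> 2\<^sup>2" using exp_le by (simp add: exp_double [symmetric])
  then have "exp (1 / 2 :: real) \<le> 2" by (rule power2_le_imp_le) simp
  then have ln2: "1 / 2 \<le> ln (2::real)" by (subst ln_ge_iff) auto
  have log2_le: "log 2 x \<le> 2 * ln x" if "1 \<le> x" for x :: real
  proof -
    from that ln2 have "ln x \<le> (2 * ln x) * ln 2" using mult_left_mono [of "1 / 2" "ln 2" "2 * ln x"] by simp
    then show ?thesis by (simp add: log_def field_simps)
  qed
  have "exp (2::real) = exp 1 * exp 1" by (simp add: exp_add [symmetric])
  also have "\<dots> \<le> 3 * 3" by (intro mult_mono exp_le) auto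
  finally have "exp (2::real) \<le> 10" by simp
  then have "2 \<le> ln (10::real)" by (simp add: ln_ge_iff)
  then have E: "2 + ln L \<le> E" "0 \<le> ln L" using L by (simp_all add: E_def ln_mult)
  have L2: "1 \<le> L\<^sup>2" using L by (simp add: one_le_power)
  have lL: "log 2 (2 * L\<^sup>2) = 1 + 2 * log 2 L" using L by (simp add: log_mult log_nat_power)
  have lL0: "0 \<le> log 2 L" using L by simp
  have e_ge: "log 2 (2 * L\<^sup>2) < real e" unfolding e_def using lL lL0 by linarith
  have e_le: "real e \<le> 3 + 4 * ln L" unfolding e_def using lL lL0 log2_le [OF L] by linarith
  have "2 * L\<^sup>2 = 2 powr (log 2 (2 * L\<^sup>2))" by (rule powr_log_cancel [symmetric]) (use L2 in auto)
  also have "\<dots> < 2 powr real e" using e_ge by simp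
  finally have 1: "2 * L\<^sup>2 < 2 ^ e" by (simp add: powr_realpow)
  have "X \<le> real k * (real k * (real e + 2))"
    unfolding X_def using k by (simp add: mult_left_mono algebra_simps)
  also have "\<dots> \<le> real k * (real k * (4 * E))"
    by (intro mult_left_mono) (use e_le E in auto)
  finally have X_le: "X \<le> 4 * (real k)\<^sup>2 * E" by (simp add: power2_eq_square)
  have "1 \<le> k * (k * Suc e + 2)" using k by (cases k) auto
  then have X1: "1 \<le> X" using of_nat_mono [of 1 "k * (k * Suc e + 2)", where 'a = real] by (simp only: X_def of_nat_1)
  have "X = 2 powr (log 2 X)" by (rule powr_log_cancel [symmetric]) (use X1 in auto)
  also have "\<dots> \<le> 2 powr real N" unfolding N_def using X1 by (intro powr_mono) auto
  finally have "X \<le> 2 ^ N" by (simp add: powr_realpow)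
  then have 2: "k * (k * Suc e + 2) \<le> 2 ^ N" unfolding X_def by (metis of_nat_le_iff of_nat_numeral of_nat_power)
  have "real N \<le> log 2 X + 1" unfolding N_def using X1 by simp
  also have "log 2 X \<le> log 2 (4 * (real k)\<^sup>2 * E)" using X1 X_le by (intro log_mono) auto
  also have "\<dots> = 2 + 2 * log 2 (real k) + log 2 E"
    using k E log_nat_power [of 2 2 2] by (simp add: log_mult log_nat_power)
  also have "\<dots> \<le> 2 + 2 * (2 * ln (real k)) + 2 * ln E"
    using log2_le [of "real k"] log2_le [of E] k E by simp
  finally have N_le: "real N \<le> 3 + 4 * ln (real k) + 2 * ln E" by simp
  have "1 / 2 \<le> ln (real k)"
    using ln2 k ln_le_cancel_iff [of 2 "real k"] by linarith
  then have K: "1 \<le> real k * ln (real k)" "real k \<le> 2 * (real k * ln (real k))" "ln (real k) \<le> real k * ln (real k)"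
    using k mult_mono [of 2 "real k" "1 / 2" "ln (real k)"] mult_left_mono [of "1 / 2" "ln (real k)" "real k"]
      mult_right_mono [of 1 "real k" "ln (real k)"] by auto
  have KE: "2 * ln E \<le> real k * ln E" "0 \<le> real k * ln E" using k E by (auto intro!: mult_right_mono)
  \<comment> \<open>The terms \<open>176 + 50 * k + 4 * ln k\<close> are at most
    \<open>(176 + 100 + 4) * k * ln k\<close>.\<close>
  have "real (3 + 2 * (25 * k + 85) + N) \<le> 300 * (real k * ln (real k)) + 300 * (real k * ln E)"
    using N_le K KE by simp
  then have "real (k * k) * real (3 + 2 * (25 * k + 85) + N) \<le> real (k * k) * (300 * (real k * ln (real k)) + 300 * (real k * ln E))"
    by (rule mult_left_mono) simp
  then have 3: "real (k * k * (3 + 2 * (25 * k + 85) + N)) \<le> 300 * real k ^ 3 * (ln (real k) + ln (ln (10 * L)))"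
    unfolding E_def by (simp add: algebra_simps power3_eq_cube)
  from 1 2 3 show thesis by (rule that)
qed

lemma le_powr_of_power_le:
  fixes x y :: real
  assumes "0 \<le> x" "x ^ (2 ^ m) \<le> y"
  shows "x \<le> y powr (2 powr (- real m))"
proof (cases "x = 0")
  case False
  with assms have x: "0 < x" by simp
  have "x = x powr (real (2 ^ m) * 2 powr (- real m))"
    using x by (simp add: powr_minus powr_realpow)
  also have "\<dots> = (x ^ (2 ^ m)) powr (2 powr (- real m))"
    using x by (simp add: powr_powr [symmetric] powr_realpow [of x "2 ^ m", simplified])
  also have "\<dots> \<le> y powr (2 powr (- real m))"
    using assms(2) x by (intro powr_mono2) auto
  finally show ?thesis .
qed simp

section \<open>Gowers norm control\<close>

lemma gowers_control_of_coefficients: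
  fixes L :: real
  assumes p: "prime p" and fin: "\<And>i. i < k \<Longrightarrow> finite_s p d k \<Phi> i" and i0: "i\<^sub>0 < k"
    and sys: "s_system p d k \<Phi> \<le> s_form p d k \<Phi> i\<^sub>0 + 1"
    and rep: "\<And>i x. i < k \<Longrightarrow> x \<in> Fp_vec p d \<Longrightarrow> \<Phi> i x = (\<Sum>q<d. a i q * x q) mod int p"
    and L: "\<And>i q. i < k \<Longrightarrow> q < d \<Longrightarrow> real_of_int \<bar>a i q\<bar> \<le> L"
  shows "\<exists>M::real. M \<ge> 0 \<and> M \<le> 300 * real k ^ 3 * (ln (real k) + ln (ln (10 * L))) \<and> gowers_control p d k \<Phi> i\<^sub>0 M"
proof -
  define s where "s = s_system p d k \<Phi>"
  define s0 where "s0 = s_form p d k \<Phi> i\<^sub>0"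
  have sp: "tensor_power_in_span p d k \<Phi> j t \<longleftrightarrow> spanned p d k a j t" if "j < k" for j t
    using tensor_power_in_span_iff [OF p that rep] .
  have ns: "\<not> spanned p d k a j t" if "j < k" "s_form p d k \<Phi> j < t" for j t
  proof
    assume "spanned p d k a j t"
    then have "t \<le> s_form p d k \<Phi> j"
      unfolding s_form_def
      using le_cSup_finite [OF fin [OF that(1), unfolded finite_s_def], of t] sp [OF that(1)] by blast
    with that(2) show False by simp
  qed
  have le_s: "s_form p d k \<Phi> j \<le> s" if "j < k" for j
    unfolding s_def s_system_def using that by (intro Max_ge) auto
  obtain q where q: "q < d" "\<not> int p dvd a i\<^sub>0 q"
    using not_spanned_nonzero [OF ns [OF i0 lessI]] by blast
  have "1 \<le> \<bar>a i\<^sub>0 q\<bar>" using q(2) by (cases "a i\<^sub>0 q = 0") auto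
  then have L1: "1 \<le> L" using L [OF i0 q(1)] by linarith
  \<comment> \<open>Extension by zero makes the functions bounded at all indices and all points, as
    \<open>bdd\<close> demands.\<close>
  define F where "F n f i v = (if i < k \<and> v \<in> zspace p n then f i (row p n v) else 0)"
    for n and f :: "nat \<Rightarrow> (nat \<Rightarrow> int) \<Rightarrow> complex" and i v
  have F_vec: "F n f i (vec p n x) = f i x" if "i < k" "x \<in> Fp_vec p n" for n f i x
    using that by (simp add: F_def vec_zspace row_vec [OF p])
  have F_bdd: "\<forall>i. bdd (F n f i)" if "\<forall>i<k. one_bounded p n (f i)" for n f
    using that row_Fp_vec [OF p] by (auto simp: F_def one_bounded_def)
  have control: "gowers_control p d k \<Phi> i\<^sub>0 (real m)"
    if *: "\<And>n f. \<forall>i<k. one_bounded p n (f i) \<Longrightarrow>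
      cmod (expect ({..<d} \<rightarrow>\<^sub>E zspace p n) (\<lambda>y. \<Prod>i<k. F n f i (\<Sum>q<d. zscale (a i q) (y q)))) ^ (2 ^ m)
        \<le> fp_space.unorm (zspace p n) (s0 + 1) (F n f i\<^sub>0)" for m
    unfolding gowers_control_def s0_def [symmetric]
  proof (intro allI impI le_powr_of_power_le)
    fix n f assume "\<forall>i<k. one_bounded p n (f i)"
    note bound = * [OF this]
    have "Lambda p n d k \<Phi> f = expect ({..<d} \<rightarrow>\<^sub>E zspace p n) (\<lambda>y. \<Prod>i<k. F n f i (\<Sum>q<d. zscale (a i q) (y q)))"
      by (rule Lambda_eq_expect [OF p rep]) (auto simp: F_vec)
    moreover have "gowers_norm p n (s0 + 1) (f i\<^sub>0) = fp_space.unorm (zspace p n) (s0 + 1) (F n f i\<^sub>0)"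
      by (rule gowers_norm_eq_unorm [OF p]) (auto simp: F_vec i0)
    ultimately show "cmod (Lambda p n d k \<Phi> f) ^ (2 ^ m) \<le> gowers_norm p n (s0 + 1) (f i\<^sub>0)"
      using bound by (simp only:)
  qed simp
  show ?thesis
  proof (cases "k = 1")
    \<comment> \<open>A single form: nothing is spanned, \<open>s_form\<close> is
      \<open>Sup {} = 0\<close>, and the norm of degree 1 bounds the average with
      \<open>M = 0\<close>.\<close>
    case True
    have none: "\<not> spanned p d k a i\<^sub>0 t" for t
    proof
      assume "spanned p d k a i\<^sub>0 t"
      moreover have "{..<k} - {i\<^sub>0} = {}" using True i0 by auto
      ultimately have "\<forall>u. int p dvd (\<Prod>r<t. dot d (a i\<^sub>0) (u r))"
        by (simp add: spanned_def)
      then have "int p dvd (\<Prod>r<t. dot d (a i\<^sub>0) (unit q))" by (rule spec)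
      with q show False using prime_dvd_power [of "int p" "a i\<^sub>0 q" t] p by simp
    qed
    then have "s0 = 0" using sp [OF i0] by (simp add: s0_def s_form_def)
    have "gowers_control p d k \<Phi> i\<^sub>0 (real 0)"
    proof (rule control)
      fix n f assume f: "\<forall>i<k. one_bounded p n (f i)"
      interpret fp_space zscale "zspace p n" p by (rule fp_space_zspace [OF p])
      interpret form_system zscale "zspace p n" p d k 0 a
        by unfold_locales (use none True i0 in auto)
      have "cmod (Lam (F n f)) \<le> unorm 1 (F n f i\<^sub>0)"
        by (rule Lam_le_unorm [OF i0 _ F_bdd [OF f], where u = "\<lambda>_. unit q"]) (use q True i0 in auto)
      then show "cmod (expect ({..<d} \<rightarrow>\<^sub>E zspace p n) (\<lambda>y. \<Prod>i<k. F n f i (\<Sum>q<d. zscale (a i q) (y q)))) ^ (2 ^ 0)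
        \<le> unorm (s0 + 1) (F n f i\<^sub>0)"
        using \<open>s0 = 0\<close> by (simp add: Lam_def Y_def lc_def)
    qed
    moreover have "0 \<le> ln (ln (10 * L))"
    proof -
      have "exp 1 \<le> (10::real)" using exp_le by linarith
      then have "1 \<le> ln (10 * L)" using L1 by (subst ln_ge_iff) auto
      then show ?thesis by simp
    qed
    ultimately show ?thesis using True by (intro exI [of _ 0]) simp
  next
    case False
    then have k: "2 \<le> k" using i0 by simp
    \<comment> \<open>Otherwise \<open>s\<close> is positive, hence a spanned exponent that is
      really attained, and at least \<open>k - 1\<close>, against
      \<open>not_spanned_large\<close>.\<close>
    have s: "s + 2 \<le> k"
    proof (rule ccontr)
      assume ge: "\<not> ?thesis"
      have "s \<in> s_form p d k \<Phi> ` {..<k}"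
        unfolding s_def s_system_def using i0 by (intro Max_in) auto
      then obtain j where j: "j < k" "s = s_form p d k \<Phi> j" by auto
      let ?X = "{t. tensor_power_in_span p d k \<Phi> j t}"
      have ne: "?X \<noteq> {}"
        using j(2) ge k by (auto simp: s_form_def simp del: Collect_empty_eq)
      then have "s_form p d k \<Phi> j \<in> ?X"
        using fin [OF j(1)] unfolding s_form_def finite_s_def by (metis Max_in cSup_eq_Max)
      then have "spanned p d k a j s" using sp j by simp
      moreover have "\<not> spanned p d k a j s"
        using not_spanned_large [OF p ns [OF j(1) lessI] _ j(1)] ge k by simp
      ultimately show False by contradiction
    qed
    obtain e N where eN: "2 * L\<^sup>2 < 2 ^ e" "k * (k * Suc e + 2) \<le> 2 ^ N"
      "real (k * k * (3 + 2 * (25 * k + 85) + N)) \<le> 300 * real k ^ 3 * (ln (real k) + ln (ln (10 * L)))"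
      using exponent_bound [OF L1 k] by blast
    define B where "B = \<lfloor>L\<rfloor>"
    have "real_of_int (2 * B\<^sup>2) \<le> 2 * L\<^sup>2"
      using L1 by (simp add: B_def power_mono)
    with eN(1) have "real_of_int (2 * B\<^sup>2) < real_of_int (2 ^ e)" by simp
    then have B: "2 * B\<^sup>2 < 2 ^ e" by (simp only: of_int_less_iff)
    have "gowers_control p d k \<Phi> i\<^sub>0 (real (k * k * (3 + 2 * (25 * k + 85) + N)))"
    proof (rule control)
      fix n f assume f: "\<forall>i<k. one_bounded p n (f i)"
      interpret fp_space zscale "zspace p n" p by (rule fp_space_zspace [OF p])
      interpret bounded_form_system zscale "zspace p n" p d k s a B e N
      proof unfold_locales
        show "\<not> spanned p d k a j t" if "j < k" "s < t" for j t
          using ns [OF that(1)] le_s [OF that(1)] that(2) by simp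
        show "\<bar>a i q\<bar> \<le> B" if "i < k" "q < d" for i q
          using L [OF that] by (simp add: B_def le_floor_iff)
      qed (use k s B eN in auto)
      have "cmod (Lam (F n f)) ^ (2 ^ (k * k * (3 + 2 * (25 * k + 85) + N))) \<le> unorm (s0 + 1) (F n f i\<^sub>0)"
        by (rule Lam_le_unorm_pow [OF i0 _ _ _ F_bdd [OF f]]) (use i0 le_s sys ns in \<open>auto simp: s0_def s_def\<close>)
      then show "cmod (expect ({..<d} \<rightarrow>\<^sub>E zspace p n) (\<lambda>y. \<Prod>i<k. F n f i (\<Sum>q<d. zscale (a i q) (y q))))
          ^ (2 ^ (k * k * (3 + 2 * (25 * k + 85) + N))) \<le> unorm (s0 + 1) (F n f i\<^sub>0)"
        by (simp add: Lam_def Y_def lc_def)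
    qed
    with eN(3) show ?thesis by (intro exI conjI) auto
  qed
qed

theorem theorem1p8:
  "\<exists>C::real. C > 0 \<and>
     (\<forall>(p::nat) (d::nat) (k::nat) (\<Phi> :: nat \<Rightarrow> (nat \<Rightarrow> int) \<Rightarrow> int) (i\<^sub>0::nat).
        prime p \<longrightarrow>
        (\<forall>i<k. linear_form p d (\<Phi> i)) \<longrightarrow>
        (\<forall>i<k. finite_s p d k \<Phi> i) \<longrightarrow>
        i\<^sub>0 < k \<longrightarrow>
        s_system p d k \<Phi> \<le> s_form p d k \<Phi> i\<^sub>0 + 1 \<longrightarrow>
        (\<exists>M::real. M \<ge> 0 \<and> gowers_control p d k \<Phi> i\<^sub>0 M) \<and>
        (\<forall>(a :: nat \<Rightarrow> nat \<Rightarrow> int) (L::real).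
           (\<forall>i<k. \<forall>x\<in>Fp_vec p d. \<Phi> i x = (\<Sum>j<d. a i j * x j) mod int p) \<longrightarrow>
           (\<forall>i<k. \<forall>j<d. real_of_int \<bar>a i j\<bar> \<le> L) \<longrightarrow>
           (\<exists>M::real. M \<ge> 0 \<and>
              M \<le> C * real k ^ 3 * (ln (real k) + ln (ln (10 * L))) \<and>
              gowers_control p d k \<Phi> i\<^sub>0 M)))"
proof (rule exI [of _ 300], intro conjI allI impI)
  fix p d k :: nat and \<Phi> :: "nat \<Rightarrow> (nat \<Rightarrow> int) \<Rightarrow> int" and i\<^sub>0 :: nat
  assume p: "prime p" and lin: "\<forall>i<k. linear_form p d (\<Phi> i)" and fin: "\<forall>i<k. finite_s p d k \<Phi> i"
    and i0: "i\<^sub>0 < k" and sys: "s_system p d k \<Phi> \<le> s_form p d k \<Phi> i\<^sub>0 + 1"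
  note control = gowers_control_of_coefficients [OF p _ i0 sys]
  show "\<exists>M\<ge>0. M \<le> 300 * real k ^ 3 * (ln (real k) + ln (ln (10 * L))) \<and> gowers_control p d k \<Phi> i\<^sub>0 M"
    if "\<forall>i<k. \<forall>x\<in>Fp_vec p d. \<Phi> i x = (\<Sum>j<d. a i j * x j) mod int p" "\<forall>i<k. \<forall>j<d. real_of_int \<bar>a i j\<bar> \<le> L"
    for a :: "nat \<Rightarrow> nat \<Rightarrow> int" and L :: real
    using control [of a L] fin that by blast
  have "\<forall>i\<in>{..<k}. \<exists>a. (\<forall>j. 0 \<le> a j \<and> a j < int p) \<and> (\<forall>x\<in>Fp_vec p d. \<Phi> i x = (\<Sum>j<d. a j * x j) mod int p)"
    using linear_form_coefficients [OF p] lin by (metis lessThan_iff)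
  then obtain a where a: "\<And>i j. i < k \<Longrightarrow> 0 \<le> a i j \<and> a i j < int p"
    "\<And>i x. i < k \<Longrightarrow> x \<in> Fp_vec p d \<Longrightarrow> \<Phi> i x = (\<Sum>j<d. a i j * x j) mod int p"
    by (auto dest!: bchoice)
  \<comment> \<open>Without given coefficients, representatives below \<open>p\<close> are taken and
    \<open>L = p\<close>.\<close>
  have "real_of_int \<bar>a i j\<bar> \<le> real p" if "i < k" for i j
    using a(1) [OF that, of j] by simp
  with control [of a "real p"] fin a(2) show "\<exists>M\<ge>0. gowers_control p d k \<Phi> i\<^sub>0 M" by blast
qed simp

end
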